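(* Let $H\in(1/2,1)$ and let $(B^H_t)_{t\ge0}$ be a one-dimensional fractional Brownian motion with Hurst parameter $H$. For $n\ge1$ let $$\mathbb{B}^{n,H}_{0,t}:=\int_0^t\int_0^{s_n}\cdots\int_0^{s_2}\mathrm{d}B^H_{s_1}\cdots\mathrm{d}B^H_{s_{n-1}}\,\mathrm{d}B^H_{s_n}$$ be the $n$-th order iterated fractional Wiener–Itô–Skorokhod (fWIS) integral of $B^H$. Then for any $t>0$ with $t\neq1$, almost surely, $$H=\limsup_{n\to\infty}\frac{1}{2\log t}\log\left(2\left|\left(\frac n2\right)!\;\mathbb{B}^{n,H}_{0,t}\right|^{2/n}\right).$$
   Context: Fractional Brownian motion with Hurst parameter $H$ is a centered Gaussian process $(B^H_t)_{t\ge0}$ with a.s. continuous paths and covariance $R_H(s,t)=\mathbb{E}[B^H_sB^H_t]=\frac12(t^{2H}+s^{2H}-|t-s|^{2H})$. For $H>1/2$ let $\theta_H(s,t)=H(2H-1)|s-t|^{2H-2}$, so that $\int_0^t\int_0^s\theta_H(u,v)\,\mathrm{d}u\,\mathrm{d}v=R_H(s,t)$, and let $\mathcal{H}$ be the Hilbert space obtained by completing the Schwartz space $\mathcal{S}(\mathbb{R}^+)$ with respect to $\langle f,g\rangle_H=\int_0^\infty\int_0^\infty f(s)g(t)\theta_H(s,t)\,\mathrm{d}s\,\mathrm{d}t$; the indicators $1_{[0,t]}$ belong to $\mathcal{H}$. The map $1_{[0,t]}\mapsto B^H_t$ extends to a linear isometry $g\mapsto B^H(g)$ from $\mathcal{H}$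 into $L^2(\Omega)$. The fWIS integral is the Skorokhod-type integral with respect to $B^H$, i.e. the divergence operator $\delta$: for smooth cylindrical random variables $F=\varphi(B^H(g_1),\dots,B^H(g_m))$ with $g_i\in\mathcal{H}$, $\varphi\in C_b^\infty(\mathbb{R}^m)$, put $DF=\sum_i\partial_i\varphi(B^H(g_1),\dots,B^H(g_m))\,g_i$; a process $u\in L^2(\Omega;\mathcal{H})$ is integrable if there is a random variable $\delta(u)\in L^2(\Omega)$, measurable with respect to $\sigma(B^H)$, such that $\mathbb{E}[F\delta(u)]=\mathbb{E}[\langle DF,u\rangle_H]$ for all such $F$, and then $\int_0^t u_s\,\mathrm{d}B^H_s:=\delta(u1_{[0,t]})$ (when $u1_{[0,t]}$ is integrable). Iterated fWIS integrals are defined recursively by $\mathbb{B}^{0,H}_{0,t}=1$ and $\mathbb{B}^{n,H}_{0,t}=\int_0^t\mathbb{B}^{n-1,H}_{0,s}\,\mathrm{d}B^H_s$. For a nonnegative integer $n$, $(n/2)!:=\Gamma(n/2+1)$. *)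

theory Defs
  imports "HOL-Probability.Probability"
begin

section \<open>Fractional Brownian motion\<close>

text \<open>Constants count as (degenerate) Gaussian random variables.\<close>

definition gaussian_rv :: "'a measure \<Rightarrow> ('a \<Rightarrow> real) \<Rightarrow> bool" where
  "gaussian_rv M X \<longleftrightarrow> X \<in> borel_measurable M \<and>
     (\<exists>\<mu> \<sigma>. (\<sigma> = 0 \<and> (AE \<omega> in M. X \<omega> = \<mu>)) \<or>
            (\<sigma> > 0 \<and> distributed M lborel X (\<lambda>x. ennreal (normal_density \<mu> \<sigma> x))))"

definition square_integrable :: "'a measure \<Rightarrow> ('a \<Rightarrow> 'b::real_normed_vector) \<Rightarrow> bool" where
  "square_integrable M X \<longleftrightarrow> X \<in> borel_measurable M \<and> integrable M (\<lambda>\<omega>. (norm (X \<omega>))\<^sup>2)"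

locale fractional_brownian_motion = prob_space M
  for M :: "'a measure" +
  fixes H :: real and B :: "real \<Rightarrow> 'a \<Rightarrow> real"
  assumes Hurst: "0 < H" "H < 1"
    and gaussian: "\<And>J c. finite J \<Longrightarrow> J \<subseteq> {0..} \<Longrightarrow> gaussian_rv M (\<lambda>\<omega>. \<Sum>t\<in>J. c t * B t \<omega>)"
    and centered: "\<And>t. 0 \<le> t \<Longrightarrow> expectation (B t) = 0"
    and covariance: "\<And>s t. 0 \<le> s \<Longrightarrow> 0 \<le> t \<Longrightarrow>
      expectation (\<lambda>\<omega>. B s \<omega> * B t \<omega>)
        = (t powr (2 * H) + s powr (2 * H) - \<bar>t - s\<bar> powr (2 * H)) / 2"
    and continuous_paths: "AE \<omega> in M. continuous_on {0..} (\<lambda>t. B t \<omega>)"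


section \<open>The pre-Hilbert structure on Schwartz functions\<close>

text \<open>Schwartz functions on the closed half-line, with one-sided derivatives at 0; \<open>g k\<close> is the
  \<open>k\<close>-th derivative. Only the values on the half-line matter.\<close>

definition schwartz_halfline :: "(real \<Rightarrow> real) set" where
  "schwartz_halfline = {f. \<exists>g :: nat \<Rightarrow> real \<Rightarrow> real.
     (\<forall>x\<ge>0. g 0 x = f x) \<and>
     (\<forall>k. \<forall>x\<ge>0. (g k has_real_derivative g (Suc k) x) (at x within {0..})) \<and>
     (\<forall>j k. bounded ((\<lambda>x. x ^ j * g k x) ` {0..}))}"

definition theta :: "real \<Rightarrow> real \<Rightarrow> real \<Rightarrow> real" where
  "theta H s t = H * (2 * H - 1) * \<bar>s - t\<bar> powr (2 * H - 2)"

definition inner_theta :: "real \<Rightarrow> (real \<Rightarrow> real) \<Rightarrow> (real \<Rightarrow> real) \<Rightarrow> real" where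
  "inner_theta H f g = (LINT s:{0..}|lborel. (LINT t:{0..}|lborel. f s * g t * theta H s t))"


section \<open>Smooth bounded functions of finitely many variables\<close>

text \<open>A function on \<open>\<real>\<^sup>m\<close> is encoded as a function of a sequence that depends on its entries
  of index below \<open>m\<close> only. The list \<open>\<alpha>\<close> below is a multi-index, written as the sequence of
  coordinates with respect to which one differentiates.\<close>

definition partial :: "nat \<Rightarrow> ((nat \<Rightarrow> real) \<Rightarrow> real) \<Rightarrow> (nat \<Rightarrow> real) \<Rightarrow> real" where
  "partial i \<phi> x = deriv (\<lambda>y. \<phi> (x(i := y))) (x i)"

definition Cb_infinity :: "nat \<Rightarrow> ((nat \<Rightarrow> real) \<Rightarrow> real) set" where
  "Cb_infinity m = {\<phi>.
     (\<forall>x y. (\<forall>i<m. x i = y i) \<longrightarrow> \<phi> x = \<phi> y) \<and>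
     (\<forall>\<alpha>. set \<alpha> \<subseteq> {..<m} \<longrightarrow>
        (let \<psi> = foldr partial \<alpha> \<phi> in
           continuous_on UNIV \<psi> \<and> bounded (range \<psi>) \<and>
           (\<forall>i<m. \<forall>x. (\<lambda>y. \<psi> (x(i := y))) differentiable (at (x i)))))}"


section \<open>Wiener integral, divergence and iterated integrals\<close>

text \<open>The Hilbert space of the fractional Brownian motion is a complete inner product space
  \<open>'h\<close> together with an isometric embedding \<open>\<iota>\<close> of the Schwartz functions with dense
  range, i.e. a completion, which is unique up to isometric isomorphism.\<close>

locale hurst_completion =
  fixes H :: real and \<iota> :: "(real \<Rightarrow> real) \<Rightarrow> 'h::{real_inner, complete_space}"
  assumes \<iota>_linear: "\<And>f g a b. f \<in> schwartz_halfline \<Longrightarrow> g \<in> schwartz_halfline \<Longrightarrow>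
        \<iota> (\<lambda>x. a * f x + b * g x) = a *\<^sub>R \<iota> f + b *\<^sub>R \<iota> g"
    and \<iota>_isometry: "\<And>f g. f \<in> schwartz_halfline \<Longrightarrow> g \<in> schwartz_halfline \<Longrightarrow>
        inner (\<iota> f) (\<iota> g) = inner_theta H f g"
    and \<iota>_dense: "closure (\<iota> ` schwartz_halfline) = UNIV"
begin

text \<open>The element \<open>h\<close> of the completion is the one given by the function \<open>f\<close> of finite
  (absolute) \<open>\<theta>\<close>-energy. Since the image of \<open>\<iota>\<close> is dense, \<open>f\<close> determines \<open>h\<close>.\<close>

definition represents :: "(real \<Rightarrow> real) \<Rightarrow> 'h \<Rightarrow> bool" where
  "represents f h \<longleftrightarrow>
     set_borel_measurable lborel {0..} f \<and>
     set_integrable (lborel \<Otimes>\<^sub>M lborel) ({0..} \<times> {0..}) (\<lambda>(s, t). f s * f t * theta H s t) \<and>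
     (\<forall>\<phi>\<in>schwartz_halfline. inner h (\<iota> \<phi>) = inner_theta H f \<phi>)"

end

text \<open>\<open>W\<close> is the linear isometry extending \<open>1\<^bsub>[0,t]\<^esub> \<mapsto> B t\<close>; its values are random
  variables that are determined up to null sets.\<close>

locale fbm_wiener_integral =
  fractional_brownian_motion M H B + hurst_completion H \<iota>
  for M :: "'a measure" and H :: real and B :: "real \<Rightarrow> 'a \<Rightarrow> real"
    and \<iota> :: "(real \<Rightarrow> real) \<Rightarrow> 'h::{real_inner, complete_space}" +
  fixes W :: "'h \<Rightarrow> 'a \<Rightarrow> real"
  assumes W_square_integrable: "\<And>h. square_integrable M (W h)"
    and W_linear: "\<And>h k a b. AE \<omega> in M. W (a *\<^sub>R h + b *\<^sub>R k) \<omega> = a * W h \<omega> + b * W k \<omega>"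
    and W_isometry: "\<And>h. expectation (\<lambda>\<omega>. (W h \<omega>)\<^sup>2) = (norm h)\<^sup>2"
    and W_indicator: "\<And>t h. 0 \<le> t \<Longrightarrow> represents (indicator {0..t}) h \<Longrightarrow> AE \<omega> in M. W h \<omega> = B t \<omega>"
begin

definition sigma_B :: "'a measure" where
  "sigma_B = sigma (space M) {B t -` A \<inter> space M | t A. 0 \<le> t \<and> A \<in> sets borel}"

definition cylindrical ::
    "nat \<Rightarrow> ((nat \<Rightarrow> real) \<Rightarrow> real) \<Rightarrow> (nat \<Rightarrow> 'h) \<Rightarrow> 'a \<Rightarrow> real" where
  "cylindrical m \<phi> g \<omega> = \<phi> (\<lambda>i. if i < m then W (g i) \<omega> else 0)"

definition malliavin_derivative ::
    "nat \<Rightarrow> ((nat \<Rightarrow> real) \<Rightarrow> real) \<Rightarrow> (nat \<Rightarrow> 'h) \<Rightarrow> 'a \<Rightarrow> 'h" where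
  "malliavin_derivative m \<phi> g \<omega> =
     (\<Sum>i<m. partial i \<phi> (\<lambda>j. if j < m then W (g j) \<omega> else 0) *\<^sub>R g i)"

text \<open>\<open>X\<close> is (a version of) the divergence of \<open>U \<in> L\<^sup>2(\<Omega>; 'h)\<close>. As elements of \<open>L\<^sup>2\<close>
  are only determined up to null sets, so is measurability with respect to \<open>\<sigma>(B)\<close>.\<close>

definition is_divergence :: "('a \<Rightarrow> 'h) \<Rightarrow> ('a \<Rightarrow> real) \<Rightarrow> bool" where
  "is_divergence U X \<longleftrightarrow>
     square_integrable M U \<and> square_integrable M X \<and>
     (\<exists>Y \<in> borel_measurable sigma_B. AE \<omega> in M. X \<omega> = Y \<omega>) \<and>
     (\<forall>m g. \<forall>\<phi>\<in>Cb_infinity m.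
        expectation (\<lambda>\<omega>. cylindrical m \<phi> g \<omega> * X \<omega>)
          = expectation (\<lambda>\<omega>. inner (malliavin_derivative m \<phi> g \<omega>) (U \<omega>)))"

text \<open>\<open>X\<close> is (a version of) the integral of \<open>u\<close> over \<open>[0,t]\<close>: the jointly measurable
  process \<open>u 1\<^bsub>[0,t]\<^esub>\<close> is, path by path, an element of the Hilbert space, and \<open>X\<close> is its
  divergence.\<close>

definition is_fWIS_integral :: "(real \<Rightarrow> 'a \<Rightarrow> real) \<Rightarrow> real \<Rightarrow> ('a \<Rightarrow> real) \<Rightarrow> bool" where
  "is_fWIS_integral u t X \<longleftrightarrow>
     (\<lambda>(s, \<omega>). indicator {0..t} s * u s \<omega>) \<in> borel_measurable (lborel \<Otimes>\<^sub>M M) \<and>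
     (\<exists>U. (AE \<omega> in M. represents (\<lambda>s. indicator {0..t} s * u s \<omega>) (U \<omega>)) \<and> is_divergence U X)"

text \<open>\<open>I n t\<close> is (a version of) the \<open>n\<close>-th order iterated integral over \<open>[0,t]\<close>.\<close>

definition iterated_fWIS :: "(nat \<Rightarrow> real \<Rightarrow> 'a \<Rightarrow> real) \<Rightarrow> bool" where
  "iterated_fWIS I \<longleftrightarrow>
     (\<forall>t\<ge>0. \<forall>\<omega>\<in>space M. I 0 t \<omega> = 1) \<and>
     (\<forall>n. \<forall>t\<ge>0. is_fWIS_integral (I n) t (I (Suc n) t))"

end

end

theory Submission
  imports Defs "HOL-Real_Asymp.Real_Asymp" "HOL-Computational_Algebra.Fundamental_Theorem_Algebra"
begin

text \<open>The \<open>n\<close>-th iterated integral is a normalised Hermite polynomial of \<open>B t\<close>, namely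
  \<open>t\<^bsup>nH\<^esup> He\<^sub>n(B t / t\<^bsup>H\<^esup>) / n!\<close>. Tested against a cylindrical variable, its expectation is by Gaussian
  integration by parts a homogeneous polynomial of degree \<open>n\<close> in the inner products
  \<open>G\<^sub>i(t) = \<langle>g\<^sub>i, 1\<^bsub>[0,t]\<^esub>\<rangle>\<close>, whose increments are \<open>O(\<bar>t - s\<bar>\<^bsup>H\<^esup>)\<close>. As \<open>2 H > 1\<close>, the quadratic
  remainders in a Taylor expansion along a partition vanish in the limit, and the linear terms are the Riemann
  sums of the divergence. Conversely, a divergence is determined by the identities that define it, because
  the trigonometric test functions determine the finite-dimensional laws of \<open>B\<close>.

  For the growth of \<open>He\<^sub>n(x)\<close> at a fixed \<open>x\<close>, the energy of the differential equation of the Hermite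
  functions is constant up to a bounded factor and is explicit at \<open>0\<close>. It bounds \<open>He\<^sub>n(x)\<close> above, and it also
  bounds \<open>He\<^sub>n(x)\<close> below as long as \<open>x\<close> has distance at least \<open>n\<^bsup>-3\<^esup>\<close> from the zeros, since then the logarithmic
  derivative is at most \<open>n\<^sup>4\<close>. By Borel--Cantelli, almost every \<open>x\<close> has this property for all large \<open>n\<close>. Thus
  the upper limit is a limit, which is why \<open>t < 1\<close>, where the sign of \<open>ln t\<close> turns it into a lower limit, is
  covered as well.\<close>

section \<open>Normalised Hermite polynomials and their growth\<close>

text \<open>The exponent \<open>2 / n\<close> erases every factor that is polynomial in
  \<open>n\<close>, so only the exponential and factorial parts of the estimates have to be sharp.
  The separation \<open>n^-3\<close> is chosen so that the intervals around the at most
  \<open>n\<close> roots have Gaussian mass at most \<open>2 / n^2\<close>, which is summable; roots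
  are counted in the complex plane, and \<open>x\<close> is kept away from their real parts. The
  probabilistic obstacle is that a divergence is characterised only by testing, and integrals only
  up to null sets. One concrete process with continuous paths therefore serves twice: it shows that
  iterated integrals exist, and every other family is compared with it, order by order. Each
  comparison needs Fubini: equality almost surely at every time must become, almost surely, equality
  at almost every time before two integrands can define the same element of the completion. Riemann
  sums converge in the completion path by path, whereas the Taylor argument gives convergence of
  tested expectations; second moments bounded uniformly over the grids join the two. Those bounds
  use that \<open>theta\<close> is nonnegative, that is, \<open>H > 1 / 2\<close> once more.\<close>

text \<open>\<open>herm n\<close> is the probabilists' Hermite polynomial \<open>He\<^sub>n\<close> divided by \<open>n!\<close>.\<close>

fun herm :: "nat \<Rightarrow> real poly" where
  "herm 0 = 1"
| "herm (Suc 0) = [:0, 1:]"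
| "herm (Suc (Suc n)) = smult (1 / real (n + 2)) ([:0, 1:] * herm (Suc n) - herm n)"

lemma herm_rec: "real (n + 2) * poly (herm (Suc (Suc n))) x = x * poly (herm (Suc n)) x - poly (herm n) x"
  by (simp add: field_simps)

text \<open>Dividing by \<open>n!\<close> makes the family an Appell sequence: differentiation is a
  plain shift. Differentiating the recursion leaves \<open>herm (m + 1)\<close> plus the raising
  expression \<open>x * herm m - pderiv (herm m)\<close>, and the induction hypothesis turns the
  latter into a multiple of \<open>herm (m + 1)\<close>.\<close>

lemma pderiv_herm: "pderiv (herm (Suc n)) = herm n"
proof (induction n rule: less_induct)
  case (less n)
  show ?case
  proof (cases n)
    case 0
    then show ?thesis by (simp add: pderiv_pCons)
  next
    case (Suc m)
    have IH1: "pderiv (herm (Suc m)) = herm m" using less.IH[of m] Suc by simp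
    \<comment> \<open>The recursion one index lower, with \<open>herm l\<close> replaced by the
      derivative of \<open>herm m\<close>; in this form it also holds for \<open>m = 0\<close>,
      where no \<open>l\<close> exists.\<close>
    have rec: "smult (real m + 1) (herm (Suc m)) = [:0,1:] * herm m - pderiv (herm m)"
    proof (cases m)
      case 0 then show ?thesis by (simp add: pderiv_1)
    next
      case (Suc l)
      have "pderiv (herm m) = herm l" using less.IH[of l] Suc \<open>n = Suc m\<close> by simp
      moreover have "smult (real m + 1) (herm (Suc m)) = [:0,1:] * herm m - herm l"
        unfolding Suc by (simp add: add.commute smult_diff_right)
      ultimately show ?thesis by simp
    qed
    have "pderiv (herm (Suc n)) =
        smult (1 / (real m + 2)) (herm (Suc m) + ([:0,1:] * herm m - pderiv (herm m)))"
      unfolding Suc by (simp add: pderiv_smult pderiv_diff pderiv_mult pderiv_pCons IH1 add.commute smult_diff_right smult_add_right)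
    also have "\<dots> = smult (1 / (real m + 2)) (smult (real m + 2) (herm (Suc m)))"
      unfolding rec[symmetric] by (rule arg_cong[of _ _ "smult _"], rule poly_eqI) (simp add: algebra_simps del: herm.simps)
    also have "\<dots> = herm n" unfolding Suc by (simp del: herm.simps)
    finally show ?thesis .
  qed
qed

text \<open>Equivalently, \<open>herm n\<close> times the Gaussian density has derivative
  \<open>- (n + 1) * herm (n + 1)\<close> times that density. Both the energy and the integration by
  parts rest on this form.\<close>

lemma herm_deriv_rec:
  "poly (pderiv (herm n)) x = x * poly (herm n) x - real (n + 1) * poly (herm (Suc n)) x"
proof (cases n)
  case 0 then show ?thesis by (simp add: pderiv_1)
next
  case (Suc m)
  then show ?thesis using herm_rec[of m x] pderiv_herm[of m] by (simp del: herm.simps)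
qed

lemma herm_at_0: "poly (herm (2 * m)) 0 = (-1) ^ m / (2 ^ m * fact m)" "poly (herm (Suc (2 * m))) 0 = 0"
proof (induction m)
  case (Suc m)
  { case 1
    have "real (2 * m + 2) * poly (herm (2 * Suc m)) 0 = - poly (herm (2 * m)) 0"
      using herm_rec[of "2 * m" 0] by simp
    then have "poly (herm (2 * Suc m)) 0 = - ((-1) ^ m / (2 ^ m * fact m)) / real (2 * m + 2)"
      unfolding Suc.IH(1)[symmetric] using of_nat_0_less_iff[of "2 * m + 2", where 'a = real]
      by (subst eq_divide_eq) (simp add: mult.commute del: herm.simps of_nat_add of_nat_mult)
    also have "\<dots> = (-1) ^ Suc m / (2 ^ Suc m * fact (Suc m))"
      by (simp add: divide_simps)
    finally show ?case .
  next case 2 show ?case using Suc.IH by simp }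
qed simp_all

section \<open>Degree and logarithmic derivative\<close>

lemma degree_herm_le: "degree (herm n) \<le> n"
proof (induction n rule: herm.induct)
  case (3 n)
  have "degree ([:0, 1:] * herm (Suc n) - herm n) \<le> Suc (Suc n)"
    by (rule degree_diff_le) (use 3 degree_mult_le[of "[:0,1:]" "herm (Suc n)"] in auto)
  then show ?case by simp
qed simp_all

lemma herm_nonzero: "herm n \<noteq> 0"
proof
  assume "herm n = 0"
  then have "herm 0 = 0"
    by (induction n) (metis pderiv_0 pderiv_herm)+
  then show False by simp
qed

text \<open>The logarithmic derivative is the sum of \<open>1 / (x - z)\<close> over the roots with
  multiplicity, so it is at most the degree divided by the distance. Splitting off one linear factor
  at a time gives this without dividing by \<open>poly p x\<close>.\<close>

lemma norm_poly_pderiv_le: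
  fixes p :: "complex poly"
  assumes "d > 0" and "p \<noteq> 0" and "\<And>z. poly p z = 0 \<Longrightarrow> d \<le> norm (x - z)"
  shows "norm (poly (pderiv p) x) \<le> real (degree p) / d * norm (poly p x)"
  using assms(2,3)
proof (induction "degree p" arbitrary: p)
  case 0
  then obtain c where "p = [:c:]" by (metis degree_eq_zeroE)
  then show ?case by (simp add: pderiv_pCons)
next
  case (Suc n)
  then obtain a where "poly p a = 0"
    using fundamental_theorem_of_algebra[of p] constant_degree[of p] by auto
  then obtain q where q: "p = [:-a, 1:] * q" by (metis dvdE poly_eq_0_iff_dvd)
  then have q0: "q \<noteq> 0" using Suc by auto
  then have deg: "degree p = Suc (degree q)" unfolding q by (subst degree_mult_eq) auto
  have "norm (poly (pderiv q) x) \<le> real (degree q) / d * norm (poly q x)"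
    by (rule Suc(1)) (use deg q0 Suc q in auto)
  then have 1: "norm ((x - a) * poly (pderiv q) x) \<le> real (degree q) / d * norm (poly p x)"
    using mult_left_mono[of _ _ "norm (x - a)"] unfolding q norm_mult poly_mult by (fastforce simp: algebra_simps)
  have "d \<le> norm (x - a)" using Suc \<open>poly p a = 0\<close> by auto
  then have 2: "norm (poly q x) \<le> norm (poly p x) / d"
    using \<open>d > 0\<close> mult_right_mono[of d "norm (x - a)" "norm (poly q x)"]
    unfolding q poly_mult norm_mult by (simp add: pos_le_divide_eq mult.commute)
  have "poly (pderiv p) x = poly q x + (x - a) * poly (pderiv q) x"
    unfolding q pderiv_mult by (simp add: pderiv_pCons algebra_simps)
  then have "norm (poly (pderiv p) x) \<le> norm (poly q x) + norm ((x - a) * poly (pderiv q) x)"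
    by (simp add: norm_triangle_ineq)
  also have "\<dots> \<le> real (degree p) / d * norm (poly p x)"
    using add_mono[OF 2 1] deg by (simp add: add_divide_distrib ring_distribs)
  finally show ?case .
qed

text \<open>Complex coefficients make all roots available. The real parts of the roots are what a
  real random point can be kept away from, and the distance to them bounds the distance to the roots
  from below.\<close>

lemma abs_poly_pderiv_le:
  fixes p :: "real poly"
  assumes "d > 0" and "p \<noteq> 0" and "\<And>z. poly (map_poly complex_of_real p) z = 0 \<Longrightarrow> d \<le> \<bar>x - Re z\<bar>"
  shows "\<bar>poly (pderiv p) x\<bar> \<le> real (degree p) / d * \<bar>poly p x\<bar>"
proof -
  let ?P = "map_poly complex_of_real p"
  have P: "poly (map_poly complex_of_real q) (of_real x) = of_real (poly q x)" for q
    by (induction q) (auto simp: map_poly_pCons)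
  have pd: "pderiv ?P = map_poly complex_of_real (pderiv p)"
    by (rule poly_eqI) (simp add: coeff_pderiv coeff_map_poly)
  have "norm (poly (pderiv ?P) (of_real x)) \<le> real (degree ?P) / d * norm (poly ?P (of_real x))"
  proof (rule norm_poly_pderiv_le[OF \<open>d > 0\<close>])
    show "?P \<noteq> 0" using \<open>p \<noteq> 0\<close> by (simp add: map_poly_eq_0_iff)
  next
    fix z assume "poly ?P z = 0"
    then have "d \<le> \<bar>Re (of_real x - z)\<bar>" using assms(3) by auto
    then show "d \<le> norm (of_real x - z)" using abs_Re_le_cmod order_trans by blast
  qed
  moreover have "degree ?P = degree p" by (simp add: degree_map_poly)
  ultimately show ?thesis unfolding pd P by simp
qed

text \<open>Writing \<open>u = exp (- x\<^sup>2 / 4) herm (n + 1)\<close>, which solves \<open>u'' + (n + 3/2 - x\<^sup>2 / 4) u = 0\<close>, this is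
  \<open>u'\<^sup>2 + (n + 3/2 - x\<^sup>2 / 4) u\<^sup>2\<close>.\<close>

definition herm_energy :: "nat \<Rightarrow> real \<Rightarrow> real" where
  "herm_energy n x = exp (- x\<^sup>2 / 2) * ((poly (herm n) x)\<^sup>2 - x * poly (herm n) x * poly (herm (Suc n)) x
     + (real n + 3 / 2) * (poly (herm (Suc n)) x)\<^sup>2)"

text \<open>For a solution of \<open>u'' = - q u\<close> the derivative of
  \<open>u'^2 + q u^2\<close> is \<open>q' u^2\<close>. Here \<open>q' = - x / 2\<close>, so the
  large parameter \<open>n\<close> drops out.\<close>

lemma herm_energy_deriv:
  "(herm_energy n has_real_derivative - (x / 2) * exp (- x\<^sup>2 / 2) * (poly (herm (Suc n)) x)\<^sup>2) (at x)"
proof -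
  have d1: "(poly (herm (Suc n)) has_real_derivative poly (herm n) x) (at x)"
    using poly_DERIV[of "herm (Suc n)" x] by (simp add: pderiv_herm del: herm.simps)
  have d2: "(poly (herm n) has_real_derivative x * poly (herm n) x - real (n + 1) * poly (herm (Suc n)) x) (at x)"
    using poly_DERIV[of "herm n" x] by (simp add: herm_deriv_rec del: herm.simps)
  show ?thesis unfolding herm_energy_def[abs_def]
    by (rule derivative_eq_intros d1 d2 refl | simp del: herm.simps)+
      (simp add: field_simps power2_eq_square del: herm.simps)
qed

text \<open>For \<open>x^2 <= n + 1\<close> the coefficient \<open>n + 3/2 - x^2 / 4\<close> stays
  above a positive constant, so the energy dominates \<open>u^2\<close> and thereby its own
  derivative.\<close>

lemma herm_energy_lower:
  assumes "x\<^sup>2 \<le> real (Suc n)"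
  shows "exp (- x\<^sup>2 / 2) * (poly (herm (Suc n)) x)\<^sup>2 \<le> 2 * herm_energy n x"
proof -
  define a b where "a = poly (herm n) x" and "b = poly (herm (Suc n)) x"
  have "0 \<le> (a - x * b)\<^sup>2 + a\<^sup>2" by simp
  then have 1: "x * a * b \<le> a\<^sup>2 + x\<^sup>2 * b\<^sup>2 / 2" by (simp add: power2_eq_square algebra_simps)
  have "x\<^sup>2 * b\<^sup>2 \<le> real (Suc n) * b\<^sup>2" using assms by (intro mult_right_mono) auto
  moreover have "0 \<le> real n * b\<^sup>2" by simp
  ultimately have "b\<^sup>2 \<le> 2 * (a\<^sup>2 - x * a * b + (real n + 3 / 2) * b\<^sup>2)"
    using 1 zero_le_power2[of b] by (simp only: of_nat_Suc ring_distribs)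
  then have "exp (- x\<^sup>2 / 2) * b\<^sup>2 \<le> exp (- x\<^sup>2 / 2) * (2 * (a\<^sup>2 - x * a * b + (real n + 3 / 2) * b\<^sup>2))"
    by (intro mult_left_mono) auto
  then show ?thesis unfolding herm_energy_def a_def b_def by (simp add: mult_ac del: herm.simps)
qed

text \<open>Gronwall's argument along the segment from \<open>0\<close> to \<open>x\<close>: the
  derivative is at most \<open>x^2\<close> times the energy, so multiplication by
  \<open>exp (x^2 * s)\<close> or by its inverse makes the energy monotone. The resulting factor
  does not depend on \<open>n\<close>.\<close>

lemma herm_energy_ratio:
  assumes "x\<^sup>2 \<le> real (Suc n)"
  shows "exp (- x\<^sup>2) * herm_energy n 0 \<le> herm_energy n x"
    and "herm_energy n x \<le> exp (x\<^sup>2) * herm_energy n 0"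
proof -
  \<comment> \<open>Parametrising the segment by \<open>s\<close> in \<open>[0, 1]\<close> treats
    both signs of \<open>x\<close> at once.\<close>
  let ?D = "\<lambda>s. x * (- (s * x / 2) * exp (- (s * x)\<^sup>2 / 2) * (poly (herm (Suc n)) (s * x))\<^sup>2)"
  have dE: "((\<lambda>s. herm_energy n (s * x)) has_real_derivative ?D s) (at s)" for s
    using DERIV_chain[OF herm_energy_deriv DERIV_cmult_right[OF DERIV_ident, of x]]
    by (simp add: o_def mult_ac)
  have D_bound: "\<bar>?D s\<bar> \<le> x\<^sup>2 * herm_energy n (s * x)" if s: "0 \<le> s" "s \<le> 1" for s
  proof -
    have sq: "s\<^sup>2 \<le> 1" using s by (simp add: power_le_one)
    have "(s * x)\<^sup>2 \<le> x\<^sup>2" using sq by (simp add: power_mult_distrib mult_left_le_one_le)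
    then have low: "exp (- (s * x)\<^sup>2 / 2) * (poly (herm (Suc n)) (s * x))\<^sup>2 \<le> 2 * herm_energy n (s * x)"
      using assms by (intro herm_energy_lower) linarith
    have "\<bar>?D s\<bar> = (x\<^sup>2 * s / 2) * (exp (- (s * x)\<^sup>2 / 2) * (poly (herm (Suc n)) (s * x))\<^sup>2)"
      using s by (simp add: abs_mult power2_eq_square del: herm.simps)
    also have "\<dots> \<le> (x\<^sup>2 / 2) * (2 * herm_energy n (s * x))"
      by (rule mult_mono[OF _ low]) (use s in \<open>auto simp: mult_left_le\<close>)
    finally show ?thesis by simp
  qed
  have "herm_energy n (0 * x) * exp (x\<^sup>2 * 0) \<le> herm_energy n (1 * x) * exp (x\<^sup>2 * 1)"
  proof (rule DERIV_nonneg_imp_nondecreasing[of 0 1])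
    fix s :: real assume s: "0 \<le> s" "s \<le> 1"
    have "((\<lambda>s. herm_energy n (s * x) * exp (x\<^sup>2 * s)) has_real_derivative
        (?D s + x\<^sup>2 * herm_energy n (s * x)) * exp (x\<^sup>2 * s)) (at s)"
      by (rule derivative_eq_intros dE refl | simp del: herm.simps)+ (simp add: algebra_simps del: herm.simps)
    moreover have "0 \<le> (?D s + x\<^sup>2 * herm_energy n (s * x)) * exp (x\<^sup>2 * s)"
      using D_bound[OF s] by (intro mult_nonneg_nonneg) auto
    ultimately show "\<exists>y. ((\<lambda>s. herm_energy n (s * x) * exp (x\<^sup>2 * s)) has_real_derivative y) (at s) \<and> 0 \<le> y"
      by blast
  qed simp
  then show "exp (- x\<^sup>2) * herm_energy n 0 \<le> herm_energy n x"
    by (simp add: exp_minus field_simps)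
  have "herm_energy n (0 * x) * exp (- x\<^sup>2 * 0) \<ge> herm_energy n (1 * x) * exp (- x\<^sup>2 * 1)"
  proof (rule DERIV_nonpos_imp_nonincreasing[of 0 1])
    fix s :: real assume s: "0 \<le> s" "s \<le> 1"
    have "((\<lambda>s. herm_energy n (s * x) * exp (- x\<^sup>2 * s)) has_real_derivative
        (?D s - x\<^sup>2 * herm_energy n (s * x)) * exp (- x\<^sup>2 * s)) (at s)"
      by (rule derivative_eq_intros dE refl | simp del: herm.simps)+ (simp add: algebra_simps del: herm.simps)
    moreover have "(?D s - x\<^sup>2 * herm_energy n (s * x)) * exp (- x\<^sup>2 * s) \<le> 0"
      using D_bound[OF s] by (intro mult_nonpos_nonneg) auto
    ultimately show "\<exists>y. ((\<lambda>s. herm_energy n (s * x) * exp (- x\<^sup>2 * s)) has_real_derivative y) (at s) \<and> y \<le> 0"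
      by blast
  qed simp
  then show "herm_energy n x \<le> exp (x\<^sup>2) * herm_energy n 0"
    by (simp add: exp_minus field_simps)
qed

lemma herm_sq_upper:
  assumes "x\<^sup>2 \<le> real (Suc n)"
  shows "(poly (herm (Suc n)) x)\<^sup>2 \<le> 2 * exp (2 * x\<^sup>2) * herm_energy n 0"
proof -
  have E0: "0 \<le> herm_energy n 0" by (simp add: herm_energy_def del: herm.simps)
  have "exp (- x\<^sup>2 / 2) * (poly (herm (Suc n)) x)\<^sup>2 \<le> 2 * (exp (x\<^sup>2) * herm_energy n 0)"
    using herm_energy_lower[OF assms] herm_energy_ratio(2)[OF assms] by linarith
  then have "(poly (herm (Suc n)) x)\<^sup>2 \<le> exp (x\<^sup>2 / 2) * (2 * (exp (x\<^sup>2) * herm_energy n 0))"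
    by (simp add: exp_minus field_simps del: herm.simps)
  also have "\<dots> \<le> exp (x\<^sup>2) * (2 * (exp (x\<^sup>2) * herm_energy n 0))"
    using E0 by (intro mult_right_mono) auto
  finally show ?thesis by (simp add: mult_ac exp_add[symmetric] flip: exp_double)
qed

text \<open>A large energy could come from the derivative alone. As \<open>herm n\<close> is the
  derivative of \<open>herm (Suc n)\<close>, the bound on their quotient excludes this and forces
  \<open>herm (Suc n)\<close> itself to be large, up to a polynomial factor.\<close>

lemma herm_sq_lower:
  assumes x: "x\<^sup>2 \<le> real (Suc n)"
    and le: "\<bar>poly (herm n) x\<bar> \<le> real (Suc n) ^ 4 * \<bar>poly (herm (Suc n)) x\<bar>"
  shows "exp (- x\<^sup>2) * herm_energy n 0 \<le> 5 * real (Suc n) ^ 8 * (poly (herm (Suc n)) x)\<^sup>2"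
proof -
  define a b where "a = poly (herm n) x" and "b = poly (herm (Suc n)) x"
  define N where "N = real (Suc n)"
  have N: "1 \<le> N" by (simp add: N_def)
  have "\<bar>a\<bar>\<^sup>2 \<le> (N ^ 4 * \<bar>b\<bar>)\<^sup>2" using le unfolding a_def b_def N_def by (intro power_mono) auto
  then have a: "a\<^sup>2 \<le> N ^ 8 * b\<^sup>2" by (simp add: power_mult_distrib flip: power_mult)
  have "0 \<le> (a + x * b)\<^sup>2" by simp
  then have 1: "- (x * a * b) \<le> a\<^sup>2 / 2 + x\<^sup>2 * b\<^sup>2 / 2" by (simp add: power2_eq_square algebra_simps)
  have N8: "N \<le> N ^ 8" "1 \<le> N ^ 8" using N by (auto simp: self_le_power)
  have "x\<^sup>2 * b\<^sup>2 \<le> N * b\<^sup>2" using x by (intro mult_right_mono) (auto simp: N_def)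
  moreover have "N * b\<^sup>2 \<le> N ^ 8 * b\<^sup>2" "1 * b\<^sup>2 \<le> N ^ 8 * b\<^sup>2" using N8 by (intro mult_right_mono; simp)+
  ultimately have 2: "a\<^sup>2 - x * a * b + (N + 1 / 2) * b\<^sup>2 \<le> 5 * N ^ 8 * b\<^sup>2"
    using 1 a zero_le_power2[of b] by (simp only: ring_distribs mult.assoc)
  have "herm_energy n x \<le> 1 * (5 * N ^ 8 * b\<^sup>2)"
    unfolding herm_energy_def
  proof (rule mult_mono)
    show "(poly (herm n) x)\<^sup>2 - x * poly (herm n) x * poly (herm (Suc n)) x
      + (real n + 3 / 2) * (poly (herm (Suc n)) x)\<^sup>2 \<le> 5 * N ^ 8 * b\<^sup>2"
      using 2 unfolding a_def b_def N_def by (simp add: algebra_simps del: herm.simps)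
    have "0 \<le> 2 * herm_energy n x" using herm_energy_lower[OF x]
      by (meson exp_ge_zero mult_nonneg_nonneg order_trans zero_le_power2)
    then show "0 \<le> (poly (herm n) x)\<^sup>2 - x * poly (herm n) x * poly (herm (Suc n)) x
      + (real n + 3 / 2) * (poly (herm (Suc n)) x)\<^sup>2"
      by (simp add: herm_energy_def zero_le_mult_iff del: herm.simps)
  qed auto
  then show ?thesis using herm_energy_ratio(1)[OF x] by (simp add: b_def N_def del: herm.simps)
qed

text \<open>One step multiplies Gamma by \<open>m + 3/2\<close> and the factorial by
  \<open>m + 1\<close>. The quotient of these factors lies between \<open>1\<close> and
  \<open>(m + 2) / (m + 1)\<close>, so the ratio of Gamma to the factorial grows at most
  linearly.\<close>

lemma Gamma_half_bounds:
  "Gamma (3 / 2) * fact m \<le> Gamma (real m + 3 / 2)"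
  "Gamma (real m + 3 / 2) \<le> Gamma (3 / 2) * (real m + 1) * fact m"
proof (induction m)
  case 0
  { case 1 then show ?case by simp next case 2 then show ?case by simp }
next
  case (Suc m)
  have G: "Gamma (real (Suc m) + 3 / 2) = (real m + 3 / 2) * Gamma (real m + 3 / 2)"
    using Gamma_plus1[of "real m + 3 / 2"] nonpos_Ints_nonpos[of "real m + 3 / 2"] by (force simp: add_ac)
  have c: "0 < Gamma (3 / 2 :: real)" by (rule Gamma_real_pos) simp
  { case 1
    have "(real m + 1) * (Gamma (3 / 2) * fact m) \<le> (real m + 3 / 2) * Gamma (real m + 3 / 2)"
      by (rule mult_mono) (use Suc.IH(1) c in auto)
    then show ?case unfolding G by (simp add: algebra_simps)
  next
    case 2
    have "(real m + 3 / 2) * Gamma (real m + 3 / 2) \<le> (real m + 2) * (Gamma (3 / 2) * (real m + 1) * fact m)"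
      by (rule mult_mono) (use Suc.IH(2) c in \<open>auto intro!: Gamma_real_nonneg\<close>)
    then show ?case unfolding G by (simp add: algebra_simps)
  }
qed

text \<open>By parity one of \<open>herm n\<close> and \<open>herm (Suc n)\<close> vanishes at the
  origin. The other has size \<open>2^(-m) / m!\<close> with \<open>m\<close> about half the order,
  which the power of two and the squared Gamma factor cancel up to a polynomial. This is the origin
  of the \<open>2\<close> and the \<open>(n/2)!\<close> in the theorem.\<close>

lemma Gamma_herm_energy_0:
  obtains c C :: real where "0 < c" "0 < C"
    "\<And>n. c \<le> 2 ^ Suc n * (Gamma (real (Suc n) / 2 + 1))\<^sup>2 * herm_energy n 0"
    "\<And>n. 2 ^ Suc n * (Gamma (real (Suc n) / 2 + 1))\<^sup>2 * herm_energy n 0 \<le> C * real (Suc n) ^ 2"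
proof
  let ?g = "Gamma (3 / 2 :: real)"
  have g: "0 < ?g" by (rule Gamma_real_pos) simp
  \<comment> \<open>The constant \<open>2 * ?g^2\<close> belongs to odd order \<open>Suc n\<close>,
    where Gamma is taken at a half-integer; \<open>1\<close> and \<open>2\<close> belong to even
    order, where the quantity is exactly \<open>n + 3/2\<close>.\<close>
  have "0 < 2 * ?g\<^sup>2" using g by (metis mult_pos_pos zero_less_numeral zero_less_power)
  then show "0 < min 1 (2 * ?g\<^sup>2)" "0 < max 2 (2 * ?g\<^sup>2)" by auto
  fix n
  let ?w = "2 ^ Suc n * (Gamma (real (Suc n) / 2 + 1))\<^sup>2 * herm_energy n 0"
  have "min 1 (2 * ?g\<^sup>2) \<le> ?w \<and> ?w \<le> max 2 (2 * ?g\<^sup>2) * real (Suc n) ^ 2"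
  proof (cases "even n")
    case True
    then obtain m where m: "n = 2 * m" by (auto elim: evenE)
    let ?q = "Gamma (real m + 3 / 2) / fact m"
    have q: "?g \<le> ?q" "?q \<le> ?g * (real m + 1)" using Gamma_half_bounds[of m] by (auto simp: field_simps)
    have "Gamma (real (Suc n) / 2 + 1) = Gamma (real m + 3 / 2)"
      by (rule arg_cong[of _ _ Gamma]) (simp add: m field_simps)
    moreover have "herm_energy n 0 = 1 / (4 ^ m * (fact m)\<^sup>2)"
      using power_mult[of "2::real" 2 m]
        herm_at_0[of m] unfolding m herm_energy_def
      by (simp add: power_mult_distrib power_divide power_mult[symmetric] mult.commute del: herm.simps)
    ultimately have w: "?w = 2 * ?q\<^sup>2"
      by (simp add: m power_mult power_divide)
    have "?g\<^sup>2 \<le> ?q\<^sup>2" "?q\<^sup>2 \<le> (?g * (real m + 1))\<^sup>2" using q g by (intro power_mono; simp)+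
    moreover have "(?g * (real m + 1))\<^sup>2 \<le> ?g\<^sup>2 * real (Suc n) ^ 2"
      unfolding power_mult_distrib by (intro mult_left_mono power_mono) (auto simp: m)
    moreover have "2 * ?g\<^sup>2 * real (Suc n) ^ 2 \<le> max 2 (2 * ?g\<^sup>2) * real (Suc n) ^ 2"
      by (intro mult_right_mono) auto
    ultimately show ?thesis unfolding w by linarith
  next
    case False
    then obtain m where m: "Suc n = 2 * m" by (metis even_Suc evenE)
    then obtain l where l: "m = Suc l" by (cases m) auto
    then have n: "n = Suc (2 * l)" using m by simp
    have "Gamma (real (Suc n) / 2 + 1) = fact m"
      by (simp add: m Gamma_fact add.commute)
    moreover have "herm_energy n 0 = (real n + 3 / 2) * (1 / (4 ^ m * (fact m)\<^sup>2))"
      unfolding herm_energy_def m n using herm_at_0(2)[of l] herm_at_0(1)[of m] m n power_mult[of "2::real" 2 m]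
      by (simp add: power_mult_distrib power_divide power_mult[symmetric] mult.commute del: herm.simps fact_Suc)
    ultimately have w: "?w = real n + 3 / 2"
      using m by (simp add: power_mult power_divide)
    have "real n + 3 / 2 \<le> 2 * real (Suc n) ^ 2" by (simp add: power2_eq_square algebra_simps)
    also have "\<dots> \<le> max 2 (2 * ?g\<^sup>2) * real (Suc n) ^ 2" by (intro mult_right_mono) auto
    finally show ?thesis unfolding w by simp
  qed
  then show "min 1 (2 * ?g\<^sup>2) \<le> ?w" "?w \<le> max 2 (2 * ?g\<^sup>2) * real (Suc n) ^ 2" by auto
qed

text \<open>The bounds on \<open>w\<close> from both sides are polynomial in \<open>n\<close>, so
  \<open>ln (w n) / n\<close> tends to \<open>0\<close> and a genuine limit results. The scale
  \<open>r\<close> enters as \<open>r^n\<close> and contributes exactly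
  \<open>2 * ln r\<close>.\<close>

lemma herm_log_asymptotics:
  assumes sep: "eventually (\<lambda>n. \<forall>z. poly (map_poly complex_of_real (herm n)) z = 0 \<longrightarrow>
      1 / real n ^ 3 \<le> \<bar>x - Re z\<bar>) sequentially"
    and r: "0 < r"
  shows "(\<lambda>n. ln (2 * \<bar>Gamma (real n / 2 + 1) * (r ^ n * poly (herm n) x)\<bar> powr (2 / real n)))
    \<longlonglongrightarrow> 2 * ln r"
proof -
  obtain c C :: real where cC: "0 < c" "0 < C"
    and c: "\<And>n. c \<le> 2 ^ Suc n * (Gamma (real (Suc n) / 2 + 1))\<^sup>2 * herm_energy n 0"
    and C: "\<And>n. 2 ^ Suc n * (Gamma (real (Suc n) / 2 + 1))\<^sup>2 * herm_energy n 0 \<le> C * real (Suc n) ^ 2"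
    using Gamma_herm_energy_0 by blast
  define c' where "c' = exp (- x\<^sup>2) * c / 5"
  define C' where "C' = 2 * exp (2 * x\<^sup>2) * C"
  \<comment> \<open>Arranged so that the argument of the outer logarithm is \<open>r^2\<close> times
    the \<open>n\<close>-th root of \<open>w n\<close>.\<close>
  define w where "w n = 2 ^ n * (Gamma (real n / 2 + 1))\<^sup>2 * (poly (herm n) x)\<^sup>2" for n
  have c'0: "0 < c'" and C'0: "0 < C'" using cC by (auto simp: c'_def C'_def)
  have ev1: "eventually (\<lambda>n. x\<^sup>2 \<le> real n) sequentially"
    using filterlim_real_sequentially by (simp add: filterlim_at_top)
  have ev: "eventually (\<lambda>n. c' / real n ^ 8 \<le> w n \<and> w n \<le> C' * real n ^ 2 \<and> 0 < n) sequentially"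
    using sep ev1 eventually_gt_at_top[of 0]
  proof eventually_elim
    case (elim n)
    then obtain k where n: "n = Suc k" by (cases n) auto
    have x: "x\<^sup>2 \<le> real (Suc k)" using elim n by simp
    \<comment> \<open>Degree at most \<open>n\<close> over distance at least \<open>n^-3\<close>
      gives the factor \<open>n^4\<close> that \<open>herm_sq_lower\<close> asks for.\<close>
    have "\<bar>poly (pderiv (herm n)) x\<bar> \<le> real (degree (herm n)) / (1 / real n ^ 3) * \<bar>poly (herm n) x\<bar>"
      by (rule abs_poly_pderiv_le) (use elim herm_nonzero in auto)
    also have "\<dots> \<le> real n / (1 / real n ^ 3) * \<bar>poly (herm n) x\<bar>"
      using degree_herm_le[of n] by (intro mult_right_mono divide_right_mono) auto
    finally have "\<bar>poly (herm k) x\<bar> \<le> real (Suc k) ^ 4 * \<bar>poly (herm (Suc k)) x\<bar>"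
      unfolding n pderiv_herm by (simp add: eval_nat_numeral mult_ac del: herm.simps)
    from herm_sq_lower[OF x this]
    have low: "exp (- x\<^sup>2) * herm_energy k 0 \<le> 5 * real (Suc k) ^ 8 * (poly (herm (Suc k)) x)\<^sup>2" .
    let ?G = "2 ^ Suc k * (Gamma (real (Suc k) / 2 + 1))\<^sup>2"
    have "exp (- x\<^sup>2) * c \<le> exp (- x\<^sup>2) * (?G * herm_energy k 0)" using c[of k] by (intro mult_left_mono) auto
    also have "\<dots> = ?G * (exp (- x\<^sup>2) * herm_energy k 0)" by simp
    also have "\<dots> \<le> ?G * (5 * real (Suc k) ^ 8 * (poly (herm (Suc k)) x)\<^sup>2)"
      by (rule mult_left_mono[OF low]) simp
    finally have 1: "c' / real n ^ 8 \<le> w n"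
      unfolding c'_def w_def n by (simp add: field_simps del: herm.simps of_nat_Suc)
    have "w n \<le> ?G * (2 * exp (2 * x\<^sup>2) * herm_energy k 0)"
      unfolding w_def n by (rule mult_left_mono[OF herm_sq_upper[OF x]]) simp
    also have "\<dots> = 2 * exp (2 * x\<^sup>2) * (?G * herm_energy k 0)" by simp
    also have "\<dots> \<le> 2 * exp (2 * x\<^sup>2) * (C * real (Suc k) ^ 2)"
      by (rule mult_left_mono[OF C]) simp
    finally show ?case using 1 elim by (simp add: C'_def n mult_ac)
  qed
  have lim: "(\<lambda>n. ln (w n) / real n) \<longlonglongrightarrow> 0"
  proof (rule tendsto_sandwich)
    show "eventually (\<lambda>n. (ln c' - 8 * ln (real n)) / real n \<le> ln (w n) / real n) sequentially"
      using ev
    proof eventually_elim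
      case (elim n)
      then have "ln (c' / real n ^ 8) \<le> ln (w n)" using c'0 by (subst ln_le_cancel_iff) (auto intro: less_le_trans[rotated])
      then show ?case using elim c'0 by (auto simp: ln_div ln_realpow intro!: divide_right_mono)
    qed
    show "eventually (\<lambda>n. ln (w n) / real n \<le> (ln C' + 2 * ln (real n)) / real n) sequentially"
      using ev
    proof eventually_elim
      case (elim n)
      then have "0 < w n" using c'0 by (auto intro: less_le_trans[rotated])
      then have "ln (w n) \<le> ln (C' * real n ^ 2)" using elim C'0 by (subst ln_le_cancel_iff) auto
      then show ?case using elim C'0 by (auto simp: ln_mult ln_realpow intro!: divide_right_mono)
    qed
    show "(\<lambda>n. (ln c' - 8 * ln (real n)) / real n) \<longlonglongrightarrow> 0" by real_asymp
    show "(\<lambda>n. (ln C' + 2 * ln (real n)) / real n) \<longlonglongrightarrow> 0" by real_asymp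
  qed
  have "eventually (\<lambda>n. ln (w n) / real n + 2 * ln r =
      ln (2 * \<bar>Gamma (real n / 2 + 1) * (r ^ n * poly (herm n) x)\<bar> powr (2 / real n))) sequentially"
    using ev
  proof eventually_elim
    case (elim n)
    let ?G = "Gamma (real n / 2 + 1)" and ?h = "poly (herm n) x"
    have "0 < w n" using elim c'0 by (auto intro: less_le_trans[rotated])
    then have nz: "?G \<noteq> 0" "?h \<noteq> 0" by (auto simp: w_def)
    have lw: "ln (w n) = real n * ln 2 + 2 * ln \<bar>?G\<bar> + 2 * ln \<bar>?h\<bar>"
    proof -
      have "w n = 2 ^ n * \<bar>?G\<bar> ^ 2 * \<bar>?h\<bar> ^ 2" by (simp add: w_def)
      also have "ln \<dots> = real n * ln 2 + 2 * ln \<bar>?G\<bar> + 2 * ln \<bar>?h\<bar>"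
        using nz ln_realpow[of "\<bar>?G\<bar>" 2] ln_realpow[of "\<bar>?h\<bar>" 2] by (subst ln_mult | simp add: ln_realpow)+
      finally show ?thesis .
    qed
    have "ln (2 * \<bar>?G * (r ^ n * ?h)\<bar> powr (2 / real n)) =
        ln 2 + 2 / real n * (ln \<bar>?G\<bar> + (real n * ln r + ln \<bar>?h\<bar>))"
      using nz r by (simp add: ln_mult ln_powr abs_mult ln_realpow)
    also have "\<dots> = ln (w n) / real n + 2 * ln r" unfolding lw using elim by (simp add: field_simps)
    finally show ?case by simp
  qed
  moreover have "(\<lambda>n. ln (w n) / real n + 2 * ln r) \<longlonglongrightarrow> 2 * ln r"
    using tendsto_add[OF lim tendsto_const[of "2 * ln r"]] by simp
  ultimately show ?thesis by (rule Lim_transform_eventually[rotated])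
qed

section \<open>Uniqueness of Fourier transforms\<close>

lemma real_distribution_density_distr:
  fixes V w :: "'a \<Rightarrow> real"
  assumes [measurable]: "V \<in> borel_measurable M" and w: "integrable M w" "\<And>x. 0 \<le> w x" "(\<integral>x. w x \<partial>M) = 1"
  shows "real_distribution (distr (density M (\<lambda>x. ennreal (w x))) borel V)"
proof -
  have [measurable]: "w \<in> borel_measurable M" using w by auto
  have "emeasure (density M (\<lambda>x. ennreal (w x))) (space M) = (\<integral>\<^sup>+x. ennreal (w x) \<partial>M)"
    by (subst emeasure_density) (auto intro!: nn_integral_cong simp: indicator_def)
  also have "\<dots> = 1" using w by (simp add: nn_integral_eq_integral)
  finally have "prob_space (density M (\<lambda>x. ennreal (w x)))" by (intro prob_spaceI) simp
  then interpret prob_space "density M (\<lambda>x. ennreal (w x))" .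
  have "prob_space (distr (density M (\<lambda>x. ennreal (w x))) borel V)" by (rule prob_space_distr) simp
  then interpret D: prob_space "distr (density M (\<lambda>x. ennreal (w x))) borel V" .
  show ?thesis by unfold_locales auto
qed

lemma char_density_distr:
  fixes V w :: "'a \<Rightarrow> real"
  assumes [measurable]: "V \<in> borel_measurable M" and w: "integrable M w" "\<And>x. 0 \<le> w x"
  shows "char (distr (density M (\<lambda>x. ennreal (w x))) borel V) u
    = Complex (\<integral>x. w x * cos (u * V x) \<partial>M) (\<integral>x. w x * sin (u * V x) \<partial>M)"
proof -
  have [measurable]: "w \<in> borel_measurable M" using w by auto
  have int: "integrable M (\<lambda>x. w x *\<^sub>R iexp (u * V x))"
    by (rule Bochner_Integration.integrable_bound[OF w(1)]) (auto simp: norm_exp_i_times)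
  have "char (distr (density M (\<lambda>x. ennreal (w x))) borel V) u = (\<integral>x. w x *\<^sub>R iexp (u * V x) \<partial>M)"
    unfolding char_def using w(2) by (subst integral_distr) (auto simp: integral_density)
  also have "\<dots> = Complex (\<integral>x. Re (w x *\<^sub>R iexp (u * V x)) \<partial>M) (\<integral>x. Im (w x *\<^sub>R iexp (u * V x)) \<partial>M)"
    using integral_Re[OF int] integral_Im[OF int] by (simp add: complex_eq_iff)
  finally show ?thesis by (simp add: Re_exp Im_exp)
qed

text \<open>The cosine hypothesis at \<open>u = 0\<close> says that the positive and negative parts
  of \<open>D\<close> have equal mass. Normalised as densities, they push forward under
  \<open>V\<close> to probability laws with equal characteristic functions, which coincide by Levy's
  theorem.\<close>

lemma weighted_fourier_uniqueness:
  fixes V D :: "'a \<Rightarrow> real"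
  assumes V[measurable]: "V \<in> borel_measurable M" and D: "integrable M D"
    and cos0: "\<And>u. (\<integral>x. D x * cos (u * V x) \<partial>M) = 0"
    and sin0: "\<And>u. (\<integral>x. D x * sin (u * V x) \<partial>M) = 0"
    and A[measurable]: "A \<in> sets borel"
  shows "(\<integral>x. D x * indicator A (V x) \<partial>M) = 0"
proof -
  have Dm[measurable]: "D \<in> borel_measurable M" using D by auto
  define p n where "p x = max 0 (D x)" and "n x = max 0 (- D x)" for x
  have pn: "D x = p x - n x" "0 \<le> p x" "0 \<le> n x" for x by (auto simp: p_def n_def)
  have ip: "integrable M p" and "integrable M n" unfolding p_def[abs_def] n_def[abs_def]
    by (rule Bochner_Integration.integrable_bound[OF D]; simp)+
  have ib: "integrable M (\<lambda>x. w x * f (V x))"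
    if "integrable M w" "\<And>y. \<bar>f y\<bar> \<le> 1" "f \<in> borel_measurable borel" for w f :: "_ \<Rightarrow> real"
    by (rule Bochner_Integration.integrable_bound[OF that(1)])
      (use that in \<open>auto simp: abs_mult mult_left_le intro!: measurable_compose[OF V that(3)]\<close>)
  have split: "(\<integral>x. D x * f (V x) \<partial>M) = (\<integral>x. p x * f (V x) \<partial>M) - (\<integral>x. n x * f (V x) \<partial>M)"
    if "\<And>y. \<bar>f y\<bar> \<le> 1" "f \<in> borel_measurable borel" for f :: "real \<Rightarrow> real"
    unfolding pn(1) left_diff_distrib
    using ib[OF ip that] ib[OF \<open>integrable M n\<close> that] by (rule Bochner_Integration.integral_diff)
  define c where "c = (\<integral>x. p x \<partial>M)"
  have c: "c = (\<integral>x. n x \<partial>M)" using split[of "\<lambda>y. 1"] cos0[of 0] by (simp add: c_def)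
  have c0: "0 \<le> c" unfolding c_def by (rule integral_nonneg_AE) (simp add: pn)
  show ?thesis
  proof (cases "c = 0")
    case True
    then have "AE x in M. p x = 0" "AE x in M. n x = 0"
      using integral_nonneg_eq_0_iff_AE[OF ip] integral_nonneg_eq_0_iff_AE[OF \<open>integrable M n\<close>] c
      by (auto simp: c_def pn)
    then have "AE x in M. D x * indicator A (V x) = 0" by eventually_elim (simp add: pn)
    then show ?thesis by (rule integral_eq_zero_AE)
  next
    case False
    define P N where "P = distr (density M (\<lambda>x. ennreal (p x / c))) borel V"
      and "N = distr (density M (\<lambda>x. ennreal (n x / c))) borel V"
    have wp: "integrable M (\<lambda>x. p x / c)" "\<And>x. 0 \<le> p x / c" "(\<integral>x. p x / c \<partial>M) = 1"
      using ip pn c0 False by (auto simp: c_def)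
    have wn: "integrable M (\<lambda>x. n x / c)" "\<And>x. 0 \<le> n x / c" "(\<integral>x. n x / c \<partial>M) = 1"
      using \<open>integrable M n\<close> pn c0 False by (auto simp: c)
    have "char P u = char N u" for u
    proof -
      have 1: "(\<integral>x. p x * cos (u * V x) \<partial>M) = (\<integral>x. n x * cos (u * V x) \<partial>M)"
        using split[of "\<lambda>y. cos (u * y)"] cos0[of u] by simp
      have 2: "(\<integral>x. p x * sin (u * V x) \<partial>M) = (\<integral>x. n x * sin (u * V x) \<partial>M)"
        using split[of "\<lambda>y. sin (u * y)"] sin0[of u] by simp
      show ?thesis unfolding P_def N_def char_density_distr[OF V wp(1,2)] char_density_distr[OF V wn(1,2)]
        using 1 2 by (simp add: field_simps)
    qed
    then have "P = N"
      unfolding P_def N_def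
      by (intro Levy_uniqueness real_distribution_density_distr V wp wn) auto
    have m: "measure (distr (density M (\<lambda>x. ennreal (w x / c))) borel V) A
        = (\<integral>x. w x * indicator A (V x) \<partial>M) / c"
      if "integrable M w" "\<And>x. 0 \<le> w x" for w
    proof -
      have [measurable]: "w \<in> borel_measurable M" using that by auto
      have "measure (distr (density M (\<lambda>x. ennreal (w x / c))) borel V) A
          = (\<integral>x. indicator A x \<partial>distr (density M (\<lambda>x. ennreal (w x / c))) borel V)"
        by simp
      also have "\<dots> = (\<integral>x. (w x / c) *\<^sub>R indicator A (V x) \<partial>M)"
        using that c0 by (subst integral_distr) (auto simp: integral_density)
      also have "\<dots> = (\<integral>x. w x * indicator A (V x) / c \<partial>M)" by simp
      finally show ?thesis by simp
    qed
    have "(\<integral>x. p x * indicator A (V x) \<partial>M) = (\<integral>x. n x * indicator A (V x) \<partial>M)"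
      using m[OF ip pn(2)] m[OF \<open>integrable M n\<close> pn(3)] \<open>P = N\<close> False unfolding P_def N_def by simp
    then show ?thesis using split[of "indicator A"] by (simp add: indicator_def)
  qed
qed

text \<open>One coordinate at a time: the phase \<open>a\<close> carries the coordinates not yet treated.\<close>

lemma weighted_fourier_uniqueness_phase:
  fixes V D a :: "'a \<Rightarrow> real"
  assumes V[measurable]: "V \<in> borel_measurable M" and D: "integrable M D" and a[measurable]: "a \<in> borel_measurable M"
    and 0: "\<And>u \<theta>. (\<integral>x. D x * cos (\<theta> + (u * V x + a x)) \<partial>M) = 0"
    and A[measurable]: "A \<in> sets borel"
  shows "(\<integral>x. D x * indicator A (V x) * cos (\<theta> + a x) \<partial>M) = 0"
proof -
  have [measurable]: "D \<in> borel_measurable M" using D by auto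
  have i: "integrable M (\<lambda>x. D x * cos (g x))" if "g \<in> borel_measurable M" for g
    by (rule Bochner_Integration.integrable_bound[OF D]) (use that in \<open>auto simp: abs_mult mult_left_le\<close>)
  have c: "(\<integral>x. (D x * cos (\<theta> + a x)) * cos (u * V x) \<partial>M) = 0" for u \<theta>
  proof -
    have "(\<integral>x. (D x * cos (\<theta> + a x)) * cos (u * V x) \<partial>M)
      = (\<integral>x. (D x * cos (\<theta> + (u * V x + a x)) + D x * cos (\<theta> + (- u * V x + a x))) / 2 \<partial>M)"
    proof (intro Bochner_Integration.integral_cong refl)
      fix x
      have "\<theta> + (u * V x + a x) = (\<theta> + a x) + u * V x" "\<theta> + (- u * V x + a x) = (\<theta> + a x) - u * V x" by auto
      then show "(D x * cos (\<theta> + a x)) * cos (u * V x)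
          = (D x * cos (\<theta> + (u * V x + a x)) + D x * cos (\<theta> + (- u * V x + a x))) / 2"
        using cos_times_cos[of "\<theta> + a x" "u * V x"] by (simp only:) (simp add: algebra_simps)
    qed
    also have "\<dots> = 0" using 0[of \<theta> u] 0[of \<theta> "-u"]
      by (subst integral_divide_zero, subst Bochner_Integration.integral_add) (auto intro!: i)
    finally show ?thesis .
  qed
  \<comment> \<open>Shifting the angle by \<open>pi / 2\<close> turns the cosine hypothesis into the
    sine identity; the free angle \<open>\<theta>\<close> thus encodes real and imaginary parts in
    one family.\<close>
  have s: "(\<integral>x. (D x * cos (\<theta> + a x)) * sin (u * V x) \<partial>M) = 0" for u
  proof -
    have "(\<integral>x. (D x * cos (\<theta> + a x)) * sin (u * V x) \<partial>M)
      = (\<integral>x. (D x * cos ((\<theta> - pi/2) + (u * V x + a x)) - D x * cos ((\<theta> - pi/2) + (- u * V x + a x))) / 2 \<partial>M)"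
    proof (intro Bochner_Integration.integral_cong refl)
      fix x
      have "(\<theta> - pi/2) + (u * V x + a x) = (\<theta> + a x + u * V x) - pi / 2"
        "(\<theta> - pi/2) + (- u * V x + a x) = (\<theta> + a x - u * V x) - pi / 2" by auto
      then show "(D x * cos (\<theta> + a x)) * sin (u * V x)
          = (D x * cos ((\<theta> - pi/2) + (u * V x + a x)) - D x * cos ((\<theta> - pi/2) + (- u * V x + a x))) / 2"
        using cos_times_sin[of "\<theta> + a x" "u * V x"]
        by (simp only: cos_diff[of _ "pi / 2"] cos_pi_half sin_pi_half) (simp add: mult.assoc right_diff_distrib[symmetric] diff_divide_distrib[symmetric])
    qed
    also have "\<dots> = 0" using 0[of "\<theta> - pi/2" u] 0[of "\<theta> - pi/2" "-u"]
      by (subst integral_divide_zero, subst Bochner_Integration.integral_diff) (auto intro!: i)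
    finally show ?thesis .
  qed
  have "(\<integral>x. (D x * cos (\<theta> + a x)) * indicator A (V x) \<partial>M) = 0"
    by (rule weighted_fourier_uniqueness[OF V i c s A]) simp
  then show ?thesis by (simp add: mult_ac)
qed

lemma multidim_fourier_uniqueness:
  fixes V :: "nat \<Rightarrow> 'a \<Rightarrow> real" and D :: "'a \<Rightarrow> real"
  assumes V[measurable]: "\<And>i. i < d \<Longrightarrow> V i \<in> borel_measurable M" and D: "integrable M D"
    and 0: "\<And>u \<theta>. (\<integral>x. D x * cos (\<theta> + (\<Sum>i<d. u i * V i x)) \<partial>M) = 0"
    and A[measurable]: "\<And>i. i < d \<Longrightarrow> A i \<in> sets borel"
  shows "(\<integral>x. D x * (\<Prod>i<d. indicator (A i) (V i x)) \<partial>M) = 0"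
proof -
  have [measurable]: "D \<in> borel_measurable M" using D by auto
  \<comment> \<open>Invariant: the first \<open>j\<close> coordinates have become indicators and are
    absorbed into the weight, while the others are still inside the cosine.\<close>
  have "(\<integral>x. (D x * (\<Prod>i<j. indicator (A i) (V i x))) * cos (\<theta> + (\<Sum>i=j..<d. u i * V i x)) \<partial>M) = 0"
    if "j \<le> d" for j u \<theta>
    using that
  proof (induction j arbitrary: u \<theta>)
    case 0
    then show ?case using assms(3)[of \<theta> u] by (simp add: lessThan_atLeast0)
  next
    case (Suc j)
    then have jd: "j < d" by simp
    have [measurable]: "V j \<in> borel_measurable M" "A j \<in> sets borel" using jd V A by auto
    have m1[measurable]: "(\<lambda>x. \<Prod>i<j. indicator (A i) (V i x) :: real) \<in> borel_measurable M"
    proof (intro borel_measurable_prod)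
      fix i assume "i \<in> {..<j}"
      then have [measurable]: "V i \<in> borel_measurable M" "A i \<in> sets borel" using jd V A by auto
      show "(\<lambda>x. indicator (A i) (V i x) :: real) \<in> borel_measurable M" by measurable
    qed
    have m2: "(\<lambda>x. \<Sum>i=Suc j..<d. u i * V i x) \<in> borel_measurable M"
      by (intro borel_measurable_sum borel_measurable_times) auto
    have "\<bar>\<Prod>i<j. indicator (A i) (V i x) :: real\<bar> \<le> 1" for x
      unfolding abs_prod by (intro prod_le_1) (auto simp: indicator_def)
    then have i: "integrable M (\<lambda>x. D x * (\<Prod>i<j. indicator (A i) (V i x)))"
      by (intro Bochner_Integration.integrable_bound[OF D]) (auto simp: abs_mult mult_left_le)
    have "(\<integral>x. D x * (\<Prod>i<j. indicator (A i) (V i x)) * indicator (A j) (V j x)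
        * cos (\<theta> + (\<Sum>i=Suc j..<d. u i * V i x)) \<partial>M) = 0"
    proof (rule weighted_fourier_uniqueness_phase[OF _ i m2])
      fix v \<theta>
      have "(\<Sum>i=j..<d. (u(j := v)) i * V i x) = v * V j x + (\<Sum>i=Suc j..<d. u i * V i x)" for x
        using jd by (subst sum.atLeast_Suc_lessThan) auto
      then show "(\<integral>x. D x * (\<Prod>i<j. indicator (A i) (V i x)) *
          cos (\<theta> + (v * V j x + (\<Sum>i = Suc j..<d. u i * V i x))) \<partial>M) = 0"
        using Suc.IH[of \<theta> "u(j := v)"] jd by simp
    qed auto
    then show ?case by (simp add: mult_ac)
  qed
  from this[of d 0 u] show ?thesis by simp
qed

section \<open>Calculus for smooth bounded functions of finitely many variables\<close>

lemma Cb_infinity_cong: "\<phi> \<in> Cb_infinity m \<Longrightarrow> (\<And>i. i < m \<Longrightarrow> x i = y i) \<Longrightarrow> \<phi> x = \<phi> y"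
  unfolding Cb_infinity_def by blast

lemma Cb_infinityD:
  assumes "\<phi> \<in> Cb_infinity m"
  shows "continuous_on UNIV \<phi>" and "bounded (range \<phi>)"
    and "i < m \<Longrightarrow> (\<lambda>y. \<phi> (x(i := y))) differentiable (at (x i))"
proof -
  have "\<forall>\<alpha>. set \<alpha> \<subseteq> {..<m} \<longrightarrow>
        (let \<psi> = foldr partial \<alpha> \<phi> in
           continuous_on UNIV \<psi> \<and> bounded (range \<psi>) \<and>
           (\<forall>i<m. \<forall>x. (\<lambda>y. \<psi> (x(i := y))) differentiable (at (x i))))"
    using assms unfolding Cb_infinity_def by simp
  from spec[OF this, of "[]"] show "continuous_on UNIV \<phi>" "bounded (range \<phi>)"
    "i < m \<Longrightarrow> (\<lambda>y. \<phi> (x(i := y))) differentiable (at (x i))" by (auto simp: Let_def)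
qed

lemma Cb_infinity_partial:
  assumes "\<phi> \<in> Cb_infinity m" and "i < m"
  shows "partial i \<phi> \<in> Cb_infinity m"
proof -
  have "partial i \<phi> x = partial i \<phi> y" if "\<forall>j<m. x j = y j" for x y
  proof -
    have "(\<lambda>z. \<phi> (x(i := z))) = (\<lambda>z. \<phi> (y(i := z)))"
      using that by (intro ext Cb_infinity_cong[OF assms(1)]) auto
    then show ?thesis using that assms(2) by (simp add: partial_def)
  qed
  moreover have "let \<psi> = foldr partial \<alpha> (partial i \<phi>) in
           continuous_on UNIV \<psi> \<and> bounded (range \<psi>) \<and>
           (\<forall>i<m. \<forall>x. (\<lambda>y. \<psi> (x(i := y))) differentiable (at (x i)))" if "set \<alpha> \<subseteq> {..<m}" for \<alpha>
  proof -
    \<comment> \<open>\<open>foldr\<close> applies the last entry of the list first, so the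
      derivative that is taken first has to be appended at the end.\<close>
    have "set (\<alpha> @ [i]) \<subseteq> {..<m} \<longrightarrow> (let \<psi> = foldr partial (\<alpha> @ [i]) \<phi> in
           continuous_on UNIV \<psi> \<and> bounded (range \<psi>) \<and>
           (\<forall>i<m. \<forall>x. (\<lambda>y. \<psi> (x(i := y))) differentiable (at (x i))))"
      using assms(1) unfolding Cb_infinity_def by blast
    then show ?thesis using that assms(2) by simp
  qed
  ultimately show ?thesis unfolding Cb_infinity_def by blast
qed

lemma Cb_infinity_DERIV:
  assumes "\<phi> \<in> Cb_infinity m" and "i < m"
  shows "((\<lambda>y. \<phi> (x(i := y))) has_real_derivative partial i \<phi> (x(i := s))) (at s)"
  using Cb_infinityD(3)[OF assms, of "x(i := s)"]
  by (simp add: partial_def DERIV_deriv_iff_real_differentiable)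

lemma Cb_infinity_bound:
  assumes "\<phi> \<in> Cb_infinity m"
  obtains C where "0 < C" "\<And>x. \<bar>\<phi> x\<bar> \<le> C"
  using Cb_infinityD(2)[OF assms] by (auto simp: bounded_pos)

text \<open>\<open>Cb_infinity\<close> speaks of separate partial derivatives only. Their continuity
  gives the chain rule along a line, by letting one coordinate after the other join the
  line.\<close>

lemma Cb_infinity_chain:
  assumes \<phi>: "\<phi> \<in> Cb_infinity m"
  shows "((\<lambda>z. \<phi> (\<lambda>i. y i + c i * z)) has_real_derivative
    (\<Sum>i<m. c i * partial i \<phi> (\<lambda>i. y i + c i * z))) (at z)"
proof -
  \<comment> \<open>Coordinates below \<open>j\<close> already move along the line; the others are
    frozen at \<open>w\<close>.\<close>
  let ?p = "\<lambda>j (w::nat \<Rightarrow> real) z i. if i < j then y i + c i * z else w i"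
  have "((\<lambda>z. \<phi> (?p j w z)) has_real_derivative (\<Sum>i<j. c i * partial i \<phi> (?p j w z))) (at z)"
    if "j \<le> m" for j w z
    using that
  proof (induction j arbitrary: w z)
    case 0
    then show ?case by simp
  next
    case (Suc j)
    then have jm: "j < m" by simp
    let ?f = "\<lambda>z s. \<phi> (?p j (w(j := s)) z)"
    let ?s = "y j + c j * z"
    have D: "((\<lambda>(z, s). ?f z s) has_derivative (\<lambda>(tz, ts). (\<Sum>i<j. c i * partial i \<phi> (?p j (w(j := ?s)) z)) * tz
        + blinfun_mult_right (partial j \<phi> (?p j (w(j := ?s)) z)) ts)) (at (z, ?s) within UNIV \<times> UNIV)"
    proof (rule has_derivative_partialsI)
      show "((\<lambda>z. ?f z ?s) has_derivative (*) (\<Sum>i<j. c i * partial i \<phi> (?p j (w(j := ?s)) z))) (at z within UNIV)"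
        using Suc.IH[of "w(j := ?s)" z] Suc.prems by (simp add: has_field_derivative_def)
      show "((\<lambda>s. ?f z s) has_derivative blinfun_apply (blinfun_mult_right (partial j \<phi> (?p j (w(j := s)) z)))) (at s within UNIV)"
        for z s
      proof -
        have "?p j (w(j := s')) z = (?p j w z)(j := s')" for s' by auto
        then show ?thesis using Cb_infinity_DERIV[OF \<phi> jm, of "?p j w z" s]
          by (simp add: has_field_derivative_def)
      qed
      have "continuous_on UNIV (\<lambda>x. partial j \<phi> (?p j (w(j := snd x)) (fst x)))"
      proof (rule continuous_on_compose2[OF Cb_infinityD(1)[OF Cb_infinity_partial[OF \<phi> jm]]])
        show "continuous_on UNIV (\<lambda>x. ?p j (w(j := snd x)) (fst x))"
        proof (rule continuous_on_coordinatewise_then_product)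
          fix i show "continuous_on UNIV (\<lambda>x. ?p j (w(j := snd x)) (fst x) i)"
            by (cases "i < j"; cases "i = j") (auto intro!: continuous_intros)
        qed
      qed simp
      then have "continuous (at (z, ?s)) (\<lambda>x. partial j \<phi> (?p j (w(j := snd x)) (fst x)))"
        by (simp add: continuous_on_eq_continuous_at)
      then show "continuous (at (z, ?s) within UNIV \<times> UNIV) (\<lambda>(z, s). blinfun_mult_right (partial j \<phi> (?p j (w(j := s)) z)))"
        by (simp add: case_prod_beta' bounded_linear.continuous[OF bounded_linear_blinfun_mult_right])
    qed auto
    have "((\<lambda>z. (z, y j + c j * z)) has_derivative (\<lambda>t. (t, c j * t))) (at z)"
      by (auto intro!: derivative_eq_intros)
    from has_derivative_compose[OF this D[unfolded UNIV_Times_UNIV]]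
    have "((\<lambda>z. ?f z (y j + c j * z)) has_derivative (\<lambda>t. (\<Sum>i<j. c i * partial i \<phi> (?p j (w(j := ?s)) z)) * t
        + partial j \<phi> (?p j (w(j := ?s)) z) * (c j * t))) (at z)"
      by simp
    moreover have "?p j (w(j := y j + c j * z)) z = ?p (Suc j) w z" for z by (auto simp: less_Suc_eq)
    ultimately show ?case
      by (simp add: has_field_derivative_def) (erule has_derivative_eq_rhs, simp add: fun_eq_iff algebra_simps)
  qed
  from this[of m] have "((\<lambda>z. \<phi> (?p m (\<lambda>_. 0) z)) has_real_derivative (\<Sum>i<m. c i * partial i \<phi> (?p m (\<lambda>_. 0) z))) (at z)"
    by simp
  moreover have "\<phi> (?p m (\<lambda>_. 0) z) = \<phi> (\<lambda>i. y i + c i * z)" for z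
    by (rule Cb_infinity_cong[OF \<phi>]) simp
  moreover have "partial i \<phi> (?p m (\<lambda>_. 0) z) = partial i \<phi> (\<lambda>i. y i + c i * z)" if "i < m" for i z
    by (rule Cb_infinity_cong[OF Cb_infinity_partial[OF \<phi> that]]) simp
  ultimately show ?thesis by simp
qed

text \<open>Two applications of the mean value theorem to the second difference over a square. That
  difference is symmetric in the two variables, so the other order of differentiation gives the
  other mixed derivative at some point of the same square.\<close>

lemma mixed_difference_eq:
  fixes f :: "real \<Rightarrow> real \<Rightarrow> real"
  assumes "0 < h"
    and fx: "\<And>s t. ((\<lambda>s. f s t) has_real_derivative fx s t) (at s)"
    and fxy: "\<And>s t. ((\<lambda>t. fx s t) has_real_derivative fxy s t) (at t)"
  obtains s t where "a \<le> s" "s \<le> a + h" "b \<le> t" "t \<le> b + h"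
    "f (a + h) (b + h) - f (a + h) b - f a (b + h) + f a b = h * h * fxy s t"
proof -
  have "\<exists>s>a. s < a + h \<and> (f (a + h) (b + h) - f (a + h) b) - (f a (b + h) - f a b)
      = (a + h - a) * (fx s (b + h) - fx s b)"
    by (rule MVT2) (use \<open>0 < h\<close> in \<open>auto intro!: derivative_intros fx\<close>)
  then obtain s where s: "a < s" "s < a + h"
    "(f (a + h) (b + h) - f (a + h) b) - (f a (b + h) - f a b) = h * (fx s (b + h) - fx s b)" by auto
  have "\<exists>t>b. t < b + h \<and> fx s (b + h) - fx s b = (b + h - b) * fxy s t"
    by (rule MVT2) (use \<open>0 < h\<close> in \<open>auto intro!: fxy\<close>)
  then obtain t where "b < t" "t < b + h" "fx s (b + h) - fx s b = h * fxy s t" by auto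
  then show thesis using s by (intro that[of s t]) auto
qed

text \<open>The two mean values agree on every square of side \<open>1 / (n + 1)\<close> at
  \<open>(a, b)\<close>; continuity of both mixed derivatives lets the squares shrink to the
  point.\<close>

lemma mixed_partials_eq:
  fixes f :: "real \<Rightarrow> real \<Rightarrow> real"
  assumes fx: "\<And>s t. ((\<lambda>s. f s t) has_real_derivative fx s t) (at s)"
    and fxy: "\<And>s t. ((\<lambda>t. fx s t) has_real_derivative fxy s t) (at t)"
    and fy: "\<And>s t. ((\<lambda>t. f s t) has_real_derivative fy s t) (at t)"
    and fyx: "\<And>s t. ((\<lambda>s. fy s t) has_real_derivative fyx s t) (at s)"
    and c12: "continuous_on UNIV (\<lambda>x. fxy (fst x) (snd x))"
    and c21: "continuous_on UNIV (\<lambda>x. fyx (fst x) (snd x))"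
  shows "fxy a b = fyx a b"
proof -
  let ?h = "\<lambda>n. 1 / real (Suc n)"
  have "\<exists>s t s' t'. a \<le> s \<and> s \<le> a + ?h n \<and> b \<le> t \<and> t \<le> b + ?h n \<and>
     a \<le> s' \<and> s' \<le> a + ?h n \<and> b \<le> t' \<and> t' \<le> b + ?h n \<and> fxy s t = fyx s' t'" for n
  proof -
    obtain s t where st: "a \<le> s" "s \<le> a + ?h n" "b \<le> t" "t \<le> b + ?h n"
      "f (a + ?h n) (b + ?h n) - f (a + ?h n) b - f a (b + ?h n) + f a b = ?h n * ?h n * fxy s t"
      using mixed_difference_eq[of "?h n" f fx fxy a b] fx fxy by auto
    obtain t' s' where st': "b \<le> t'" "t' \<le> b + ?h n" "a \<le> s'" "s' \<le> a + ?h n"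
      "f (a + ?h n) (b + ?h n) - f a (b + ?h n) - f (a + ?h n) b + f a b = ?h n * ?h n * fyx s' t'"
      using mixed_difference_eq[of "?h n" "\<lambda>t s. f s t" "\<lambda>t s. fy s t" "\<lambda>t s. fyx s t" b a] fy fyx by auto
    have "?h n * ?h n * fxy s t = ?h n * ?h n * fyx s' t'" using st(5) st'(5) by linarith
    then have "fxy s t = fyx s' t'" by simp
    then show ?thesis using st st' by blast
  qed
  then obtain s t s' t' where *: "\<And>n. a \<le> s n \<and> s n \<le> a + ?h n \<and> b \<le> t n \<and> t n \<le> b + ?h n \<and>
     a \<le> s' n \<and> s' n \<le> a + ?h n \<and> b \<le> t' n \<and> t' n \<le> b + ?h n \<and> fxy (s n) (t n) = fyx (s' n) (t' n)"
    by metis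
  have lim: "(\<lambda>n. c + ?h n) \<longlonglongrightarrow> c" for c :: real by real_asymp
  have sq: "u \<longlonglongrightarrow> c" if "\<And>n. c \<le> u n \<and> u n \<le> c + ?h n" for u and c :: real
    by (rule tendsto_sandwich[OF _ _ tendsto_const lim]) (use that in auto)
  have "(\<lambda>n. (s n, t n)) \<longlonglongrightarrow> (a, b)" "(\<lambda>n. (s' n, t' n)) \<longlonglongrightarrow> (a, b)"
    by (intro tendsto_Pair sq; use * in blast)+
  then have "(\<lambda>n. fxy (s n) (t n)) \<longlonglongrightarrow> fxy a b" "(\<lambda>n. fyx (s' n) (t' n)) \<longlonglongrightarrow> fyx a b"
    using continuous_on_tendsto_compose[OF c12, of "\<lambda>n. (s n, t n)" "(a, b)"]
      continuous_on_tendsto_compose[OF c21, of "\<lambda>n. (s' n, t' n)" "(a, b)"] by auto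
  moreover have "(\<lambda>n. fxy (s n) (t n)) = (\<lambda>n. fyx (s' n) (t' n))" using * by auto
  ultimately show ?thesis by (auto intro: LIMSEQ_unique)
qed

text \<open>The symmetry of second derivatives is what lets the linear terms in
  \<open>chaos_poly_expansion\<close> be collected.\<close>

lemma Cb_infinity_partial_commute:
  assumes \<phi>: "\<phi> \<in> Cb_infinity m" and i: "i < m" and j: "j < m"
  shows "partial i (partial j \<phi>) = partial j (partial i \<phi>)"
proof (cases "i = j")
  case False
  show ?thesis
  proof
    fix x :: "nat \<Rightarrow> real"
    have tw: "x(i := s, j := t) = x(j := t, i := s)" for s t using False by (simp add: fun_upd_twist)
    have cont: "continuous_on UNIV (\<lambda>p. \<psi> (x(i := fst p, j := snd p)))" if "\<psi> \<in> Cb_infinity m" for \<psi>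
    proof (rule continuous_on_compose2[OF Cb_infinityD(1)[OF that]])
      show "continuous_on UNIV (\<lambda>p. x(i := fst p, j := snd p))"
      proof (rule continuous_on_coordinatewise_then_product)
        fix k show "continuous_on UNIV (\<lambda>p. (x(i := fst p, j := snd p)) k)"
          by (cases "k = j"; cases "k = i") (auto intro!: continuous_intros)
      qed
    qed simp
    have D1: "((\<lambda>s. \<psi> (x(i := s, j := t))) has_real_derivative partial i \<psi> (x(i := s, j := t))) (at s)"
      if "\<psi> \<in> Cb_infinity m" for \<psi> s t
      unfolding tw by (rule Cb_infinity_DERIV[OF that i])
    have D2: "((\<lambda>t. \<psi> (x(i := s, j := t))) has_real_derivative partial j \<psi> (x(i := s, j := t))) (at t)"
      if "\<psi> \<in> Cb_infinity m" for \<psi> s t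
      by (rule Cb_infinity_DERIV[OF that j])
    note [intro] = Cb_infinity_partial[OF \<phi> i] Cb_infinity_partial[OF \<phi> j] \<phi> Cb_infinity_partial i j
    have "partial j (partial i \<phi>) (x(i := x i, j := x j)) = partial i (partial j \<phi>) (x(i := x i, j := x j))"
      by (rule mixed_partials_eq[where f = "\<lambda>s t. \<phi> (x(i := s, j := t))"
          and fx = "\<lambda>s t. partial i \<phi> (x(i := s, j := t))" and fy = "\<lambda>s t. partial j \<phi> (x(i := s, j := t))"
          and fxy = "\<lambda>s t. partial j (partial i \<phi>) (x(i := s, j := t))"
          and fyx = "\<lambda>s t. partial i (partial j \<phi>) (x(i := s, j := t))"])
        (intro D1 D2 cont; blast)+
    then show "partial i (partial j \<phi>) x = partial j (partial i \<phi>) x" by simp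
  qed
qed simp

text \<open>Each differentiation multiplies the amplitude by some \<open>u i\<close> and advances
  the angle by \<open>pi / 2\<close>, so one family with two parameters contains the derivatives for
  all multi-indices.\<close>

lemma cos_Cb_infinity: "(\<lambda>x. cos (\<theta> + (\<Sum>i<m. u i * x i))) \<in> Cb_infinity m"
proof -
  let ?c = "\<lambda>a \<theta> (x::nat \<Rightarrow> real). a * cos (\<theta> + (\<Sum>i<m. u i * x i))"
  have upd: "(\<Sum>j<m. u j * (x(i := y)) j) = u i * y + (\<Sum>j\<in>{..<m} - {i}. u j * x j)" if "i < m" for i x y
    using that by (subst sum.remove[of _ i]) auto
  have D: "((\<lambda>y. ?c a \<theta> (x(i := y))) has_real_derivative ?c (a * u i) (\<theta> + pi / 2) x) (at (x i))"
    if "i < m" for a \<theta> x i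
  proof -
    have "(\<Sum>j<m. u j * x j) = u i * x i + (\<Sum>j\<in>{..<m} - {i}. u j * x j)"
      using upd[OF that, of x "x i"] by simp
    then show ?thesis unfolding upd[OF that]
      by (auto intro!: derivative_eq_intros simp: cos_add sin_add algebra_simps)
  qed
  have p: "partial i (?c a \<theta>) = ?c (a * u i) (\<theta> + pi / 2)" if "i < m" for i a \<theta>
    unfolding partial_def using D[OF that] by (intro ext DERIV_imp_deriv)
  have f: "\<exists>a' \<theta>'. foldr partial \<alpha> (?c 1 \<theta>) = ?c a' \<theta>'" if "set \<alpha> \<subseteq> {..<m}" for \<alpha>
    using that
  proof (induction \<alpha>)
    case Nil
    show ?case by (rule exI[of _ 1], rule exI[of _ \<theta>]) simp
  next
    case (Cons i \<alpha>)
    then obtain a' \<theta>' where "foldr partial \<alpha> (?c 1 \<theta>) = ?c a' \<theta>'" by auto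
    then show ?case using p[of i a' \<theta>'] Cons.prems by auto
  qed
  have g: "continuous_on UNIV (?c a \<theta>) \<and> bounded (range (?c a \<theta>)) \<and>
        (\<forall>i<m. \<forall>x. (\<lambda>y. ?c a \<theta> (x(i := y))) differentiable (at (x i)))" for a \<theta>
  proof (intro conjI allI impI)
    show "continuous_on UNIV (?c a \<theta>)"
      by (intro continuous_intros continuous_on_product_then_coordinatewise[OF continuous_on_id, unfolded id_def])
    show "bounded (range (?c a \<theta>))"
      by (auto intro!: boundedI[of _ "\<bar>a\<bar>"] simp: abs_mult mult_left_le)
  qed (use D real_differentiable_def in blast)
  show ?thesis unfolding Cb_infinity_def
  proof (intro CollectI conjI allI impI)
    fix x y :: "nat \<Rightarrow> real" assume "\<forall>i<m. x i = y i"
    then show "cos (\<theta> + (\<Sum>i<m. u i * x i)) = cos (\<theta> + (\<Sum>i<m. u i * y i))" by simp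
  next
    fix \<alpha> :: "nat list" assume "set \<alpha> \<subseteq> {..<m}"
    then obtain a' \<theta>' where "foldr partial \<alpha> (?c 1 \<theta>) = ?c a' \<theta>'" using f by blast
    then show "let \<psi> = foldr partial \<alpha> (\<lambda>x. cos (\<theta> + (\<Sum>i<m. u i * x i))) in
         continuous_on UNIV \<psi> \<and> bounded (range \<psi>) \<and>
         (\<forall>i<m. \<forall>x. (\<lambda>y. \<psi> (x(i := y))) differentiable at (x i))"
      using g[of a' \<theta>'] by simp
  qed
qed

section \<open>The energy inner product\<close>

text \<open>A class that contains indicators of bounded intervals as well as Schwartz functions.
  Boundedness copes with the singularity of \<open>theta\<close> on the diagonal and integrability
  with the region far from it.\<close>

definition tame :: "(real \<Rightarrow> real) \<Rightarrow> bool" where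
  "tame f \<longleftrightarrow> set_integrable lborel {0..} f \<and> bounded (f ` {0..})"

lemma tame_bound:
  assumes "tame f" obtains C where "0 < C" "\<And>x. 0 \<le> x \<Longrightarrow> \<bar>f x\<bar> \<le> C"
  using assms by (auto simp: tame_def bounded_pos)

lemma tame_measurable [measurable_dest]: "tame f \<Longrightarrow> (\<lambda>x. indicator {0..} x * f x) \<in> borel_measurable borel"
  by (auto simp: tame_def set_integrable_def dest: borel_measurable_integrable)

lemma tame_dominated:
  assumes d: "tame d" and f: "(\<lambda>x. indicator {0..} x * f x) \<in> borel_measurable borel"
    and le: "\<And>x. 0 \<le> x \<Longrightarrow> \<bar>f x\<bar> \<le> d x"
  shows "tame f"
proof -
  have "set_integrable lborel {0..} f" unfolding set_integrable_def
  proof (rule Bochner_Integration.integrable_bound)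
    show "integrable lborel (\<lambda>x. indicator {0..} x *\<^sub>R d x)"
      using d by (simp add: tame_def set_integrable_def)
    show "AE x in lborel. norm (indicator {0..} x *\<^sub>R f x) \<le> norm (indicator {0..} x *\<^sub>R d x)"
      using le by (intro AE_I2) (auto simp: indicator_def intro: order_trans[OF le abs_ge_self])
  qed (use f in simp)
  moreover obtain C where C: "\<And>x. 0 \<le> x \<Longrightarrow> \<bar>d x\<bar> \<le> C" using tame_bound[OF d] by blast
  have "\<bar>f x\<bar> \<le> C" if "0 \<le> x" for x using le[OF that] C[OF that] by linarith
  then have "bounded (f ` {0..})" by (auto intro!: boundedI)
  ultimately show ?thesis by (simp add: tame_def)
qed

lemma tame_lincomb:
  assumes "tame f" "tame g" shows "tame (\<lambda>x. a * f x + b * g x)"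
proof -
  obtain C D where "\<And>x. 0 \<le> x \<Longrightarrow> \<bar>f x\<bar> \<le> C" "\<And>x. 0 \<le> x \<Longrightarrow> \<bar>g x\<bar> \<le> D"
    using tame_bound assms by metis
  then have "\<bar>a * f x + b * g x\<bar> \<le> \<bar>a\<bar> * C + \<bar>b\<bar> * D" if "0 \<le> x" for x
    using that by (intro order_trans[OF abs_triangle_ineq] add_mono) (auto simp: abs_mult mult_left_mono)
  then have "bounded ((\<lambda>x. a * f x + b * g x) ` {0..})" by (auto intro!: boundedI)
  then show ?thesis using assms unfolding tame_def by (auto intro!: set_integral_add)
qed

lemma tame_abs: "tame f \<Longrightarrow> tame (\<lambda>x. \<bar>f x\<bar>)"
  unfolding tame_def bounded_iff by (auto intro: set_integrable_abs)

lemma tame_cmult: "tame f \<Longrightarrow> tame (\<lambda>x. a * f x)"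
  using tame_lincomb[of f f a 0] by simp

lemma tame_diff: "tame f \<Longrightarrow> tame g \<Longrightarrow> tame (\<lambda>x. f x - g x)"
  using tame_lincomb[of f g 1 "-1"] by simp

lemma tame_add: "tame f \<Longrightarrow> tame g \<Longrightarrow> tame (\<lambda>x. f x + g x)"
  using tame_lincomb[of f g 1 1] by simp

lemma tame_zero: "tame (\<lambda>x. 0)"
  by (auto simp: tame_def set_integrable_def intro!: boundedI)

lemma tame_indicator_Icc: "tame (indicator {a..b})"
proof -
  have "set_integrable lborel {0..} (indicator {a..b} :: real \<Rightarrow> real)"
    unfolding set_integrable_def
  proof (rule Bochner_Integration.integrable_bound)
    show "integrable lborel (indicator {a..b} :: real \<Rightarrow> real)"
      by (rule integrable_real_indicator) (auto simp: emeasure_lborel_Icc_eq)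
  qed (auto simp: indicator_def)
  then show ?thesis by (auto simp: tame_def indicator_def intro!: boundedI[of _ 1])
qed

text \<open>Local integrability of the kernel: for \<open>p = 2 * H - 2\<close> the hypothesis is
  exactly \<open>H > 1 / 2\<close>.\<close>

lemma nn_integral_powr_near_0:
  assumes p: "-1 < (p::real)"
  shows "(\<integral>\<^sup>+y. ennreal (indicator {-1..1} y * \<bar>y\<bar> powr p) \<partial>lborel) < \<infinity>"
proof -
  let ?f = "\<lambda>y. indicator {0..1} y * y powr p :: real"
  have "((\<lambda>y. if y \<in> {0..1} then y powr p else 0) has_integral (1 powr (p + 1) / (p + 1))) UNIV"
    unfolding has_integral_restrict_UNIV using p by (intro has_integral_powr_from_0) auto
  moreover have "(\<lambda>y. if y \<in> {0..1} then y powr p else 0) = ?f" by (auto simp: indicator_def)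
  ultimately have "(?f has_integral (1 / (p + 1))) UNIV" by simp
  then have f: "(\<integral>\<^sup>+y. ennreal (?f y) \<partial>lborel) = ennreal (1 / (p + 1))"
    by (intro nn_integral_has_integral_lborel) auto
  have f': "(\<integral>\<^sup>+y. ennreal (?f (- y)) \<partial>lborel) = ennreal (1 / (p + 1))"
    using nn_integral_real_affine[of "\<lambda>y. ennreal (?f y)" "-1" 0] f by simp
  have "(\<integral>\<^sup>+y. ennreal (indicator {-1..1} y * \<bar>y\<bar> powr p) \<partial>lborel) \<le> (\<integral>\<^sup>+y. ennreal (?f y) + ennreal (?f (- y)) \<partial>lborel)"
    by (intro nn_integral_mono) (auto simp: indicator_def ennreal_plus[symmetric] simp del: ennreal_plus)
  also have "\<dots> = ennreal (1 / (p + 1)) + ennreal (1 / (p + 1))"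
    using f f' by (subst nn_integral_add) auto
  also have "\<dots> < \<infinity>" by simp
  finally show ?thesis .
qed

lemma theta_measurable [measurable]: "(\<lambda>x. theta H (fst x) (snd x)) \<in> borel_measurable (lborel \<Otimes>\<^sub>M lborel)"
  unfolding theta_def by measurable

locale regular_hurst =
  fixes H :: real assumes H: "1 / 2 < H" "H < 1"
begin

lemma theta_nonneg: "0 \<le> theta H x y"
  using H by (simp add: theta_def)

text \<open>Within distance \<open>1\<close> of \<open>x\<close> the bound on \<open>g\<close> meets
  an integrable singularity; farther away the power is at most \<open>1\<close> and \<open>g\<close>
  itself is integrated. Translation invariance makes the bound uniform in \<open>x\<close>.\<close>

lemma nn_integral_tame_theta:
  assumes g: "tame g"
  obtains K :: real where "\<And>x. (\<integral>\<^sup>+y. ennreal \<bar>indicator {0..} y * g y * theta H x y\<bar> \<partial>lborel) \<le> ennreal K"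
proof -
  define p where "p = 2 * H - 2"
  have p: "-1 < p" "p < 0" using H by (auto simp: p_def)
  obtain C where C: "0 < C" "\<And>x. 0 \<le> x \<Longrightarrow> \<bar>g x\<bar> \<le> C" using tame_bound[OF g] by blast
  let ?c = "H * (2 * H - 1)"
  let ?near = "\<lambda>y. ennreal (indicator {-1..1} y * \<bar>y\<bar> powr p)"
  let ?g = "\<lambda>y. indicator {0..} y * g y"
  have c: "0 \<le> ?c" using H by auto
  have [measurable]: "?g \<in> borel_measurable borel" using tame_measurable[OF g] .
  have ig: "integrable lborel ?g" using g by (simp add: tame_def set_integrable_def)
  define J where "J = (\<integral>\<^sup>+y. ennreal \<bar>?g y\<bar> \<partial>lborel)"
  have J: "J < \<infinity>" using ig unfolding J_def by (simp add: integrable_iff_bounded)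
  define L where "L = integral\<^sup>N lborel ?near"
  have L: "L < \<infinity>" unfolding L_def by (rule nn_integral_powr_near_0[OF p(1)])
  have "(\<integral>\<^sup>+y. ennreal \<bar>?g y * theta H x y\<bar> \<partial>lborel) \<le> ennreal ?c * (ennreal C * L + J)" for x
  proof -
    have le: "ennreal \<bar>?g y * theta H x y\<bar> \<le> ennreal ?c * (ennreal C * ?near (x - y) + ennreal \<bar>?g y\<bar>)" for y
    proof -
      have "\<bar>?g y\<bar> * \<bar>x - y\<bar> powr p \<le> C * (indicator {-1..1} (x - y) * \<bar>x - y\<bar> powr p) + \<bar>?g y\<bar>"
      proof (cases "\<bar>x - y\<bar> \<le> 1")
        case True
        then have ind: "indicator {-1..1} (x - y) = (1::real)" by (auto simp: indicator_def)
        have "\<bar>?g y\<bar> * \<bar>x - y\<bar> powr p \<le> C * \<bar>x - y\<bar> powr p"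
          using C by (intro mult_right_mono) (auto simp: indicator_def)
        then show ?thesis unfolding ind by simp
      next
        case False
        then have "\<bar>x - y\<bar> powr p \<le> \<bar>x - y\<bar> powr 0" using p by (intro powr_mono) auto
        also have "\<dots> = 1" using False by auto
        finally have "\<bar>?g y\<bar> * \<bar>x - y\<bar> powr p \<le> \<bar>?g y\<bar>" by (intro mult_left_le) auto
        then show ?thesis using C(1) by (simp add: add_increasing)
      qed
      then have "?c * (\<bar>?g y\<bar> * \<bar>x - y\<bar> powr p) \<le> ?c * (C * (indicator {-1..1} (x - y) * \<bar>x - y\<bar> powr p) + \<bar>?g y\<bar>)"
        using c by (rule mult_left_mono)
      moreover have th: "\<bar>theta H x y\<bar> = ?c * \<bar>x - y\<bar> powr p"
        using theta_nonneg[of x y] by (simp add: theta_def p_def)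
      ultimately have "\<bar>?g y * theta H x y\<bar> \<le> ?c * (C * (indicator {-1..1} (x - y) * \<bar>x - y\<bar> powr p) + \<bar>?g y\<bar>)"
        using theta_nonneg[of x y] by (simp add: abs_mult th mult_ac)
      then have "ennreal \<bar>?g y * theta H x y\<bar> \<le> ennreal (?c * (C * (indicator {-1..1} (x - y) * \<bar>x - y\<bar> powr p) + \<bar>?g y\<bar>))"
        by (rule ennreal_leI)
      also have "\<dots> = ennreal ?c * (ennreal C * ?near (x - y) + ennreal \<bar>?g y\<bar>)"
        using c C(1) by (subst ennreal_mult) (auto simp: ennreal_plus ennreal_mult)
      finally show ?thesis .
    qed
    have "(\<integral>\<^sup>+y. ennreal \<bar>?g y * theta H x y\<bar> \<partial>lborel)
        \<le> (\<integral>\<^sup>+y. ennreal ?c * (ennreal C * ?near (x - y) + ennreal \<bar>?g y\<bar>) \<partial>lborel)"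
      by (intro nn_integral_mono le)
    also have "\<dots> = ennreal ?c * (ennreal C * (\<integral>\<^sup>+y. ?near (x - y) \<partial>lborel) + J)"
    proof -
      have 1: "(\<lambda>y. ?near (x - y)) \<in> borel_measurable lborel" by measurable
      then have 2: "(\<lambda>y. ennreal C * ?near (x - y)) \<in> borel_measurable lborel" by (rule borel_measurable_times_ennreal[rotated]) simp
      have 3: "(\<lambda>y. ennreal \<bar>?g y\<bar>) \<in> borel_measurable lborel" by measurable
      show ?thesis unfolding J_def nn_integral_cmult[OF borel_measurable_add[OF 2 3]] nn_integral_add[OF 2 3] nn_integral_cmult[OF 1] ..
    qed
    also have "(\<integral>\<^sup>+y. ?near (x - y) \<partial>lborel) = L"
      unfolding L_def using nn_integral_real_affine[of ?near "-1" x] by simp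
    finally show ?thesis .
  qed
  moreover have "ennreal ?c * (ennreal C * L + J) < \<infinity>"
    using J L by (simp add: ennreal_mult_less_top)
  ultimately show thesis
    by (intro that[of "enn2real (ennreal ?c * (ennreal C * L + J))"]) (auto simp: mult.assoc)
qed

lemma tame_energy_integrable:
  assumes f: "tame f" and g: "tame g"
  shows "integrable (lborel \<Otimes>\<^sub>M lborel) (\<lambda>(x, y). (indicator {0..} x * f x) * (indicator {0..} y * g y) * theta H x y)"
proof (rule integrableI_bounded)
  let ?f = "\<lambda>x. indicator {0..} x * f x" and ?g = "\<lambda>x. indicator {0..} x * g x"
  have [measurable]: "?f \<in> borel_measurable borel" "?g \<in> borel_measurable borel"
    using f g by (auto dest: tame_measurable)
  show m: "(\<lambda>(x, y). ?f x * ?g y * theta H x y) \<in> borel_measurable (lborel \<Otimes>\<^sub>M lborel)"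
    unfolding case_prod_beta' by measurable
  obtain K where K: "\<And>x. (\<integral>\<^sup>+y. ennreal \<bar>?g y * theta H x y\<bar> \<partial>lborel) \<le> ennreal K"
    using nn_integral_tame_theta[OF g] by (auto simp: mult.assoc)
  have "(\<integral>\<^sup>+z. ennreal (norm (case z of (x, y) \<Rightarrow> ?f x * ?g y * theta H x y)) \<partial>(lborel \<Otimes>\<^sub>M lborel))
     = (\<integral>\<^sup>+x. \<integral>\<^sup>+y. ennreal (norm (?f x * ?g y * theta H x y)) \<partial>lborel \<partial>lborel)"
    using m by (subst lborel.nn_integral_fst[symmetric]) auto
  also have "\<dots> = (\<integral>\<^sup>+x. ennreal \<bar>?f x\<bar> * (\<integral>\<^sup>+y. ennreal \<bar>?g y * theta H x y\<bar> \<partial>lborel) \<partial>lborel)"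
  proof (intro nn_integral_cong)
    fix x
    have [measurable]: "(\<lambda>y. theta H x y) \<in> borel_measurable borel" unfolding theta_def by measurable
    have "(\<integral>\<^sup>+y. ennreal (norm (?f x * ?g y * theta H x y)) \<partial>lborel)
        = (\<integral>\<^sup>+y. ennreal \<bar>?f x\<bar> * ennreal \<bar>?g y * theta H x y\<bar> \<partial>lborel)"
      by (intro nn_integral_cong) (simp add: ennreal_mult[symmetric] abs_mult mult_ac)
    then show "(\<integral>\<^sup>+y. ennreal (norm (?f x * ?g y * theta H x y)) \<partial>lborel)
        = ennreal \<bar>?f x\<bar> * (\<integral>\<^sup>+y. ennreal \<bar>?g y * theta H x y\<bar> \<partial>lborel)"
      by (simp add: nn_integral_cmult)
  qed
  also have "\<dots> \<le> (\<integral>\<^sup>+x. ennreal \<bar>?f x\<bar> * ennreal K \<partial>lborel)"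
    by (intro nn_integral_mono mult_left_mono K) simp
  also have "\<dots> = (\<integral>\<^sup>+x. ennreal \<bar>?f x\<bar> \<partial>lborel) * ennreal K" by (simp add: nn_integral_multc)
  also have "\<dots> < \<infinity>"
    using f unfolding tame_def set_integrable_def by (auto simp: ennreal_mult_less_top integrable_iff_bounded)
  finally show "(\<integral>\<^sup>+z. ennreal (norm (case z of (x, y) \<Rightarrow> ?f x * ?g y * theta H x y)) \<partial>(lborel \<Otimes>\<^sub>M lborel)) < \<infinity>" .
qed

lemma inner_theta_product:
  assumes f: "tame f" and g: "tame g"
  shows "inner_theta H f g = (\<integral>(x, y). (indicator {0..} x * f x) * (indicator {0..} y * g y) * theta H x y \<partial>(lborel \<Otimes>\<^sub>M lborel))"
proof -
  have "inner_theta H f g = (\<integral>x. \<integral>y. (indicator {0..} x * f x) * (indicator {0..} y * g y) * theta H x y \<partial>lborel \<partial>lborel)"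
    unfolding inner_theta_def set_lebesgue_integral_def
  proof (rule Bochner_Integration.integral_cong[OF refl])
    fix x
    have "indicator {0..} x *\<^sub>R (\<integral>y. indicator {0..} y *\<^sub>R (f x * g y * theta H x y) \<partial>lborel)
        = (\<integral>y. indicator {0..} x *\<^sub>R (indicator {0..} y *\<^sub>R (f x * g y * theta H x y)) \<partial>lborel)"
      by (rule integral_scaleR_right[symmetric])
    also have "\<dots> = (\<integral>y. (indicator {0..} x * f x) * (indicator {0..} y * g y) * theta H x y \<partial>lborel)"
      by (rule Bochner_Integration.integral_cong[OF refl]) (simp only: real_scaleR_def mult_ac)
    finally show "indicator {0..} x *\<^sub>R (\<integral>y. indicator {0..} y *\<^sub>R (f x * g y * theta H x y) \<partial>lborel)
        = (\<integral>y. (indicator {0..} x * f x) * (indicator {0..} y * g y) * theta H x y \<partial>lborel)" .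
  qed
  also have "\<dots> = (\<integral>(x, y). (indicator {0..} x * f x) * (indicator {0..} y * g y) * theta H x y \<partial>(lborel \<Otimes>\<^sub>M lborel))"
    by (rule lborel_pair.integral_fst[OF tame_energy_integrable[OF f g]])
  finally show ?thesis .
qed

lemma inner_theta_add_left:
  assumes "tame f" "tame f'" "tame g"
  shows "inner_theta H (\<lambda>x. f x + f' x) g = inner_theta H f g + inner_theta H f' g"
  unfolding inner_theta_product[OF assms(1,3)] inner_theta_product[OF assms(2,3)]
    inner_theta_product[OF tame_add[OF assms(1,2)] assms(3)]
  by (subst Bochner_Integration.integral_add[symmetric, OF tame_energy_integrable[OF assms(1,3)] tame_energy_integrable[OF assms(2,3)]])
    (auto intro!: Bochner_Integration.integral_cong simp: algebra_simps)

lemma inner_theta_mono: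
  assumes "tame f" "tame g" "tame f'" "tame g'"
    and le: "\<And>x y. 0 \<le> x \<Longrightarrow> 0 \<le> y \<Longrightarrow> f x * g y \<le> f' x * g' y"
  shows "inner_theta H f g \<le> inner_theta H f' g'"
  unfolding inner_theta_product[OF assms(1,2)] inner_theta_product[OF assms(3,4)]
proof (rule integral_mono[OF tame_energy_integrable[OF assms(1,2)] tame_energy_integrable[OF assms(3,4)]])
  fix z :: "real \<times> real"
  show "(case z of (x, y) \<Rightarrow> indicat_real {0..} x * f x * (indicat_real {0..} y * g y) * theta H x y)
    \<le> (case z of (x, y) \<Rightarrow> indicat_real {0..} x * f' x * (indicat_real {0..} y * g' y) * theta H x y)"
    using le theta_nonneg[of "fst z" "snd z"] by (auto simp: indicator_def split: prod.splits intro!: mult_right_mono)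
qed

lemma inner_theta_nonneg:
  assumes "tame f" "tame g" "\<And>x. 0 \<le> x \<Longrightarrow> 0 \<le> f x" "\<And>x. 0 \<le> x \<Longrightarrow> 0 \<le> g x"
  shows "0 \<le> inner_theta H f g"
  unfolding inner_theta_product[OF assms(1,2)] using assms(3,4) theta_nonneg
  by (intro integral_nonneg_AE AE_I2) (auto simp: indicator_def)

text \<open>As a single integral over the product space the energy has the integrable majorant
  \<open>d x * d y * theta H x y\<close>.\<close>

lemma inner_theta_tendsto:
  assumes d: "tame d" and fm: "\<And>k. tame (f k)" and gm: "\<And>k. tame (g k)" and "tame f'" "tame g'"
    and fd: "\<And>k x. 0 \<le> x \<Longrightarrow> \<bar>f k x\<bar> \<le> d x" and gd: "\<And>k x. 0 \<le> x \<Longrightarrow> \<bar>g k x\<bar> \<le> d x"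
    and fl: "\<And>x. 0 \<le> x \<Longrightarrow> (\<lambda>k. f k x) \<longlonglongrightarrow> f' x" and gl: "\<And>x. 0 \<le> x \<Longrightarrow> (\<lambda>k. g k x) \<longlonglongrightarrow> g' x"
  shows "(\<lambda>k. inner_theta H (f k) (g k)) \<longlonglongrightarrow> inner_theta H f' g'"
  unfolding inner_theta_product[OF fm gm] inner_theta_product[OF assms(4,5)]
proof (rule integral_dominated_convergence[OF _ _ tame_energy_integrable[OF d d]])
  show "(\<lambda>(x, y). indicat_real {0..} x * f' x * (indicat_real {0..} y * g' y) * theta H x y) \<in> borel_measurable (lborel \<Otimes>\<^sub>M lborel)"
    using tame_energy_integrable[OF assms(4,5)] by (rule borel_measurable_integrable)
  show "(\<lambda>(x, y). indicat_real {0..} x * f k x * (indicat_real {0..} y * g k y) * theta H x y) \<in> borel_measurable (lborel \<Otimes>\<^sub>M lborel)" for k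
    using tame_energy_integrable[OF fm gm] by (rule borel_measurable_integrable)
  show "AE z in lborel \<Otimes>\<^sub>M lborel. (\<lambda>k. case z of (x, y) \<Rightarrow> indicat_real {0..} x * f k x * (indicat_real {0..} y * g k y) * theta H x y)
     \<longlonglongrightarrow> (case z of (x, y) \<Rightarrow> indicat_real {0..} x * f' x * (indicat_real {0..} y * g' y) * theta H x y)"
    using fl gl by (intro AE_I2) (auto simp: indicator_def split: prod.splits intro!: tendsto_intros)
  show "AE z in lborel \<Otimes>\<^sub>M lborel. norm (case z of (x, y) \<Rightarrow> indicat_real {0..} x * f k x * (indicat_real {0..} y * g k y) * theta H x y)
     \<le> (case z of (x, y) \<Rightarrow> indicat_real {0..} x * d x * (indicat_real {0..} y * d y) * theta H x y)" for k
    using fd gd theta_nonneg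
    by (intro AE_I2) (auto simp: indicator_def abs_mult split: prod.splits intro!: mult_right_mono mult_mono intro: order_trans[OF abs_ge_zero])
qed

end

lemma tame_limit:
  assumes d: "tame d" and f: "\<And>k. tame (f k)" and le: "\<And>k x. 0 \<le> x \<Longrightarrow> \<bar>f k x\<bar> \<le> d x"
    and lim: "\<And>x. 0 \<le> x \<Longrightarrow> (\<lambda>k. f k x) \<longlonglongrightarrow> f' x"
  shows "tame f'" and "0 \<le> x \<Longrightarrow> \<bar>f' x\<bar> \<le> d x"
proof -
  show le': "\<bar>f' x\<bar> \<le> d x" if "0 \<le> x" for x
    by (rule LIMSEQ_le_const2[OF tendsto_rabs[OF lim[OF that]]]) (use le[OF that] in auto)
  have "(\<lambda>x. indicator {0..} x * f' x) \<in> borel_measurable borel"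
  proof (rule borel_measurable_LIMSEQ_real)
    show "(\<lambda>x. indicator {0..} x * f k x) \<in> borel_measurable borel" for k using f by (rule tame_measurable)
    show "(\<lambda>k. indicator {0..} x * f k x) \<longlonglongrightarrow> indicator {0..} x * f' x" for x
      using lim by (auto simp: indicator_def)
  qed
  then show "tame f'" using le' by (rule tame_dominated[OF d])
qed

text \<open>Only measurability is assumed, since a function known merely through
  \<open>represents\<close> need not be tame. The inner integral does not involve the first
  function, so the outer integrands agree almost everywhere.\<close>

lemma inner_theta_cong_AE:
  assumes fm: "(\<lambda>x. indicator {0..} x * f x) \<in> borel_measurable borel"
    and fm': "(\<lambda>x. indicator {0..} x * f' x) \<in> borel_measurable borel"
    and gm: "(\<lambda>x. indicator {0..} x * g x) \<in> borel_measurable borel"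
    and ae: "AE x in lborel. 0 \<le> x \<longrightarrow> f x = f' x"
  shows "inner_theta H f g = inner_theta H f' g"
proof -
  have r: "inner_theta H h g = (\<integral>x. (indicator {0..} x * h x) * (\<integral>y. (indicator {0..} y * g y) * theta H x y \<partial>lborel) \<partial>lborel)" for h
    unfolding inner_theta_def set_lebesgue_integral_def
  proof (rule Bochner_Integration.integral_cong[OF refl])
    fix x
    have "(\<integral>y. indicator {0..} y *\<^sub>R (h x * g y * theta H x y) \<partial>lborel)
        = (\<integral>y. h x * ((indicator {0..} y * g y) * theta H x y) \<partial>lborel)"
      by (rule Bochner_Integration.integral_cong[OF refl]) (simp only: real_scaleR_def mult_ac)
    then show "indicator {0..} x *\<^sub>R (\<integral>y. indicator {0..} y *\<^sub>R (h x * g y * theta H x y) \<partial>lborel)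
        = (indicator {0..} x * h x) * (\<integral>y. (indicator {0..} y * g y) * theta H x y \<partial>lborel)"
      by (simp only: real_scaleR_def integral_mult_right_zero mult.assoc)
  qed
  note [measurable] = fm fm' gm
  have [measurable]: "(\<lambda>x. \<integral>y. (indicator {0..} y * g y) * theta H x y \<partial>lborel) \<in> borel_measurable borel"
    unfolding theta_def by (intro lborel.borel_measurable_lebesgue_integral) measurable
  show ?thesis unfolding r
  proof (rule integral_cong_AE)
    show "AE x in lborel. indicator {0..} x * f x * (\<integral>y. indicator {0..} y * g y * theta H x y \<partial>lborel)
        = indicator {0..} x * f' x * (\<integral>y. indicator {0..} y * g y * theta H x y \<partial>lborel)"
      using ae by eventually_elim (auto simp: indicator_def)
  qed measurable
qed

section \<open>Schwartz functions on the half-line and smooth cutoffs\<close>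

lemma schwartz_halflineE:
  assumes "f \<in> schwartz_halfline"
  obtains g :: "nat \<Rightarrow> real \<Rightarrow> real" where "\<forall>x\<ge>0. g 0 x = f x"
    "\<forall>k. \<forall>x\<ge>0. (g k has_real_derivative g (Suc k) x) (at x within {0..})"
    "\<forall>j k. bounded ((\<lambda>x. x ^ j * g k x) ` {0..})"
  using assms unfolding schwartz_halfline_def by auto

lemma schwartz_halfline_lincomb:
  assumes "f \<in> schwartz_halfline" "f' \<in> schwartz_halfline"
  shows "(\<lambda>x. a * f x + b * f' x) \<in> schwartz_halfline"
proof -
  obtain g where g: "\<forall>x\<ge>0. g 0 x = f x"
     "\<forall>k. \<forall>x\<ge>0. (g k has_real_derivative g (Suc k) x) (at x within {0..})"
     "\<forall>j k. bounded ((\<lambda>x. x ^ j * g k x) ` {0..})"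
    by (rule schwartz_halflineE[OF assms(1)]) (rule that)
  obtain g' where g': "\<forall>x\<ge>0. g' 0 x = f' x"
     "\<forall>k. \<forall>x\<ge>0. (g' k has_real_derivative g' (Suc k) x) (at x within {0..})"
     "\<forall>j k. bounded ((\<lambda>x. x ^ j * g' k x) ` {0..})"
    by (rule schwartz_halflineE[OF assms(2)]) (rule that)
  show ?thesis unfolding schwartz_halfline_def
  proof (intro CollectI exI[of _ "\<lambda>k x. a * g k x + b * g' k x"] conjI allI impI)
    fix k and x :: real assume "0 \<le> x"
    then show "((\<lambda>x. a * g k x + b * g' k x) has_real_derivative a * g (Suc k) x + b * g' (Suc k) x) (at x within {0..})"
      using g(2) g'(2) by (intro DERIV_add DERIV_cmult) auto
  next
    fix j k
    have "bounded ((\<lambda>x. a *\<^sub>R (x ^ j * g k x)) ` {0..})" "bounded ((\<lambda>x. b *\<^sub>R (x ^ j * g' k x)) ` {0..})"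
      using g(3) g'(3) by (metis bounded_scaleR_comp)+
    then have "bounded ((\<lambda>x. a *\<^sub>R (x ^ j * g k x) + b *\<^sub>R (x ^ j * g' k x)) ` {0..})"
      by (rule bounded_plus_comp)
    then show "bounded ((\<lambda>x. x ^ j * (a * g k x + b * g' k x)) ` {0..})"
      by (simp add: algebra_simps)
  qed (use g g' in auto)
qed

lemma schwartz_halfline_decay:
  assumes "f \<in> schwartz_halfline"
  obtains C where "0 < C" "\<And>x. 0 \<le> x \<Longrightarrow> \<bar>f x\<bar> \<le> C / (1 + x\<^sup>2)"
proof -
  obtain g where g: "\<forall>x\<ge>0. g 0 x = f x"
     "\<forall>k. \<forall>x\<ge>0. (g k has_real_derivative g (Suc k) x) (at x within {0..})"
     "\<forall>j k. bounded ((\<lambda>x. x ^ j * g k x) ` {0..})"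
    by (rule schwartz_halflineE[OF assms]) (rule that)
  obtain C where C: "\<And>x. 0 \<le> x \<Longrightarrow> \<bar>x ^ 0 * g 0 x\<bar> \<le> C"
    using g(3)[rule_format, of 0 0] by (auto simp: bounded_iff)
  obtain D where D: "0 < D" "\<And>x. 0 \<le> x \<Longrightarrow> \<bar>x ^ 2 * g 0 x\<bar> \<le> D"
    using g(3)[rule_format, of 2 0] by (auto simp: bounded_pos)
  have "\<bar>f x\<bar> \<le> (C + D) / (1 + x\<^sup>2)" if x: "0 \<le> x" for x
  proof -
    have "\<bar>f x\<bar> * (1 + x\<^sup>2) = \<bar>x ^ 0 * g 0 x\<bar> + \<bar>x ^ 2 * g 0 x\<bar>"
      using g(1) x by (simp add: abs_mult algebra_simps)
    also have "\<dots> \<le> C + D" using C[OF x] D(2)[OF x] by linarith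
    finally show ?thesis by (simp add: pos_le_divide_eq add_pos_nonneg)
  qed
  moreover have "0 < C + D" using C[of 0] D(1) by simp
  ultimately show thesis by (rule that[rotated])
qed

lemma tame_inverse_square: "tame (\<lambda>x. C / (1 + x\<^sup>2))"
proof -
  have "integrable lborel (\<lambda>x::real. inverse (1 + x\<^sup>2))"
    using integrable_inverse_1_plus_square by (simp add: set_integrable_def)
  then have "integrable lborel (\<lambda>x::real. indicator {0..} x *\<^sub>R inverse (1 + x\<^sup>2))"
    by (rule integrable_mult_indicator[rotated]) simp
  then have "tame (\<lambda>x. inverse (1 + x\<^sup>2))"
    by (auto simp: tame_def set_integrable_def inverse_le_1_iff intro!: boundedI[of _ 1])
  from tame_cmult[OF this, of C] show ?thesis by (simp add: divide_inverse)
qed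

lemma schwartz_halfline_continuous:
  assumes "f \<in> schwartz_halfline" shows "continuous_on {0..} f"
proof -
  obtain g where g: "\<forall>x\<ge>0. g 0 x = f x"
     "\<forall>k. \<forall>x\<ge>0. (g k has_real_derivative g (Suc k) x) (at x within {0..})"
    by (rule schwartz_halflineE[OF assms]) (rule that)
  have "continuous_on {0..} (g 0)"
    by (rule DERIV_continuous_on) (use g(2) in auto)
  then show ?thesis using g(1) continuous_on_cong[of "{0..}" "{0..}" "g 0" f] by auto
qed

lemma tame_schwartz:
  assumes f: "f \<in> schwartz_halfline" shows "tame f"
proof -
  obtain C where C: "\<And>x. 0 \<le> x \<Longrightarrow> \<bar>f x\<bar> \<le> C / (1 + x\<^sup>2)" using schwartz_halfline_decay[OF f] by blast
  have "set_borel_measurable borel {0..} f"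
    unfolding set_borel_measurable_def
    by (rule borel_measurable_continuous_on_indicator) (use schwartz_halfline_continuous[OF f] in auto)
  then show ?thesis
    by (intro tame_dominated[OF tame_inverse_square _ C]) (simp_all add: set_borel_measurable_def)
qed

lemma power_times_exp_bounded:
  assumes "0 < (c::real)" "0 \<le> x"
  shows "x ^ k * exp (- c * x) \<le> fact k / c ^ k"
proof -
  have "(\<Sum>n\<in>{k}. (c * x) ^ n /\<^sub>R fact n) \<le> (\<Sum>n. (c * x) ^ n /\<^sub>R fact n)"
    using assms by (intro sum_le_suminf summable_exp_generic) auto
  then have "(c * x) ^ k / fact k \<le> exp (c * x)" by (simp add: exp_def divide_inverse mult.commute)
  then have "c ^ k * (x ^ k) \<le> fact k * exp (c * x)" by (simp add: field_simps power_mult_distrib)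
  then show ?thesis using assms by (simp add: exp_minus field_simps)
qed

lemma poly_times_exp_bounded:
  assumes c: "0 < c" and q: "\<And>x. 0 \<le> x \<Longrightarrow> c * x - b \<le> poly q x"
  shows "bounded ((\<lambda>x. poly p x * exp (- poly q x)) ` {0::real..})"
proof (rule boundedI)
  fix y assume "y \<in> (\<lambda>x. poly p x * exp (- poly q x)) ` {0..}"
  then obtain x where x: "0 \<le> x" and y: "y = poly p x * exp (- poly q x)" by auto
  have "norm y = \<bar>poly p x\<bar> * exp (- poly q x)" by (simp add: y abs_mult)
  also have "\<dots> \<le> \<bar>poly p x\<bar> * (exp b * exp (- c * x))"
    using q[OF x] by (intro mult_left_mono) (auto simp: exp_add[symmetric])
  also have "\<dots> \<le> (\<Sum>i\<le>degree p. \<bar>coeff p i\<bar> * x ^ i) * (exp b * exp (- c * x))"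
    unfolding poly_altdef using x
    by (intro mult_right_mono order_trans[OF sum_abs] sum_mono) (auto simp: abs_mult)
  also have "\<dots> = (\<Sum>i\<le>degree p. \<bar>coeff p i\<bar> * exp b * (x ^ i * exp (- c * x)))"
    unfolding sum_distrib_right by (intro sum.cong refl) (simp only: mult_ac)
  also have "\<dots> \<le> (\<Sum>i\<le>degree p. \<bar>coeff p i\<bar> * exp b * (fact i / c ^ i))"
    by (intro sum_mono mult_left_mono power_times_exp_bounded c x) auto
  finally show "norm y \<le> (\<Sum>i\<le>degree p. \<bar>coeff p i\<bar> * exp b * (fact i / c ^ i))" .
qed

text \<open>Derivatives stay of the form polynomial times \<open>exp (- q)\<close>, because
  \<open>p\<close> turns into \<open>p' - p q'\<close>; one boundedness statement therefore covers
  all seminorms.\<close>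

lemma schwartz_poly_exp:
  assumes c: "0 < c" and q: "\<And>x. 0 \<le> x \<Longrightarrow> c * x - b \<le> poly q x"
  shows "(\<lambda>x. poly p x * exp (- poly q x)) \<in> schwartz_halfline"
proof -
  define P where "P k = ((\<lambda>p. pderiv p - p * pderiv q) ^^ k) p" for k
  show ?thesis unfolding schwartz_halfline_def
  proof (intro CollectI exI[of _ "\<lambda>k x. poly (P k) x * exp (- poly q x)"] conjI allI impI)
    fix k and x :: real
    show "((\<lambda>x. poly (P k) x * exp (- poly q x)) has_real_derivative poly (P (Suc k)) x * exp (- poly q x)) (at x within {0..})"
      by (rule derivative_eq_intros refl | simp add: P_def algebra_simps)+
  next
    fix j k
    show "bounded ((\<lambda>x. x ^ j * (poly (P k) x * exp (- poly q x))) ` {0..})"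
      using poly_times_exp_bounded[OF c q, where p="monom 1 j * P k"] by (simp add: poly_monom mult.assoc)
  qed (simp add: P_def)
qed

text \<open>Explicit smooth approximations of the indicator of \<open>[0, s]\<close>. The division
  by \<open>N\<close> makes the value at \<open>x = s\<close> tend to \<open>1\<close>, so they
  converge at every point of the half-line, under one exponential majorant.\<close>

lemma schwartz_cutoff:
  assumes "0 < (s::real)" "0 < N"
  shows "(\<lambda>x. exp (- ((x / s) ^ N / real N))) \<in> schwartz_halfline"
    and "0 \<le> x \<Longrightarrow> exp (- ((x / s) ^ N / real N)) \<le> exp 1 * exp (- x / s)"
proof -
  \<comment> \<open>Bernoulli's inequality replaces the power by its tangent at
    \<open>x = s\<close>; after division by \<open>N\<close> the slope is independent of
    \<open>N\<close>.\<close>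
  have bern: "(1 / s) * x - 1 \<le> (x / s) ^ N / real N" if "0 \<le> x" for x
  proof -
    have "1 + real N * (x / s - 1) \<le> (1 + (x / s - 1)) ^ N"
      using that assms by (intro Bernoulli_inequality) auto
    then have "real N * (x / s - 1) \<le> (x / s) ^ N" by simp
    then show ?thesis using assms by (simp add: pos_le_divide_eq mult.commute)
  qed
  let ?q = "monom (1 / (s ^ N * real N)) N"
  have q: "poly ?q x = (x / s) ^ N / real N" for x by (simp add: poly_monom power_divide)
  have "(\<lambda>x. poly 1 x * exp (- poly ?q x)) \<in> schwartz_halfline"
    by (rule schwartz_poly_exp[of "1 / s" 1]) (use bern q assms in auto)
  then show "(\<lambda>x. exp (- ((x / s) ^ N / real N))) \<in> schwartz_halfline" by (simp add: q)
  show "exp (- ((x / s) ^ N / real N)) \<le> exp 1 * exp (- x / s)" if "0 \<le> x"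
    using bern[OF that] by (simp add: exp_add[symmetric])
qed

lemma schwartz_exp: "0 < c \<Longrightarrow> (\<lambda>x. exp (- c * x)) \<in> schwartz_halfline"
  using schwartz_poly_exp[of c 0 "[:0, c:]" 1] by (simp add: mult.commute)

lemma cutoff_tendsto:
  assumes s: "0 < (s::real)" and x: "0 \<le> x"
  shows "(\<lambda>N. exp (- ((x / s) ^ Suc N / real (Suc N)))) \<longlonglongrightarrow> indicator {0..s} x"
proof (cases "x \<le> s")
  case True
  have "(\<lambda>N. (x / s) ^ Suc N / real (Suc N)) \<longlonglongrightarrow> 0"
  proof (rule tendsto_sandwich[OF _ _ tendsto_const])
    have "(x / s) ^ Suc N \<le> 1" for N using True x s by (intro power_le_one) auto
    then show "eventually (\<lambda>N. (x / s) ^ Suc N / real (Suc N) \<le> 1 / real (Suc N)) sequentially"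
      by (intro always_eventually allI divide_right_mono) auto
    show "(\<lambda>N. 1 / real (Suc N)) \<longlonglongrightarrow> 0" by real_asymp
  qed (use x s in auto)
  then have "(\<lambda>N. exp (- ((x / s) ^ Suc N / real (Suc N)))) \<longlonglongrightarrow> exp (- 0)"
    by (intro tendsto_intros)
  then show ?thesis using True x by simp
next
  case False
  define r where "r = x / s"
  have r: "1 < r" using False s by (simp add: r_def)
  have "(\<lambda>N. exp (- (r ^ Suc N / real (Suc N)))) \<longlonglongrightarrow> 0" using r by real_asymp
  then show ?thesis using False by (simp add: r_def)
qed

section \<open>Step functions in the completion\<close>

locale regular_hurst_completion = hurst_completion H \<iota> + regular_hurst H
  for H :: real and \<iota> :: "(real \<Rightarrow> real) \<Rightarrow> 'h::{real_inner, complete_space}"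
begin

text \<open>Whereas \<open>represents\<close> prescribes the pairings with Schwartz functions, this
  notion couples dominated pointwise convergence with convergence in the completion. The isometry
  then extends to two such limits, in particular to pairs of indicators.\<close>

definition schwartz_limit :: "(real \<Rightarrow> real) \<Rightarrow> 'h \<Rightarrow> bool" where
  "schwartz_limit f v \<longleftrightarrow> (\<exists>\<phi> d. (\<forall>k::nat. \<phi> k \<in> schwartz_halfline) \<and> tame d \<and>
     (\<forall>k x. 0 \<le> x \<longrightarrow> \<bar>\<phi> k x\<bar> \<le> d x) \<and> (\<forall>x\<ge>0. (\<lambda>k. \<phi> k x) \<longlonglongrightarrow> f x) \<and> (\<lambda>k. \<iota> (\<phi> k)) \<longlonglongrightarrow> v)"

lemma schwartz_limitE:
  assumes "schwartz_limit f v"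
  obtains \<phi> d where "\<And>k::nat. \<phi> k \<in> schwartz_halfline" "tame d"
    "\<And>k x. 0 \<le> x \<Longrightarrow> \<bar>\<phi> k x\<bar> \<le> d x" "\<And>x. 0 \<le> x \<Longrightarrow> (\<lambda>k. \<phi> k x) \<longlonglongrightarrow> f x" "(\<lambda>k. \<iota> (\<phi> k)) \<longlonglongrightarrow> v"
  using assms unfolding schwartz_limit_def by auto

lemma schwartz_limit_tame: "schwartz_limit f v \<Longrightarrow> tame f"
  by (erule schwartz_limitE) (rule tame_limit(1)[OF _ tame_schwartz]; assumption)

lemma schwartz_limit_inner:
  assumes "schwartz_limit f v" "schwartz_limit g w"
  shows "inner v w = inner_theta H f g"
proof -
  obtain \<phi> d where \<phi>: "\<And>k::nat. \<phi> k \<in> schwartz_halfline" "tame d"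
    "\<And>k x. 0 \<le> x \<Longrightarrow> \<bar>\<phi> k x\<bar> \<le> d x" "\<And>x. 0 \<le> x \<Longrightarrow> (\<lambda>k. \<phi> k x) \<longlonglongrightarrow> f x" "(\<lambda>k. \<iota> (\<phi> k)) \<longlonglongrightarrow> v"
    using schwartz_limitE[OF assms(1)] by metis
  obtain \<psi> d' where \<psi>: "\<And>k::nat. \<psi> k \<in> schwartz_halfline" "tame d'"
    "\<And>k x. 0 \<le> x \<Longrightarrow> \<bar>\<psi> k x\<bar> \<le> d' x" "\<And>x. 0 \<le> x \<Longrightarrow> (\<lambda>k. \<psi> k x) \<longlonglongrightarrow> g x" "(\<lambda>k. \<iota> (\<psi> k)) \<longlonglongrightarrow> w"
    using schwartz_limitE[OF assms(2)] by metis
  have d: "0 \<le> d x" "0 \<le> d' x" if "0 \<le> x" for x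
    using \<phi>(3)[of x 0] \<psi>(3)[of x 0] that by auto
  have "(\<lambda>k. inner_theta H (\<phi> k) (\<psi> k)) \<longlonglongrightarrow> inner_theta H f g"
  proof (rule inner_theta_tendsto[where d = "\<lambda>x. d x + d' x"])
    show "\<bar>\<phi> k x\<bar> \<le> d x + d' x" "\<bar>\<psi> k x\<bar> \<le> d x + d' x" if "0 \<le> x" for k x
      using \<phi>(3)[of x k] \<psi>(3)[of x k] d[OF that] that by auto
  qed (use \<phi> \<psi> assms in \<open>auto intro: tame_add tame_schwartz schwartz_limit_tame\<close>)
  moreover have "(\<lambda>k. inner (\<iota> (\<phi> k)) (\<iota> (\<psi> k))) \<longlonglongrightarrow> inner v w"
    using \<phi>(5) \<psi>(5) by (rule tendsto_inner)
  ultimately show ?thesis using \<iota>_isometry[OF \<phi>(1) \<psi>(1)] by (auto intro: LIMSEQ_unique)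
qed

lemma schwartz_limit_schwartz: "f \<in> schwartz_halfline \<Longrightarrow> schwartz_limit f (\<iota> f)"
  unfolding schwartz_limit_def
  by (rule exI[of _ "\<lambda>_. f"], rule exI[of _ "\<lambda>x. \<bar>f x\<bar>"]) (auto intro: tame_abs tame_schwartz)

lemma schwartz_limit_lincomb:
  assumes "schwartz_limit f v" "schwartz_limit g w"
  shows "schwartz_limit (\<lambda>x. a * f x + b * g x) (a *\<^sub>R v + b *\<^sub>R w)"
proof -
  obtain \<phi> d where \<phi>: "\<And>k::nat. \<phi> k \<in> schwartz_halfline" "tame d"
    "\<And>k x. 0 \<le> x \<Longrightarrow> \<bar>\<phi> k x\<bar> \<le> d x" "\<And>x. 0 \<le> x \<Longrightarrow> (\<lambda>k. \<phi> k x) \<longlonglongrightarrow> f x" "(\<lambda>k. \<iota> (\<phi> k)) \<longlonglongrightarrow> v"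
    using schwartz_limitE[OF assms(1)] by metis
  obtain \<psi> d' where \<psi>: "\<And>k::nat. \<psi> k \<in> schwartz_halfline" "tame d'"
    "\<And>k x. 0 \<le> x \<Longrightarrow> \<bar>\<psi> k x\<bar> \<le> d' x" "\<And>x. 0 \<le> x \<Longrightarrow> (\<lambda>k. \<psi> k x) \<longlonglongrightarrow> g x" "(\<lambda>k. \<iota> (\<psi> k)) \<longlonglongrightarrow> w"
    using schwartz_limitE[OF assms(2)] by metis
  show ?thesis unfolding schwartz_limit_def
  proof (intro exI[of _ "\<lambda>k x. a * \<phi> k x + b * \<psi> k x"] exI[of _ "\<lambda>x. \<bar>a\<bar> * d x + \<bar>b\<bar> * d' x"] conjI allI impI)
    fix k and x :: real assume x: "0 \<le> x"
    have "\<bar>a * \<phi> k x + b * \<psi> k x\<bar> \<le> \<bar>a\<bar> * \<bar>\<phi> k x\<bar> + \<bar>b\<bar> * \<bar>\<psi> k x\<bar>"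
      by (metis abs_mult abs_triangle_ineq)
    also have "\<dots> \<le> \<bar>a\<bar> * d x + \<bar>b\<bar> * d' x"
      using \<phi>(3)[OF x] \<psi>(3)[OF x] by (intro add_mono mult_left_mono) auto
    finally show "\<bar>a * \<phi> k x + b * \<psi> k x\<bar> \<le> \<bar>a\<bar> * d x + \<bar>b\<bar> * d' x" .
  next
    show "(\<lambda>k. \<iota> (\<lambda>x. a * \<phi> k x + b * \<psi> k x)) \<longlonglongrightarrow> a *\<^sub>R v + b *\<^sub>R w"
      unfolding \<iota>_linear[OF \<phi>(1) \<psi>(1)] by (intro tendsto_intros \<phi> \<psi>)
  qed (use \<phi> \<psi> in \<open>auto intro!: schwartz_halfline_lincomb tame_lincomb tendsto_intros\<close>)
qed

lemma schwartz_limit_diff: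
  assumes "schwartz_limit f v" "schwartz_limit g w"
  shows "schwartz_limit (\<lambda>x. f x - g x) (v - w)"
  using schwartz_limit_lincomb[OF assms, of 1 "-1"] by simp

lemma schwartz_limit_zero: "schwartz_limit (\<lambda>x. 0) 0"
  using schwartz_limit_lincomb[of _ _ _ _ 0 0] schwartz_limit_schwartz[OF schwartz_exp[of 1]] by fastforce

lemma schwartz_limit_sum:
  assumes "\<And>j. j < (n::nat) \<Longrightarrow> schwartz_limit (f j) (v j)"
  shows "schwartz_limit (\<lambda>x. \<Sum>j<n. c j * f j x) (\<Sum>j<n. c j *\<^sub>R v j)"
  using assms
proof (induction n)
  case 0
  show ?case using schwartz_limit_zero by simp
next
  case (Suc n)
  then have "schwartz_limit (\<lambda>x. 1 * (\<Sum>j<n. c j * f j x) + c n * f n x) (1 *\<^sub>R (\<Sum>j<n. c j *\<^sub>R v j) + c n *\<^sub>R v n)"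
    by (intro schwartz_limit_lincomb) auto
  then show ?case by simp
qed

text \<open>The squared distance of two members is the energy of \<open>f k - f l\<close>, at most
  the pairing of \<open>\<bar>f k - g\<bar> + \<bar>f l - g\<bar>\<close> with \<open>2 * d\<close>.
  Both parts vanish by dominated convergence, so the vectors form a Cauchy sequence before any limit
  is known.\<close>

lemma dominated_schwartz_limits_converge:
  assumes r: "\<And>k::nat. schwartz_limit (f k) (v k)" and d: "tame d"
    and le: "\<And>k x. 0 \<le> x \<Longrightarrow> \<bar>f k x\<bar> \<le> d x"
    and lim: "\<And>x. 0 \<le> x \<Longrightarrow> (\<lambda>k. f k x) \<longlonglongrightarrow> g x"
  obtains h where "v \<longlonglongrightarrow> h" "\<And>\<phi>. \<phi> \<in> schwartz_halfline \<Longrightarrow> inner h (\<iota> \<phi>) = inner_theta H g \<phi>"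
proof -
  have tf: "tame (f k)" for k using schwartz_limit_tame[OF r] .
  have tg: "tame g" and gd: "\<bar>g x\<bar> \<le> d x" if "0 \<le> x" for x
    using tame_limit[OF d tf le lim] that by auto
  have tg: "tame g" using tame_limit(1)[OF d tf le lim] .
  define a where "a k x = \<bar>f k x - g x\<bar>" for k x
  \<comment> \<open>Differences of two functions below \<open>d\<close> are below
    \<open>2 * d\<close>.\<close>
  define d2 where "d2 x = 2 * d x" for x
  have d0: "0 \<le> d x" if "0 \<le> x" for x using le[OF that, of 0] by linarith
  have ta: "tame (a k)" for k unfolding a_def[abs_def] by (intro tame_abs tame_diff tf tg)
  have td2: "tame d2" unfolding d2_def[abs_def] by (intro tame_cmult d)
  define r where "r k = inner_theta H (a k) d2" for k
  have r0: "r \<longlonglongrightarrow> 0"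
  proof -
    have "(\<lambda>k. inner_theta H (a k) d2) \<longlonglongrightarrow> inner_theta H (\<lambda>x. 0) d2"
    proof (rule inner_theta_tendsto[OF td2 ta td2 tame_zero td2])
      show "\<bar>a k x\<bar> \<le> d2 x" if "0 \<le> x" for k x
        using le[OF that, of k] gd[OF that] unfolding a_def d2_def by linarith
      show "(\<lambda>k. a k x) \<longlonglongrightarrow> 0" if "0 \<le> x" for x
        unfolding a_def using tendsto_diff[OF lim[OF that] tendsto_const[of "g x"]] by (intro tendsto_rabs_zero) simp
    qed (use d0 in \<open>auto simp: d2_def\<close>)
    then show ?thesis by (simp add: r_def[abs_def] inner_theta_def)
  qed
  have nb: "(norm (v k - v l))\<^sup>2 \<le> r k + r l" for k l
  proof -
    have "(norm (v k - v l))\<^sup>2 = inner_theta H (\<lambda>x. f k x - f l x) (\<lambda>x. f k x - f l x)"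
      unfolding power2_norm_eq_inner
      by (intro schwartz_limit_inner schwartz_limit_diff assms(1))
    also have "\<dots> \<le> inner_theta H (\<lambda>x. a k x + a l x) d2"
    proof (rule inner_theta_mono)
      fix x y :: real assume xy: "0 \<le> x" "0 \<le> y"
      have 1: "\<bar>f k x - f l x\<bar> \<le> a k x + a l x" unfolding a_def by linarith
      have 2: "\<bar>f k y - f l y\<bar> \<le> d2 y" unfolding d2_def using le[OF xy(2), of k] le[OF xy(2), of l] by linarith
      have "\<bar>f k x - f l x\<bar> * \<bar>f k y - f l y\<bar> \<le> (a k x + a l x) * d2 y"
        by (rule mult_mono[OF 1 2]) (auto simp: a_def)
      then show "(f k x - f l x) * (f k y - f l y) \<le> (a k x + a l x) * d2 y"
        by (metis abs_ge_self abs_mult order_trans)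
    qed (intro tame_diff tame_add tf ta td2)+
    also have "\<dots> = r k + r l" unfolding r_def by (intro inner_theta_add_left ta td2)
    finally show ?thesis .
  qed
  have "Cauchy v"
  proof (rule metric_CauchyI)
    fix e :: real assume e: "0 < e"
    obtain N where N: "\<And>k. N \<le> k \<Longrightarrow> r k < e\<^sup>2 / 2"
      using order_tendstoD(2)[OF r0, of "e\<^sup>2 / 2"] e by (auto simp: eventually_sequentially)
    have "dist (v k) (v l) < e" if "N \<le> k" "N \<le> l" for k l
    proof -
      have "(norm (v k - v l))\<^sup>2 < e\<^sup>2" using nb[of k l] N[OF that(1)] N[OF that(2)] by simp
      then show ?thesis using e by (simp add: dist_norm power2_less_imp_less)
    qed
    then show "\<exists>N. \<forall>k\<ge>N. \<forall>l\<ge>N. dist (v k) (v l) < e" by blast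
  qed
  then obtain h where h: "v \<longlonglongrightarrow> h" using Cauchy_convergent_iff convergent_def by blast
  have "inner h (\<iota> \<phi>) = inner_theta H g \<phi>" if \<phi>: "\<phi> \<in> schwartz_halfline" for \<phi>
  proof -
    have "(\<lambda>k. inner (v k) (\<iota> \<phi>)) \<longlonglongrightarrow> inner h (\<iota> \<phi>)" by (intro tendsto_intros h)
    moreover have "(\<lambda>k. inner (v k) (\<iota> \<phi>)) = (\<lambda>k. inner_theta H (f k) \<phi>)"
      using schwartz_limit_inner[OF assms(1) schwartz_limit_schwartz[OF \<phi>]] by simp
    moreover have "(\<lambda>k. inner_theta H (f k) \<phi>) \<longlonglongrightarrow> inner_theta H g \<phi>"
    proof (rule inner_theta_tendsto[where d = "\<lambda>x. d x + \<bar>\<phi> x\<bar>"])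
      show "\<bar>f k x\<bar> \<le> d x + \<bar>\<phi> x\<bar>" "\<bar>\<phi> x\<bar> \<le> d x + \<bar>\<phi> x\<bar>" if "0 \<le> x" for k x
        using le[OF that, of k] d0[OF that] by auto
    qed (use tf tg tame_add[OF d tame_abs] tame_schwartz[OF \<phi>] lim in auto)
    ultimately show ?thesis by (auto intro: LIMSEQ_unique)
  qed
  then show thesis using h that by blast
qed

lemma schwartz_sequence_limit:
  assumes "\<And>k::nat. \<phi> k \<in> schwartz_halfline" "tame d"
    "\<And>k x. 0 \<le> x \<Longrightarrow> \<bar>\<phi> k x\<bar> \<le> d x" "\<And>x. 0 \<le> x \<Longrightarrow> (\<lambda>k. \<phi> k x) \<longlonglongrightarrow> f x"
  shows "\<exists>v. schwartz_limit f v"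
proof -
  obtain h where "(\<lambda>k. \<iota> (\<phi> k)) \<longlonglongrightarrow> h"
    using dominated_schwartz_limits_converge[of \<phi> "\<lambda>k. \<iota> (\<phi> k)" d f] assms schwartz_limit_schwartz by metis
  then show ?thesis using assms unfolding schwartz_limit_def by blast
qed

lemma schwartz_limit_indicator: assumes "0 \<le> s" shows "\<exists>v. schwartz_limit (indicator {0..s}) v"
proof (cases "s = 0")
  \<comment> \<open>The cutoffs divide by \<open>s\<close>. For \<open>s = 0\<close> the functions
    \<open>exp (- (k + 1) * x)\<close> shrink to the indicator of the origin instead.\<close>
  case True
  show ?thesis
  proof (rule schwartz_sequence_limit)
    show "(\<lambda>x. exp (- real (Suc k) * x)) \<in> schwartz_halfline" for k by (rule schwartz_exp) simp
    show "tame (\<lambda>x. exp (- 1 * x))" by (intro tame_schwartz schwartz_exp) simp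
    show "\<bar>exp (- real (Suc k) * x)\<bar> \<le> exp (- 1 * x)" if "0 \<le> x" for k x
      using mult_right_mono[of 1 "real (Suc k)" x] that by (simp add: algebra_simps)
    show "(\<lambda>k. exp (- real (Suc k) * x)) \<longlonglongrightarrow> indicator {0..s} x" if x: "0 \<le> x" for x
    proof (cases "x = 0")
      case False
      then have "0 < x" using x by simp
      then have "(\<lambda>k. exp (- real (Suc k) * x)) \<longlonglongrightarrow> 0" by real_asymp
      then show ?thesis using True False x by simp
    qed (use True in simp)
  qed
next
  case False
  then have s: "0 < s" using assms by simp
  show ?thesis
  proof (rule schwartz_sequence_limit)
    show "(\<lambda>x. exp (- ((x / s) ^ Suc k / real (Suc k)))) \<in> schwartz_halfline" for k
      by (rule schwartz_cutoff[OF s]) simp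
    have "tame (\<lambda>x. exp (- (1 / s) * x))" by (intro tame_schwartz schwartz_exp) (use s in simp)
    then show "tame (\<lambda>x. exp 1 * exp (- x / s))" using tame_cmult[of "\<lambda>x. exp (- (1 / s) * x)" "exp 1"] by simp
    show "\<bar>exp (- ((x / s) ^ Suc k / real (Suc k)))\<bar> \<le> exp 1 * exp (- x / s)" if "0 \<le> x" for k x
      using schwartz_cutoff(2)[OF s _ that, of "Suc k"] by simp
  qed (rule cutoff_tendsto[OF s])
qed

text \<open>The choice is immaterial: any two such limits have the same inner products with the
  dense image of \<open>\<iota>\<close>.\<close>

definition ind_vec :: "real \<Rightarrow> 'h" where
  "ind_vec s = (SOME v. schwartz_limit (indicator {0..s}) v)"

lemma ind_vec: "0 \<le> s \<Longrightarrow> schwartz_limit (indicator {0..s}) (ind_vec s)"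
  unfolding ind_vec_def using schwartz_limit_indicator by (rule someI_ex)

lemma tame_set_integrable:
  assumes "tame f"
  shows "set_integrable (lborel \<Otimes>\<^sub>M lborel) ({0..} \<times> {0..}) (\<lambda>(s, t). f s * f t * theta H s t)"
proof -
  have "(\<lambda>z. indicator ({0..} \<times> {0..}) z *\<^sub>R (case z of (s, t) \<Rightarrow> f s * f t * theta H s t))
      = (\<lambda>(x, y). (indicator {0..} x * f x) * (indicator {0..} y * f y) * theta H x y)"
    by (auto simp: fun_eq_iff indicator_def)
  then show ?thesis unfolding set_integrable_def using tame_energy_integrable[OF assms assms] by simp
qed

lemma representsI:
  assumes "tame f" "\<And>\<phi>. \<phi> \<in> schwartz_halfline \<Longrightarrow> inner h (\<iota> \<phi>) = inner_theta H f \<phi>"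
  shows "represents f h"
  unfolding represents_def using assms tame_set_integrable[OF assms(1)] tame_measurable[OF assms(1)]
  by (simp add: set_borel_measurable_def)

lemma represents_ind_vec: "0 \<le> s \<Longrightarrow> represents (indicator {0..s}) (ind_vec s)"
  using ind_vec[of s] by (intro representsI)
    (auto intro: schwartz_limit_tame schwartz_limit_inner schwartz_limit_schwartz)

lemma schwartz_dense_eqI:
  assumes "\<And>\<phi>. \<phi> \<in> schwartz_halfline \<Longrightarrow> inner h (\<iota> \<phi>) = inner h' (\<iota> \<phi>)"
  shows "h = h'"
proof -
  have "h - h' \<in> closure (\<iota> ` schwartz_halfline)" using \<iota>_dense by simp
  then obtain x where x: "\<And>n. x n \<in> \<iota> ` schwartz_halfline" "x \<longlonglongrightarrow> h - h'"
    unfolding closure_sequential by blast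
  have "(\<lambda>n. inner (h - h') (x n)) \<longlonglongrightarrow> inner (h - h') (h - h')" by (intro tendsto_intros x)
  moreover have "inner (h - h') (x n) = 0" for n using x(1)[of n] assms by (auto simp: inner_diff_left)
  ultimately have "inner (h - h') (h - h') = 0" by (simp add: LIMSEQ_const_iff)
  then show ?thesis by simp
qed

text \<open>The completion does not see null sets of times. This matters when two versions of an
  integrand are known to agree only for almost every time.\<close>

lemma represents_unique_AE:
  assumes "represents f h" "represents f' h'" and ae: "AE x in lborel. 0 \<le> x \<longrightarrow> f x = f' x"
  shows "h = h'"
proof (rule schwartz_dense_eqI)
  fix \<phi> assume \<phi>: "\<phi> \<in> schwartz_halfline"
  have "inner_theta H f \<phi> = inner_theta H f' \<phi>"
    using assms(1,2) tame_measurable[OF tame_schwartz[OF \<phi>]]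
    by (intro inner_theta_cong_AE ae) (auto simp: represents_def set_borel_measurable_def)
  then show "inner h (\<iota> \<phi>) = inner h' (\<iota> \<phi>)" using assms(1,2) \<phi> by (simp add: represents_def)
qed

text \<open>The last summand only corrects the value at \<open>0\<close>, so that step functions on finer and finer grids
  converge everywhere and not just almost everywhere.\<close>

definition step_fun :: "(nat \<Rightarrow> real) \<Rightarrow> (nat \<Rightarrow> real) \<Rightarrow> nat \<Rightarrow> real \<Rightarrow> real" where
  "step_fun s c N x = (\<Sum>j<N. c j * (indicator {0..s (Suc j)} x - indicator {0..s j} x)) + c 0 * indicator {0..0} x"

text \<open>The correction at the origin in \<open>step_fun\<close> has no counterpart here, since
  \<open>ind_vec 0 = 0\<close>.\<close>

definition step_vec :: "(nat \<Rightarrow> real) \<Rightarrow> (nat \<Rightarrow> real) \<Rightarrow> nat \<Rightarrow> 'h" where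
  "step_vec s c N = (\<Sum>j<N. c j *\<^sub>R (ind_vec (s (Suc j)) - ind_vec (s j)))"

lemma ind_vec_0: "ind_vec 0 = 0"
proof (rule represents_unique_AE[OF represents_ind_vec representsI])
  show "AE x::real in lborel. 0 \<le> x \<longrightarrow> indicat_real {0..0} x = 0"
    using AE_lborel_singleton[of 0] by eventually_elim (auto simp: indicator_def)
qed (auto simp: inner_theta_def tame_zero)

lemma step_fun_0: "(\<And>j. 0 \<le> s j) \<Longrightarrow> step_fun s c N 0 = c 0"
  by (simp add: step_fun_def)

text \<open>For \<open>x > 0\<close> the differences of indicators are indicators of the disjoint
  intervals \<open>(s j, s (j + 1)]\<close>, so at most one coefficient survives.\<close>

lemma step_fun_cases:
  assumes "mono s" "s 0 = 0" "0 < x"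
  shows "(\<exists>j<N. s j < x \<and> x \<le> s (Suc j) \<and> step_fun s c N x = c j) \<or> (s N < x \<and> step_fun s c N x = 0)"
proof (induction N)
  case 0
  then show ?case using assms by (simp add: step_fun_def)
next
  case (Suc N)
  have st: "step_fun s c (Suc N) x = step_fun s c N x + c N * (indicator {0..s (Suc N)} x - indicator {0..s N} x)"
    by (simp add: step_fun_def)
  from Suc show ?case
  proof (elim disjE exE conjE)
    fix j assume j: "j < N" "s j < x" "x \<le> s (Suc j)" "step_fun s c N x = c j"
    have "s (Suc j) \<le> s N" "s N \<le> s (Suc N)" using j(1) by (auto intro!: monoD[OF assms(1)])
    then have "step_fun s c (Suc N) x = c j" unfolding st using j assms(3) by simp
    then show ?thesis using j less_SucI by blast
  next
    assume a: "s N < x" "step_fun s c N x = 0"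
    show ?thesis
    proof (cases "x \<le> s (Suc N)")
      case True
      then have "step_fun s c (Suc N) x = c N" unfolding st using a assms(3) by simp
      then show ?thesis using a True by blast
    next
      case False
      then have "step_fun s c (Suc N) x = 0" unfolding st using a assms(3) by simp
      then show ?thesis using False by simp
    qed
  qed
qed

lemma step_funE:
  assumes "mono s" "s 0 = 0" "0 < x" "x \<le> s N"
  obtains j where "j < N" "s j < x" "x \<le> s (Suc j)" "step_fun s c N x = c j"
  using step_fun_cases[OF assms(1-3), of N c] assms(4) by auto

lemma schwartz_limit_step:
  assumes "\<And>j. 0 \<le> s j" shows "schwartz_limit (step_fun s c N) (step_vec s c N)"
proof -
  have "schwartz_limit (\<lambda>x. \<Sum>j<N. c j * (indicator {0..s (Suc j)} x - indicator {0..s j} x)) (step_vec s c N)"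
    unfolding step_vec_def by (intro schwartz_limit_sum schwartz_limit_diff ind_vec assms)
  from schwartz_limit_lincomb[OF this ind_vec[of 0], of 1 "c 0"] show ?thesis
    by (simp add: step_fun_def[abs_def] ind_vec_0)
qed

lemma step_fun_bounded_by:
  assumes s: "mono s" "s 0 = 0" and x: "0 \<le> x" and K: "0 \<le> K"
    and c: "x = 0 \<Longrightarrow> \<bar>c 0\<bar> \<le> K" "\<And>j. j < N \<Longrightarrow> s j < x \<Longrightarrow> x \<le> s (Suc j) \<Longrightarrow> \<bar>c j\<bar> \<le> K"
  shows "\<bar>step_fun s c N x\<bar> \<le> K"
proof (cases "x = 0")
  case True
  have "0 \<le> s j" for j using monoD[OF s(1), of 0 j] s(2) by simp
  then show ?thesis using True c(1) by (simp add: step_fun_0)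
next
  case False
  then show ?thesis using step_fun_cases[OF s, of x N c] x K c(2) by auto
qed

text \<open>Sampling \<open>f\<close> on finer and finer grids gives dominated step functions whose
  vectors lie in the span; their limit is recognised as \<open>\<iota> f\<close> by its pairings
  with Schwartz functions.\<close>

lemma schwartz_in_closure_span:
  assumes f: "f \<in> schwartz_halfline"
  obtains v where "\<And>k. v k \<in> span (ind_vec ` {0..})" "v \<longlonglongrightarrow> \<iota> f"
proof -
  \<comment> \<open>Mesh \<open>1 / (k + 1)\<close> with \<open>(k + 1)^2\<close> cells: the mesh
    shrinks while the covered interval \<open>[0, k + 1]\<close> grows.\<close>
  define s where "s k j = real j / real (Suc k)" for k j :: nat
  define F where "F k = step_fun (s k) (\<lambda>j. f (s k j)) ((Suc k)\<^sup>2)" for k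
  define v where "v k = step_vec (s k) (\<lambda>j. f (s k j)) ((Suc k)\<^sup>2)" for k
  have s: "mono (s k)" "s k 0 = 0" "0 \<le> s k j" for k j
    by (auto simp: s_def mono_def divide_right_mono)
  have s_Suc: "s k (Suc j) = s k j + 1 / real (Suc k)" for k j by (simp add: s_def add_divide_distrib)
  have sN: "s k ((Suc k)\<^sup>2) = real (Suc k)" for k unfolding s_def power2_eq_square of_nat_mult by (simp del: of_nat_Suc)
  obtain C where C: "0 < C" "\<And>x. 0 \<le> x \<Longrightarrow> \<bar>f x\<bar> \<le> C / (1 + x\<^sup>2)" using schwartz_halfline_decay[OF f] by blast
  have dom: "\<bar>F k x\<bar> \<le> 3 * C / (1 + x\<^sup>2)" if x: "0 \<le> x" for k x
    unfolding F_def
  proof (rule step_fun_bounded_by[OF s(1,2) x])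
    show "0 \<le> 3 * C / (1 + x\<^sup>2)" using C(1) by simp
    show "\<bar>f (s k 0)\<bar> \<le> 3 * C / (1 + x\<^sup>2)" if "x = 0" using C(2)[of 0] C(1) that by (simp add: s)
    fix j assume j: "s k j < x" "x \<le> s k (Suc j)"
    \<comment> \<open>A cell has length at most \<open>1\<close>, so moving from \<open>x\<close> to
      the left end of its cell costs at most a factor \<open>3\<close> in the majorant
      \<open>C / (1 + x^2)\<close>.\<close>
    have "x \<le> s k j + 1" using j(2) unfolding s_Suc by (rule order_trans) simp
    then have "x\<^sup>2 \<le> (s k j + 1)\<^sup>2" using x by (intro power_mono) auto
    also have "\<dots> \<le> 2 + 2 * (s k j)\<^sup>2"
      using zero_le_power2[of "s k j - 1"] by (simp add: power2_eq_square algebra_simps)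
    finally have *: "x\<^sup>2 \<le> 2 + 2 * (s k j)\<^sup>2" .
    have "a \<le> 2 + 2 * b \<Longrightarrow> 0 \<le> b \<Longrightarrow> 1 + a \<le> 3 * (1 + b)" for a b :: real by (simp add: distrib_left)
    from this[OF *] have "1 + x\<^sup>2 \<le> 3 * (1 + (s k j)\<^sup>2)" by simp
    then have "C / (1 + (s k j)\<^sup>2) \<le> 3 * C / (1 + x\<^sup>2)"
      using C(1) mult_left_mono[of "1 + x\<^sup>2" "3 * (1 + (s k j)\<^sup>2)" C]
      by (simp add: field_simps add_pos_nonneg)
    then show "\<bar>f (s k j)\<bar> \<le> 3 * C / (1 + x\<^sup>2)" using C(2)[OF s(3), of k j] by linarith
  qed
  have lim: "(\<lambda>k. F k x) \<longlonglongrightarrow> f x" if x: "0 \<le> x" for x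
  proof (cases "x = 0")
    case True
    then show ?thesis unfolding F_def by (simp add: step_fun_0 s)
  next
    case False
    then have x0: "0 < x" using x by simp
    show ?thesis
    proof (rule tendstoI)
      fix e :: real assume "0 < e"
      then obtain \<delta> where \<delta>: "0 < \<delta>" "\<And>y. 0 \<le> y \<Longrightarrow> dist y x < \<delta> \<Longrightarrow> dist (f y) (f x) < e"
        using schwartz_halfline_continuous[OF f] x unfolding continuous_on_iff by (metis atLeast_iff)
      have "eventually (\<lambda>k. 1 / real (Suc k) < \<delta>) sequentially" "eventually (\<lambda>k. x < real (Suc k)) sequentially"
        using \<delta>(1) by real_asymp+
      then show "eventually (\<lambda>k. dist (F k x) (f x) < e) sequentially"
      proof eventually_elim
        case (elim k)
        have "x \<le> s k ((Suc k)\<^sup>2)" using elim(2) unfolding sN by simp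
        from step_funE[OF s(1,2) x0 this, of "\<lambda>j. f (s k j)"]
        obtain j where j: "s k j < x" "x \<le> s k (Suc j)" "F k x = f (s k j)" unfolding F_def by metis
        have "dist (s k j) x < \<delta>" using j(1,2) elim(1) unfolding s_Suc dist_real_def by linarith
        then show ?case unfolding j(3) using \<delta>(2) s(3) by blast
      qed
    qed
  qed
  have Fr: "schwartz_limit (F k) (v k)" for k unfolding F_def v_def by (rule schwartz_limit_step[OF s(3)])
  obtain h where h: "v \<longlonglongrightarrow> h" "\<And>\<phi>. \<phi> \<in> schwartz_halfline \<Longrightarrow> inner h (\<iota> \<phi>) = inner_theta H f \<phi>"
    using dominated_schwartz_limits_converge[OF Fr tame_inverse_square dom lim] by blast
  have "h = \<iota> f"
    by (rule schwartz_dense_eqI) (use h(2) \<iota>_isometry[OF f] in simp)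
  moreover have "v k \<in> span (ind_vec ` {0..})" for k
    unfolding v_def step_vec_def
    by (intro span_sum span_scale span_diff) (auto intro!: span_base imageI simp: s)
  ultimately show thesis using h(1) that by blast
qed

text \<open>Gaussianity is assumed for finite linear combinations of the variables
  \<open>B s\<close> only. Statements about \<open>W h\<close> are proved on this span and extended
  by density.\<close>

lemma dense_span_ind_vec:
  obtains v where "\<And>k. v k \<in> span (ind_vec ` {0..})" "v \<longlonglongrightarrow> h"
proof -
  have "\<iota> ` schwartz_halfline \<subseteq> closure (span (ind_vec ` {0..}))"
  proof
    fix h assume "h \<in> \<iota> ` schwartz_halfline"
    then obtain f where f: "f \<in> schwartz_halfline" "h = \<iota> f" by auto
    obtain v where "\<And>k. v k \<in> span (ind_vec ` {0..})" "v \<longlonglongrightarrow> h"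
      using schwartz_in_closure_span[OF f(1)] f(2) by metis
    then show "h \<in> closure (span (ind_vec ` {0..}))" unfolding closure_sequential by (intro exI[of _ v]) simp
  qed
  then have "closure (\<iota> ` schwartz_halfline) \<subseteq> closure (span (ind_vec ` {0..}))"
    by (simp add: closure_minimal)
  then have "h \<in> closure (span (ind_vec ` {0..}))" using \<iota>_dense by auto
  then show thesis using that unfolding closure_sequential by auto
qed

section \<open>Riemann sums of continuous functions in the completion\<close>

definition grid :: "real \<Rightarrow> nat \<Rightarrow> nat \<Rightarrow> real" where
  "grid t k j = t * real j / real (Suc k)"

lemma grid:
  assumes "0 \<le> t"
  shows "mono (grid t k)" "grid t k 0 = 0" "0 \<le> grid t k j" "grid t k (Suc k) = t"
    "grid t k (Suc j) = grid t k j + t / real (Suc k)" "j \<le> Suc k \<Longrightarrow> grid t k j \<le> t"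
proof -
  show "grid t k (Suc k) = t" by (simp add: grid_def del: of_nat_Suc)
  show m: "mono (grid t k)" using assms
    by (auto simp: grid_def mono_def intro!: divide_right_mono mult_left_mono)
  show "grid t k j \<le> t" if "j \<le> Suc k" using monoD[OF m that] \<open>grid t k (Suc k) = t\<close> by simp
qed (use assms in \<open>auto simp: grid_def add_divide_distrib distrib_left\<close>)

text \<open>Sampling at left end points: the maximum of \<open>\<bar>f\<bar>\<close> on
  \<open>[0, t]\<close> gives the majorant and continuity gives pointwise convergence. Nothing
  random is involved, so the lemma applies to each path separately.\<close>

lemma riemann_sums_converge:
  assumes t: "0 \<le> t" and f: "continuous_on {0..t} f"
  obtains h where "(\<lambda>k. step_vec (grid t k) (\<lambda>j. f (grid t k j)) (Suc k)) \<longlonglongrightarrow> h"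
    "represents (\<lambda>s. indicator {0..t} s * f s) h"
proof -
  define F where "F k = step_fun (grid t k) (\<lambda>j. f (grid t k j)) (Suc k)" for k
  define v where "v k = step_vec (grid t k) (\<lambda>j. f (grid t k j)) (Suc k)" for k
  note g = grid[OF t]
  have "compact (f ` {0..t})" by (intro compact_continuous_image f) simp
  then have "bounded (f ` {0..t})" by (rule compact_imp_bounded)
  then obtain C where C: "0 < C" "\<And>x. x \<in> {0..t} \<Longrightarrow> \<bar>f x\<bar> \<le> C"
    unfolding bounded_pos by auto
  have dom: "\<bar>F k x\<bar> \<le> C * indicator {0..t} x" if x: "0 \<le> x" for k x
    unfolding F_def
  proof (rule step_fun_bounded_by[OF g(1,2) x])
    show "0 \<le> C * indicator {0..t} x" using C(1) by simp
    show "\<bar>f (grid t k 0)\<bar> \<le> C * indicator {0..t} x" if "x = 0" using C(2)[of 0] t that by (simp add: g)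
    fix j assume j: "j < Suc k" "grid t k j < x" "x \<le> grid t k (Suc j)"
    then have "x \<le> t" using g(6)[of "Suc j" k] by linarith
    then show "\<bar>f (grid t k j)\<bar> \<le> C * indicator {0..t} x"
      using C(2)[of "grid t k j"] g(3)[of k j] g(6)[of j k] j x by simp
  qed
  have lim: "(\<lambda>k. F k x) \<longlonglongrightarrow> indicator {0..t} x * f x" if x: "0 \<le> x" for x
  proof (cases "x = 0")
    case True
    then show ?thesis unfolding F_def using t by (simp add: step_fun_0 g)
  next
    case False
    then have x0: "0 < x" using x by simp
    show ?thesis
    proof (cases "x \<le> t")
      case True
      show ?thesis
      proof (rule tendstoI)
        fix e :: real assume "0 < e"
        then obtain \<delta> where \<delta>: "0 < \<delta>" "\<And>y. y \<in> {0..t} \<Longrightarrow> dist y x < \<delta> \<Longrightarrow> dist (f y) (f x) < e"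
          using f True x unfolding continuous_on_iff by (metis atLeastAtMost_iff)
        have "eventually (\<lambda>k. t / real (Suc k) < \<delta>) sequentially"
          using \<delta>(1) by real_asymp
        then show "eventually (\<lambda>k. dist (F k x) (indicator {0..t} x * f x) < e) sequentially"
        proof eventually_elim
          case (elim k)
          have "x \<le> grid t k (Suc k)" using True unfolding g(4) by simp
          from step_funE[OF g(1,2) x0 this, of "\<lambda>j. f (grid t k j)"]
          obtain j where j: "j < Suc k" "grid t k j < x" "x \<le> grid t k (Suc j)" "F k x = f (grid t k j)"
            unfolding F_def by metis
          have "dist (grid t k j) x < \<delta>" using j(2,3) elim unfolding g(5) dist_real_def by linarith
          moreover have "grid t k j \<in> {0..t}" using g(3) g(6) j(1) by simp
          ultimately show ?case unfolding j(4) using \<delta>(2) True x by simp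
        qed
      qed
    next
      case False
      have "F k x = 0" for k
      proof -
        have "\<not> x \<le> grid t k (Suc j)" if "j < Suc k" for j using g(6)[of "Suc j" k] that False by simp
        then show ?thesis
          using step_fun_cases[OF g(1)[of k] g(2)[of k] x0, of "Suc k" "\<lambda>j. f (grid t k j)"]
          unfolding F_def by fast
      qed
      then show ?thesis using False by simp
    qed
  qed
  have Fr: "schwartz_limit (F k) (v k)" for k unfolding F_def v_def by (rule schwartz_limit_step[OF g(3)])
  have d: "tame (\<lambda>x. C * indicator {0..t} x)" by (intro tame_cmult tame_indicator_Icc)
  obtain h where h: "v \<longlonglongrightarrow> h"
      "\<And>\<phi>. \<phi> \<in> schwartz_halfline \<Longrightarrow> inner h (\<iota> \<phi>) = inner_theta H (\<lambda>s. indicator {0..t} s * f s) \<phi>"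
    using dominated_schwartz_limits_converge[OF Fr d dom lim] by blast
  have "tame (\<lambda>s. indicator {0..t} s * f s)"
    by (rule tame_limit(1)[OF d schwartz_limit_tame[OF Fr] dom lim])
  then show thesis using that[of h] h representsI unfolding v_def by blast
qed

text \<open>Increments are nonnegatively correlated because \<open>theta\<close> is nonnegative.
  This permits replacing the coefficients of a step vector by upper bounds when its second moment is
  estimated.\<close>

lemma inner_increments_nonneg:
  assumes "0 \<le> a" "a \<le> b" "0 \<le> c" "c \<le> d"
  shows "0 \<le> inner (ind_vec b - ind_vec a) (ind_vec d - ind_vec c)"
proof -
  have "inner (ind_vec b - ind_vec a) (ind_vec d - ind_vec c)
    = inner_theta H (\<lambda>x. indicator {0..b} x - indicator {0..a} x) (\<lambda>x. indicator {0..d} x - indicator {0..c} x)"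
    using assms by (intro schwartz_limit_inner schwartz_limit_diff ind_vec) auto
  also have "\<dots> \<ge> 0"
    using assms by (intro inner_theta_nonneg tame_diff tame_indicator_Icc) (auto simp: indicator_def)
  finally show ?thesis .
qed

lemma step_vec_const: "s 0 = 0 \<Longrightarrow> step_vec s (\<lambda>_. 1) N = ind_vec (s N)"
  using sum_lessThan_telescope[of "\<lambda>j. ind_vec (s j)" N] by (simp add: step_vec_def ind_vec_0)

lemma norm_step_vec_sq:
  "(norm (step_vec s c N))\<^sup>2 = (\<Sum>i<N. \<Sum>j<N. c i * c j * inner (ind_vec (s (Suc i)) - ind_vec (s i)) (ind_vec (s (Suc j)) - ind_vec (s j)))"
  unfolding power2_norm_eq_inner step_vec_def
  by (subst sum.swap) (simp add: inner_sum_left inner_sum_right sum_distrib_left mult_ac)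

end

section \<open>Taylor expansion of the chaos coefficients\<close>

text \<open>The expectation of \<open>F\<close> times the \<open>n\<close>-th chaos of \<open>B s\<close>, for \<open>F\<close> cylindrical with function \<open>\<phi>\<close>,
  is \<open>chaos_poly E m n \<phi> v\<close>, where \<open>E \<psi>\<close> is the expectation of the cylindrical variable with function
  \<open>\<psi>\<close> and \<open>v i = inner (g i) (ind_vec s)\<close>.\<close>

fun chaos_poly :: "(((nat \<Rightarrow> real) \<Rightarrow> real) \<Rightarrow> real) \<Rightarrow> nat \<Rightarrow> nat \<Rightarrow> ((nat \<Rightarrow> real) \<Rightarrow> real) \<Rightarrow> (nat \<Rightarrow> real) \<Rightarrow> real" where
  "chaos_poly E m 0 \<phi> v = E \<phi>"
| "chaos_poly E m (Suc n) \<phi> v = (\<Sum>i<m. v i * chaos_poly E m n (partial i \<phi>) v) / real (Suc n)"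

lemma chaos_poly_bounded:
  "\<exists>C\<ge>0. \<forall>v. (\<forall>i<m. \<bar>v i\<bar> \<le> R) \<longrightarrow> \<bar>chaos_poly E m n \<phi> v\<bar> \<le> C"
proof (induction n arbitrary: \<phi>)
  case 0
  show ?case by (rule exI[of _ "\<bar>E \<phi>\<bar>"]) simp
next
  case (Suc n)
  from Suc[of "partial _ \<phi>"] obtain C where C: "\<And>i. 0 \<le> C i"
    "\<And>i v. (\<forall>i<m. \<bar>v i\<bar> \<le> R) \<Longrightarrow> \<bar>chaos_poly E m n (partial i \<phi>) v\<bar> \<le> C i" by metis
  show ?case
  proof (intro exI[of _ "\<Sum>i<m. \<bar>R\<bar> * C i"] conjI allI impI)
    fix v :: "nat \<Rightarrow> real" assume v: "\<forall>i<m. \<bar>v i\<bar> \<le> R"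
    have "\<bar>chaos_poly E m (Suc n) \<phi> v\<bar> \<le> \<bar>\<Sum>i<m. v i * chaos_poly E m n (partial i \<phi>) v\<bar> / 1"
      unfolding chaos_poly.simps abs_divide by (intro divide_left_mono) auto
    also have "\<dots> \<le> (\<Sum>i<m. \<bar>v i * chaos_poly E m n (partial i \<phi>) v\<bar>)" by (simp add: sum_abs)
    also have "\<dots> \<le> (\<Sum>i<m. \<bar>R\<bar> * C i)"
      unfolding abs_mult using v C by (intro sum_mono mult_mono) (auto intro: order_trans)
    finally show "\<bar>chaos_poly E m (Suc n) \<phi> v\<bar> \<le> (\<Sum>i<m. \<bar>R\<bar> * C i)" .
  qed (use C in \<open>auto intro!: sum_nonneg\<close>)
qed

text \<open>Unfolded, \<open>chaos_poly\<close> of order \<open>n\<close> is a homogeneous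
  polynomial of degree \<open>n\<close> in \<open>v\<close>, divided by \<open>n!\<close>, with
  expectations of derivatives of \<open>\<phi>\<close> as coefficients; its gradient has the same
  shape one order lower. The constant is uniform on the box given by \<open>R\<close>, because the
  expansion is used at all grid points at once.\<close>

lemma chaos_poly_expansion:
  assumes "\<phi> \<in> Cb_infinity m"
  shows "\<exists>C\<ge>0. \<forall>v w. (\<forall>i<m. \<bar>v i\<bar> \<le> R) \<longrightarrow> (\<forall>i<m. \<bar>w i\<bar> \<le> R) \<longrightarrow>
    \<bar>chaos_poly E m (Suc n) \<phi> w - chaos_poly E m (Suc n) \<phi> v
      - (\<Sum>i<m. chaos_poly E m n (partial i \<phi>) v * (w i - v i))\<bar> \<le> C * (\<Sum>i<m. \<bar>w i - v i\<bar>)\<^sup>2"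
  using assms
proof (induction n arbitrary: \<phi>)
  case 0
  show ?case
    by (rule exI[of _ 0]) (simp add: sum_subtractf[symmetric] algebra_simps)
next
  case (Suc n)
  let ?A = "chaos_poly E m"
  define \<rho> where "\<rho> i v w = ?A (Suc n) (partial i \<phi>) w - ?A (Suc n) (partial i \<phi>) v
      - (\<Sum>j<m. ?A n (partial j (partial i \<phi>)) v * (w j - v j))" for i v w
  define D where "D v w = (\<Sum>i<m. \<bar>w i - v i\<bar>)" for v w :: "nat \<Rightarrow> real"
  have "\<forall>i. \<exists>C\<ge>0. i < m \<longrightarrow> (\<forall>v w. (\<forall>i<m. \<bar>v i\<bar> \<le> R) \<longrightarrow> (\<forall>i<m. \<bar>w i\<bar> \<le> R) \<longrightarrow> \<bar>\<rho> i v w\<bar> \<le> C * (D v w)\<^sup>2)"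
    using Suc.IH[OF Cb_infinity_partial[OF Suc.prems]] unfolding \<rho>_def D_def by blast
  then obtain C where C: "\<And>i. 0 \<le> C i"
    "\<And>i v w. i < m \<Longrightarrow> (\<forall>i<m. \<bar>v i\<bar> \<le> R) \<Longrightarrow> (\<forall>i<m. \<bar>w i\<bar> \<le> R) \<Longrightarrow> \<bar>\<rho> i v w\<bar> \<le> C i * (D v w)\<^sup>2"
    by metis
  have "\<forall>i j. \<exists>C\<ge>0. \<forall>v. (\<forall>i<m. \<bar>v i\<bar> \<le> R) \<longrightarrow> \<bar>?A n (partial j (partial i \<phi>)) v\<bar> \<le> C"
    using chaos_poly_bounded by blast
  then obtain K where K: "\<And>i j. 0 \<le> K i j"
    "\<And>i j v. (\<forall>i<m. \<bar>v i\<bar> \<le> R) \<Longrightarrow> \<bar>?A n (partial j (partial i \<phi>)) v\<bar> \<le> K i j" by metis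
  \<comment> \<open>\<open>\<bar>R\<bar> + 2 * \<bar>R\<bar>\<close> bounds
    \<open>\<bar>v i\<bar> + \<bar>w i - v i\<bar>\<close>, the factors in front of the inductive
    remainder; the \<open>K\<close> terms come from products of two increments.\<close>
  define c where "c = (\<Sum>i<m. 3 * \<bar>R\<bar> * C i) + (\<Sum>i<m. \<Sum>j<m. K i j)"
  show ?case
  proof (intro exI[of _ c] conjI allI impI)
    show "0 \<le> c" unfolding c_def using C(1) K(1) by (auto intro!: sum_nonneg add_nonneg_nonneg)
    fix v w :: "nat \<Rightarrow> real" assume v: "\<forall>i<m. \<bar>v i\<bar> \<le> R" and w: "\<forall>i<m. \<bar>w i\<bar> \<le> R"
    define \<delta> where "\<delta> i = w i - v i" for i
    define a where "a i = ?A (Suc n) (partial i \<phi>) v" for i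
    define b where "b i j = ?A n (partial j (partial i \<phi>)) v" for i j
    have aw: "?A (Suc n) (partial i \<phi>) w = a i + (\<Sum>j<m. b i j * \<delta> j) + \<rho> i v w" for i
      by (simp add: \<rho>_def a_def b_def \<delta>_def)
    have sym: "b i j = b j i" if "i < m" "j < m" for i j
      using Cb_infinity_partial_commute[OF Suc.prems that] by (simp add: b_def)
    have vb: "(\<Sum>i<m. v i * b j i) = real (Suc n) * a j" for j by (simp add: a_def b_def)
    \<comment> \<open>Euler's relation for homogeneous polynomials. After exchanging the order of
      differentiation these terms are \<open>n + 1\<close> copies of the linear term; with the copy
      from the product rule they cancel the divisor \<open>n + 2\<close>.\<close>
    have "(\<Sum>i<m. v i * (\<Sum>j<m. b i j * \<delta> j)) = (\<Sum>j<m. \<Sum>i<m. v i * (b i j * \<delta> j))"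
      by (simp add: sum_distrib_left) (rule sum.swap)
    also have "\<dots> = (\<Sum>j<m. \<delta> j * (\<Sum>i<m. v i * b j i))"
      unfolding sum_distrib_left by (intro sum.cong refl) (use sym in auto)
    finally have swap: "(\<Sum>i<m. v i * (\<Sum>j<m. b i j * \<delta> j)) = real (Suc n) * (\<Sum>j<m. \<delta> j * a j)"
      unfolding vb by (simp add: sum_distrib_left mult_ac)
    have "real (Suc (Suc n)) * ?A (Suc (Suc n)) \<phi> w = (\<Sum>i<m. w i * ?A (Suc n) (partial i \<phi>) w)" by (simp del: chaos_poly.simps(2) add: chaos_poly.simps(2)[of E m "Suc n" \<phi>])
    also have "\<dots> = (\<Sum>i<m. v i * a i + (\<delta> i * a i + (v i * (\<Sum>j<m. b i j * \<delta> j) + (v i * \<rho> i v w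
        + \<delta> i * ((\<Sum>j<m. b i j * \<delta> j) + \<rho> i v w)))))"
      unfolding aw by (intro sum.cong refl) (simp add: \<delta>_def algebra_simps)
    also have "\<dots> = (\<Sum>i<m. v i * a i) + ((\<Sum>i<m. \<delta> i * a i) + (real (Suc n) * (\<Sum>j<m. \<delta> j * a j)
        + (\<Sum>i<m. v i * \<rho> i v w + \<delta> i * ((\<Sum>j<m. b i j * \<delta> j) + \<rho> i v w))))"
      unfolding sum.distrib swap by simp
    also have "(\<Sum>i<m. v i * a i) = real (Suc (Suc n)) * ?A (Suc (Suc n)) \<phi> v"
      by (simp add: a_def del: chaos_poly.simps(2) add: chaos_poly.simps(2)[of E m "Suc n" \<phi>])
    finally have eq: "real (Suc (Suc n)) * (?A (Suc (Suc n)) \<phi> w - ?A (Suc (Suc n)) \<phi> v - (\<Sum>i<m. a i * \<delta> i))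
        = (\<Sum>i<m. v i * \<rho> i v w + \<delta> i * ((\<Sum>j<m. b i j * \<delta> j) + \<rho> i v w))"
      by (simp add: algebra_simps del: chaos_poly.simps)
    have D0: "0 \<le> D v w" by (simp add: D_def sum_nonneg)
    have \<delta>D: "\<bar>\<delta> i\<bar> \<le> D v w" if "i < m" for i
      unfolding D_def \<delta>_def using that by (intro member_le_sum[of i "{..<m}" "\<lambda>i. \<bar>w i - v i\<bar>"]) auto
    have summand: "\<bar>v i * \<rho> i v w + \<delta> i * ((\<Sum>j<m. b i j * \<delta> j) + \<rho> i v w)\<bar>
        \<le> (3 * \<bar>R\<bar> * C i + (\<Sum>j<m. K i j)) * (D v w)\<^sup>2" if i: "i < m" for i
    proof -
      have \<rho>: "\<bar>\<rho> i v w\<bar> \<le> C i * (D v w)\<^sup>2" using C(2)[OF i v w] .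
      have vR: "\<bar>v i\<bar> \<le> \<bar>R\<bar>" "\<bar>\<delta> i\<bar> \<le> 2 * \<bar>R\<bar>" using v w i unfolding \<delta>_def by fastforce+
      have "\<bar>\<Sum>j<m. b i j * \<delta> j\<bar> \<le> (\<Sum>j<m. K i j * D v w)"
        by (rule order_trans[OF sum_abs], unfold abs_mult, intro sum_mono mult_mono)
          (use K v \<delta>D in \<open>auto simp: b_def\<close>)
      then have "\<bar>\<delta> i\<bar> * \<bar>\<Sum>j<m. b i j * \<delta> j\<bar> \<le> D v w * (\<Sum>j<m. K i j * D v w)"
        by (intro mult_mono \<delta>D i) (use D0 in auto)
      also have "\<dots> = (\<Sum>j<m. K i j) * (D v w)\<^sup>2"
        by (simp add: sum_distrib_right[symmetric] power2_eq_square)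
      finally have 1: "\<bar>\<delta> i\<bar> * \<bar>\<Sum>j<m. b i j * \<delta> j\<bar> \<le> (\<Sum>j<m. K i j) * (D v w)\<^sup>2" .
      have 2: "\<bar>v i\<bar> * \<bar>\<rho> i v w\<bar> \<le> \<bar>R\<bar> * (C i * (D v w)\<^sup>2)"
        by (intro mult_mono \<rho> vR) auto
      have 3: "\<bar>\<delta> i\<bar> * \<bar>\<rho> i v w\<bar> \<le> 2 * \<bar>R\<bar> * (C i * (D v w)\<^sup>2)"
        by (intro mult_mono \<rho> vR) auto
      have "\<bar>v i * \<rho> i v w + \<delta> i * ((\<Sum>j<m. b i j * \<delta> j) + \<rho> i v w)\<bar>
          \<le> \<bar>v i\<bar> * \<bar>\<rho> i v w\<bar> + (\<bar>\<delta> i\<bar> * \<bar>\<Sum>j<m. b i j * \<delta> j\<bar> + \<bar>\<delta> i\<bar> * \<bar>\<rho> i v w\<bar>)"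
        unfolding abs_mult[symmetric] distrib_left by (intro order_trans[OF abs_triangle_ineq] add_left_mono abs_triangle_ineq)
      also have "\<dots> \<le> (3 * \<bar>R\<bar> * C i + (\<Sum>j<m. K i j)) * (D v w)\<^sup>2"
        using 1 2 3 by (simp add: distrib_right)
      finally show ?thesis .
    qed
    have "\<bar>?A (Suc (Suc n)) \<phi> w - ?A (Suc (Suc n)) \<phi> v - (\<Sum>i<m. a i * \<delta> i)\<bar>
        \<le> real (Suc (Suc n)) * \<bar>?A (Suc (Suc n)) \<phi> w - ?A (Suc (Suc n)) \<phi> v - (\<Sum>i<m. a i * \<delta> i)\<bar>"
    proof -
      have "\<bar>x\<bar> \<le> real (Suc (Suc n)) * \<bar>x\<bar>" for x :: real
        using mult_right_mono[of 1 "real (Suc (Suc n))" "\<bar>x\<bar>"] by simp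
      then show ?thesis .
    qed
    also have "\<dots> = \<bar>\<Sum>i<m. v i * \<rho> i v w + \<delta> i * ((\<Sum>j<m. b i j * \<delta> j) + \<rho> i v w)\<bar>"
      unfolding eq[symmetric] abs_mult by simp
    also have "\<dots> \<le> (\<Sum>i<m. (3 * \<bar>R\<bar> * C i + (\<Sum>j<m. K i j)) * (D v w)\<^sup>2)"
      by (intro order_trans[OF sum_abs] sum_mono summand) auto
    also have "\<dots> = c * (D v w)\<^sup>2"
      unfolding c_def by (simp add: sum_distrib_right[symmetric] sum.distrib)
    finally show "\<bar>?A (Suc (Suc n)) \<phi> w - ?A (Suc (Suc n)) \<phi> v
      - (\<Sum>i<m. ?A (Suc n) (partial i \<phi>) v * (w i - v i))\<bar> \<le> c * (\<Sum>i<m. \<bar>w i - v i\<bar>)\<^sup>2"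
      unfolding a_def \<delta>_def D_def .
  qed
qed

section \<open>Hermite polynomials against the Gaussian density\<close>

lemma integrable_poly_std_normal: "integrable lborel (\<lambda>x. std_normal_density x * poly p x)"
  unfolding poly_altdef sum_distrib_left
  by (intro Bochner_Integration.integrable_sum)
    (use integrable_mult_left[OF integrable_std_normal_moment] in \<open>auto simp: mult_ac\<close>)

lemma poly_std_normal_tendsto_0:
  "((\<lambda>x. std_normal_density x * poly p x) \<longlongrightarrow> 0) at_top" "((\<lambda>x. std_normal_density x * poly p x) \<longlongrightarrow> 0) at_bot"
proof -
  have "((\<lambda>x. std_normal_density x * x ^ k) \<longlongrightarrow> 0) at_top" "((\<lambda>x. std_normal_density x * x ^ k) \<longlongrightarrow> 0) at_bot" for k
    unfolding normal_density_def by real_asymp+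
  then have "((\<lambda>x. coeff p i * (std_normal_density x * x ^ i)) \<longlongrightarrow> 0) at_top"
    "((\<lambda>x. coeff p i * (std_normal_density x * x ^ i)) \<longlongrightarrow> 0) at_bot" for i
    by (auto intro: tendsto_mult_right_zero)
  then have "((\<lambda>x. \<Sum>i\<le>degree p. coeff p i * (std_normal_density x * x ^ i)) \<longlongrightarrow> 0) at_top"
    "((\<lambda>x. \<Sum>i\<le>degree p. coeff p i * (std_normal_density x * x ^ i)) \<longlongrightarrow> 0) at_bot"
    by (auto intro: tendsto_null_sum)
  then show "((\<lambda>x. std_normal_density x * poly p x) \<longlongrightarrow> 0) at_top" "((\<lambda>x. std_normal_density x * poly p x) \<longlongrightarrow> 0) at_bot"
    by (simp_all add: poly_altdef sum_distrib_left mult_ac)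
qed

text \<open>By \<open>herm_deriv_rec\<close> the difference of the two integrands is the derivative
  of \<open>\<psi> * herm n\<close> times the density, which vanishes at both infinities.\<close>

lemma hermite_integration_by_parts:
  assumes b: "\<And>z. \<bar>\<psi> z\<bar> \<le> C" and b': "\<And>z. \<bar>\<psi>' z\<bar> \<le> C'"
    and D: "\<And>z. (\<psi> has_real_derivative \<psi>' z) (at z)" and cont: "continuous_on UNIV \<psi>'"
  shows "real (Suc n) * (\<integral>z. \<psi> z * poly (herm (Suc n)) z * std_normal_density z \<partial>lborel)
    = (\<integral>z. \<psi>' z * poly (herm n) z * std_normal_density z \<partial>lborel)"
proof -
  let ?g = std_normal_density
  have c\<psi>: "continuous_on UNIV \<psi>"
    by (rule DERIV_continuous_on[of _ _ \<psi>']) (use D in simp)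
  have [measurable]: "\<psi> \<in> borel_measurable borel" "\<psi>' \<in> borel_measurable borel"
    using c\<psi> cont by (auto intro: borel_measurable_continuous_onI)
  have pm[measurable]: "poly p \<in> borel_measurable borel" for p :: "real poly"
    by (intro borel_measurable_continuous_onI continuous_intros)
  have int: "integrable lborel (\<lambda>z. f z * poly p z * ?g z)"
    if [measurable]: "f \<in> borel_measurable borel" and f: "\<And>z. \<bar>f z\<bar> \<le> K" for f K p
  proof (rule Bochner_Integration.integrable_bound[OF integrable_mult_right[OF integrable_poly_std_normal[of p], of K]])
    show "AE z in lborel. norm (f z * poly p z * ?g z) \<le> norm (K * (?g z * poly p z))"
    proof (rule AE_I2)
      fix z
      have "\<bar>f z\<bar> * \<bar>?g z * poly p z\<bar> \<le> \<bar>K\<bar> * \<bar>?g z * poly p z\<bar>"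
        using f[of z] by (intro mult_right_mono) auto
      then show "norm (f z * poly p z * ?g z) \<le> norm (K * (?g z * poly p z))"
        by (simp add: abs_mult mult_ac)
    qed
  qed simp
  let ?F = "\<lambda>z. \<psi> z * poly (herm n) z * ?g z"
  let ?f = "\<lambda>z. \<psi>' z * poly (herm n) z * ?g z - real (Suc n) * (\<psi> z * poly (herm (Suc n)) z * ?g z)"
  have dg: "(?g has_real_derivative - z * ?g z) (at z)" for z
    unfolding normal_density_def
    by (rule derivative_eq_intros refl | simp)+
  have dF: "(?F has_real_derivative ?f z) (at z)" for z
    by (rule derivative_eq_intros D dg poly_DERIV refl | simp add: herm_deriv_rec del: herm.simps)+
      (simp add: algebra_simps del: herm.simps)
  have if1: "integrable lborel (\<lambda>z. \<psi>' z * poly (herm n) z * ?g z)" by (rule int[OF _ b']) simp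
  have if2: "integrable lborel (\<lambda>z. real (Suc n) * (\<psi> z * poly (herm (Suc n)) z * ?g z))"
    by (intro integrable_mult_right int[OF _ b]) simp
  have iF: "integrable lborel ?f" using if1 if2 by (rule Bochner_Integration.integrable_diff)
  have lim: "(?F \<longlongrightarrow> 0) F" if "((\<lambda>x. ?g x * poly (herm n) x) \<longlongrightarrow> 0) F" for F
  proof (rule Lim_null_comparison)
    show "eventually (\<lambda>z. norm (?F z) \<le> \<bar>C\<bar> * \<bar>?g z * poly (herm n) z\<bar>) F"
    proof (intro always_eventually allI)
      fix z
      have "\<bar>\<psi> z\<bar> * \<bar>?g z * poly (herm n) z\<bar> \<le> \<bar>C\<bar> * \<bar>?g z * poly (herm n) z\<bar>"
        using b[of z] by (intro mult_right_mono) auto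
      then show "norm (?F z) \<le> \<bar>C\<bar> * \<bar>?g z * poly (herm n) z\<bar>" by (simp add: abs_mult mult_ac)
    qed
    show "((\<lambda>z. \<bar>C\<bar> * \<bar>?g z * poly (herm n) z\<bar>) \<longlongrightarrow> 0) F"
      by (intro tendsto_mult_right_zero tendsto_rabs_zero that)
  qed
  have "(LBINT z=-\<infinity>..\<infinity>. ?f z) = 0 - 0"
  proof (rule interval_integral_FTC_integrable)
    show "(?F has_vector_derivative ?f z) (at z)" for z
      using dF by (simp add: has_real_derivative_iff_has_vector_derivative)
    have "continuous_on UNIV ?f" unfolding normal_density_def by (intro continuous_intros c\<psi> cont) auto
    then show "isCont ?f z" for z by (simp add: continuous_on_eq_continuous_at)
    show "set_integrable lborel (einterval (- \<infinity>) \<infinity>) ?f" using iF by (simp add: set_integrable_def)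
    show "((?F \<circ> real_of_ereal) \<longlongrightarrow> 0) (at_right (- \<infinity>))"
      unfolding ereal_tendsto_simps1 by (rule lim[OF poly_std_normal_tendsto_0(2)])
    show "((?F \<circ> real_of_ereal) \<longlongrightarrow> 0) (at_left \<infinity>)"
      unfolding ereal_tendsto_simps1 by (rule lim[OF poly_std_normal_tendsto_0(1)])
  qed simp
  then have "(\<integral>z. ?f z \<partial>lborel) = 0"
    by (simp add: interval_lebesgue_integral_def set_lebesgue_integral_def)
  then show ?thesis
    unfolding Bochner_Integration.integral_diff[OF if1 if2] by simp
qed

section \<open>Gaussian random variables\<close>

text \<open>Rectangles generate the finite product and are stable under intersection, so agreement
  on them suffices. \<open>Z\<close> occupies the last index \<open>m\<close>, and the second sample
  point supplies an independent copy of it.\<close>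

lemma (in prob_space) vector_law_product:
  fixes Y :: "nat \<Rightarrow> 'a \<Rightarrow> real" and Z :: "'a \<Rightarrow> real"
  assumes Y[measurable]: "\<And>i. i < m \<Longrightarrow> Y i \<in> borel_measurable M" and Z[measurable]: "Z \<in> borel_measurable M"
    and rect: "\<And>A C. (\<And>i. i < m \<Longrightarrow> A i \<in> sets borel) \<Longrightarrow> C \<in> sets borel \<Longrightarrow>
      expectation (\<lambda>\<omega>. (\<Prod>i<m. indicator (A i) (Y i \<omega>)) * indicator C (Z \<omega>))
        = expectation (\<lambda>\<omega>. \<Prod>i<m. indicator (A i) (Y i \<omega>)) * prob (Z -` C \<inter> space M)"
  defines "V \<equiv> \<lambda>\<omega> \<omega>'. \<lambda>i\<in>{..m}. if i < m then Y i \<omega> else Z \<omega>'"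
  shows "distr M (PiM {..m} (\<lambda>_. borel)) (\<lambda>\<omega>. V \<omega> \<omega>)
    = distr (M \<Otimes>\<^sub>M M) (PiM {..m} (\<lambda>_. borel)) (\<lambda>(\<omega>, \<omega>'). V \<omega> \<omega>')"
proof -
  interpret P: pair_prob_space M M ..
  have V1[measurable]: "(\<lambda>\<omega>. V \<omega> \<omega>) \<in> measurable M (PiM {..m} (\<lambda>_. borel))"
    unfolding V_def
  proof (rule measurable_restrict)
    fix i assume "i \<in> {..m}"
    show "(\<lambda>\<omega>. if i < m then Y i \<omega> else Z \<omega>) \<in> borel_measurable M" by (cases "i < m") auto
  qed
  have V2[measurable]: "(\<lambda>(\<omega>, \<omega>'). V \<omega> \<omega>') \<in> measurable (M \<Otimes>\<^sub>M M) (PiM {..m} (\<lambda>_. borel))"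
    unfolding V_def case_prod_beta'
  proof (rule measurable_restrict)
    fix i assume "i \<in> {..m}"
    show "(\<lambda>z. if i < m then Y i (fst z) else Z (snd z)) \<in> borel_measurable (M \<Otimes>\<^sub>M M)"
      by (cases "i < m") (auto intro: measurable_compose[OF measurable_fst Y] measurable_compose[OF measurable_snd Z])
  qed
  let ?L1 = "distr M (PiM {..m} (\<lambda>_. borel)) (\<lambda>\<omega>. V \<omega> \<omega>)"
  let ?L2 = "distr (M \<Otimes>\<^sub>M M) (PiM {..m} (\<lambda>_. borel)) (\<lambda>(\<omega>, \<omega>'). V \<omega> \<omega>')"
  interpret L1: prob_space ?L1 by (rule prob_space_distr) simp
  interpret L2: prob_space ?L2 by (rule P.prob_space_distr) simp
  show ?thesis
  proof (rule measure_eqI_PiM_finite[where I = "{..m}" and M = "\<lambda>_. borel"])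
    show "sets ?L1 = sets (PiM {..m} (\<lambda>_. borel))" "sets ?L2 = sets (PiM {..m} (\<lambda>_. borel))" by auto
    fix A :: "nat \<Rightarrow> real set" assume A: "\<And>i. i \<in> {..m} \<Longrightarrow> A i \<in> sets borel"
    let ?B = "{\<omega> \<in> space M. \<forall>i\<in>{..<m}. Y i \<omega> \<in> A i}" and ?C = "Z -` A m \<inter> space M"
    have Bs: "?B \<in> sets M"
    proof (rule sets.sets_Collect_finite_All)
      fix i assume "i \<in> {..<m}"
      then have "Y i -` A i \<inter> space M \<in> sets M" using A[of i] measurable_sets[OF Y[of i], of "A i"] by simp
      moreover have "Y i -` A i \<inter> space M = {\<omega> \<in> space M. Y i \<omega> \<in> A i}" by auto
      ultimately show "{\<omega> \<in> space M. Y i \<omega> \<in> A i} \<in> sets M" by simp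
    qed simp
    have Cs: "?C \<in> sets M" using A[of m] by simp
    have i1: "(\<Prod>i<m. indicator (A i) (Y i \<omega>)) = (indicator ?B \<omega> :: real)" if "\<omega> \<in> space M" for \<omega>
    proof (cases "\<forall>i\<in>{..<m}. Y i \<omega> \<in> A i")
      case True
      then have "(\<Prod>i<m. indicator (A i) (Y i \<omega>)) = (1::real)" by (intro prod.neutral) auto
      then show ?thesis using that True by simp
    next
      case False
      then have "(\<Prod>i<m. indicator (A i) (Y i \<omega>)) = (0::real)" by (intro prod_zero) (auto simp: indicator_def)
      then show ?thesis using False by simp
    qed
    have pB: "expectation (\<lambda>\<omega>. \<Prod>i<m. indicator (A i) (Y i \<omega>) :: real) = prob ?B"
      using Bs by (subst Bochner_Integration.integral_cong[OF refl i1]) auto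
    have "expectation (\<lambda>\<omega>. (\<Prod>i<m. indicator (A i) (Y i \<omega>)) * indicator (A m) (Z \<omega>) :: real)
        = expectation (indicator (?B \<inter> ?C))"
    proof (rule Bochner_Integration.integral_cong[OF refl])
      fix \<omega> assume \<omega>: "\<omega> \<in> space M"
      show "(\<Prod>i<m. indicator (A i) (Y i \<omega>)) * indicator (A m) (Z \<omega>) = (indicator (?B \<inter> ?C) \<omega> :: real)"
        unfolding i1[OF \<omega>] using \<omega> by (simp add: indicator_def)
    qed
    also have "\<dots> = prob (?B \<inter> ?C)" using Bs Cs by simp
    finally have pBC: "prob (?B \<inter> ?C) = prob ?B * prob ?C"
      using rect[of A "A m"] A pB by simp
    have e1: "(\<lambda>\<omega>. V \<omega> \<omega>) -` Pi\<^sub>E {..m} A \<inter> space M = ?B \<inter> ?C"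
      by (auto simp: V_def PiE_iff le_less split: if_splits)
    have e2: "(\<lambda>(\<omega>, \<omega>'). V \<omega> \<omega>') -` Pi\<^sub>E {..m} A \<inter> space (M \<Otimes>\<^sub>M M) = ?B \<times> ?C"
      by (auto simp: V_def PiE_iff le_less space_pair_measure split: if_splits)
    have AP: "Pi\<^sub>E {..m} A \<in> sets (PiM {..m} (\<lambda>_. borel))" using A by (intro sets_PiM_I_finite) auto
    have "emeasure ?L1 (Pi\<^sub>E {..m} A) = emeasure M (?B \<inter> ?C)"
      using AP by (subst emeasure_distr) (auto simp: e1)
    also have "\<dots> = emeasure M ?B * emeasure M ?C"
      using pBC by (simp add: emeasure_eq_measure ennreal_mult)
    also have "\<dots> = emeasure (M \<Otimes>\<^sub>M M) (?B \<times> ?C)" using Bs Cs by (simp add: emeasure_pair_measure_Times)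
    also have "\<dots> = emeasure ?L2 (Pi\<^sub>E {..m} A)"
      using AP by (subst emeasure_distr) (auto simp: e2)
    finally show "emeasure ?L1 (Pi\<^sub>E {..m} A) = emeasure ?L2 (Pi\<^sub>E {..m} A)" .
  next
    show "range (\<lambda>_::nat. Pi\<^sub>E {..m} (\<lambda>_. UNIV)) \<subseteq> prod_algebra {..m} (\<lambda>_. borel :: real measure)"
      using prod_algebraI_finite[of "{..m}" "\<lambda>_. UNIV" "\<lambda>_. borel :: real measure"] by auto
    show "(\<Union>i::nat. Pi\<^sub>E {..m} (\<lambda>_. UNIV)) = space (PiM {..m} (\<lambda>_. borel :: real measure))"
      by (simp add: space_PiM)
    show "emeasure ?L1 (Pi\<^sub>E {..m} (\<lambda>_. UNIV)) \<noteq> \<infinity>"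
      by simp
  qed auto
qed

text \<open>Fubini for independent blocks: the inner expectation freezes \<open>Y\<close>, so that a
  one-dimensional integration by parts in \<open>Z\<close> becomes applicable.\<close>

lemma (in prob_space) expectation_independent:
  fixes Y :: "nat \<Rightarrow> 'a \<Rightarrow> real" and Z :: "'a \<Rightarrow> real" and F :: "(nat \<Rightarrow> real) \<Rightarrow> real \<Rightarrow> real"
  assumes Y[measurable]: "\<And>i. i < m \<Longrightarrow> Y i \<in> borel_measurable M" and Z[measurable]: "Z \<in> borel_measurable M"
    and rect: "\<And>A C. (\<And>i. i < m \<Longrightarrow> A i \<in> sets borel) \<Longrightarrow> C \<in> sets borel \<Longrightarrow>
      expectation (\<lambda>\<omega>. (\<Prod>i<m. indicator (A i) (Y i \<omega>)) * indicator C (Z \<omega>))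
        = expectation (\<lambda>\<omega>. \<Prod>i<m. indicator (A i) (Y i \<omega>)) * prob (Z -` C \<inter> space M)"
    and F: "(\<lambda>(x, z). F x z) \<in> borel_measurable (borel \<Otimes>\<^sub>M borel)"
    and dep: "\<And>x y z. (\<And>i. i < m \<Longrightarrow> x i = y i) \<Longrightarrow> F x z = F y z"
    and int: "integrable M (\<lambda>\<omega>. F (\<lambda>i. Y i \<omega>) (Z \<omega>))"
  shows "expectation (\<lambda>\<omega>. F (\<lambda>i. Y i \<omega>) (Z \<omega>))
    = expectation (\<lambda>\<omega>. expectation (\<lambda>\<omega>'. F (\<lambda>i. Y i \<omega>) (Z \<omega>')))"
proof -
  interpret P: pair_prob_space M M ..
  define V where "V = (\<lambda>\<omega> \<omega>'. \<lambda>i\<in>{..m}. if i < m then Y i \<omega> else Z \<omega>')"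
  \<comment> \<open>Only the first \<open>m\<close> arguments of \<open>F\<close> matter, so the
    remaining ones may be filled with \<open>0\<close>; this makes \<open>f\<close> a measurable
    function on a finite product.\<close>
  define f where "f x = F (\<lambda>i. if i < m then x i else 0) (x m)" for x :: "nat \<Rightarrow> real"
  have fV: "f (V \<omega> \<omega>') = F (\<lambda>i. Y i \<omega>) (Z \<omega>')" for \<omega> \<omega>'
    unfolding f_def V_def by (simp, rule dep) simp
  have fm[measurable]: "f \<in> borel_measurable (PiM {..m} (\<lambda>_. borel))"
  proof -
    have 1: "(\<lambda>(x::nat \<Rightarrow> real) i. if i < m then x i else 0) \<in> borel_measurable (PiM {..m} (\<lambda>_. borel))"
    proof (rule measurable_coordinatewise_then_product)
      show "(\<lambda>x::nat \<Rightarrow> real. if i < m then x i else 0) \<in> borel_measurable (PiM {..m} (\<lambda>_. borel))" for i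
        by (cases "i < m") auto
    qed
    have "(\<lambda>x::nat \<Rightarrow> real. (\<lambda>i. if i < m then x i else 0, x m)) \<in> measurable (PiM {..m} (\<lambda>_. borel)) (borel \<Otimes>\<^sub>M borel)"
      by (rule measurable_Pair[OF 1]) simp
    from measurable_compose[OF this F] show ?thesis by (simp add: f_def[abs_def])
  qed
  have V1: "(\<lambda>\<omega>. V \<omega> \<omega>) \<in> measurable M (PiM {..m} (\<lambda>_. borel))"
    unfolding V_def
  proof (rule measurable_restrict)
    fix i assume "i \<in> {..m}"
    show "(\<lambda>\<omega>. if i < m then Y i \<omega> else Z \<omega>) \<in> borel_measurable M" by (cases "i < m") auto
  qed
  have V2: "(\<lambda>(\<omega>, \<omega>'). V \<omega> \<omega>') \<in> measurable (M \<Otimes>\<^sub>M M) (PiM {..m} (\<lambda>_. borel))"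
    unfolding V_def case_prod_beta'
  proof (rule measurable_restrict)
    fix i assume "i \<in> {..m}"
    show "(\<lambda>z. if i < m then Y i (fst z) else Z (snd z)) \<in> borel_measurable (M \<Otimes>\<^sub>M M)"
      by (cases "i < m") (auto intro: measurable_compose[OF measurable_fst Y] measurable_compose[OF measurable_snd Z])
  qed
  have law: "distr M (PiM {..m} (\<lambda>_. borel)) (\<lambda>\<omega>. V \<omega> \<omega>)
    = distr (M \<Otimes>\<^sub>M M) (PiM {..m} (\<lambda>_. borel)) (\<lambda>(\<omega>, \<omega>'). V \<omega> \<omega>')"
    unfolding V_def by (rule vector_law_product[OF Y Z rect])
  have "integrable (distr M (PiM {..m} (\<lambda>_. borel)) (\<lambda>\<omega>. V \<omega> \<omega>)) f"
    using int by (subst integrable_distr_eq[OF V1 fm]) (simp add: fV)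
  then have int2: "integrable (M \<Otimes>\<^sub>M M) (\<lambda>(\<omega>, \<omega>'). F (\<lambda>i. Y i \<omega>) (Z \<omega>'))"
    unfolding law by (subst (asm) integrable_distr_eq[OF V2 fm]) (simp add: fV case_prod_beta')
  have "expectation (\<lambda>\<omega>. F (\<lambda>i. Y i \<omega>) (Z \<omega>)) = integral\<^sup>L (distr M (PiM {..m} (\<lambda>_. borel)) (\<lambda>\<omega>. V \<omega> \<omega>)) f"
    by (subst integral_distr[OF V1 fm]) (simp add: fV)
  also have "\<dots> = (\<integral>(\<omega>, \<omega>'). F (\<lambda>i. Y i \<omega>) (Z \<omega>') \<partial>(M \<Otimes>\<^sub>M M))"
    unfolding law by (subst integral_distr[OF V2 fm]) (simp add: fV case_prod_beta')
  also have "\<dots> = expectation (\<lambda>\<omega>. expectation (\<lambda>\<omega>'. F (\<lambda>i. Y i \<omega>) (Z \<omega>')))"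
    by (rule P.integral_fst[symmetric, OF int2])
  finally show ?thesis .
qed

text \<open>\<open>herm_var n x l\<close> is \<open>l\<^bsup>n/2\<^esup> He\<^sub>n(x / \<surd>l) / n!\<close>, as a polynomial in \<open>x\<close> and \<open>l\<close>.\<close>

fun herm_var :: "nat \<Rightarrow> real \<Rightarrow> real \<Rightarrow> real" where
  "herm_var 0 x l = 1"
| "herm_var (Suc 0) x l = x"
| "herm_var (Suc (Suc n)) x l = (x * herm_var (Suc n) x l - l * herm_var n x l) / real (n + 2)"

lemma herm_var_scale: "herm_var n (\<sigma> * z) (\<sigma>\<^sup>2) = \<sigma> ^ n * poly (herm n) z"
proof (induction n rule: herm.induct)
  case (3 n)
  then show ?case by (simp add: power2_eq_square field_simps)
qed simp_all

lemma herm_var_0: "herm_var (Suc n) 0 0 = 0"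
  by (cases n) auto

lemma herm_var_continuous [continuous_intros]:
  "continuous_on A f \<Longrightarrow> continuous_on A g \<Longrightarrow> continuous_on A (\<lambda>s. herm_var n (f s) (g s))"
  by (induction n rule: herm.induct) (auto intro!: continuous_intros)

lemma herm_var_measurable [measurable]:
  "f \<in> borel_measurable N \<Longrightarrow> g \<in> borel_measurable N \<Longrightarrow> (\<lambda>s. herm_var n (f s) (g s)) \<in> borel_measurable N"
  by (induction n rule: herm.induct) auto

lemma std_normal_fourier:
  "(\<integral>z. std_normal_density z * cos (u * z) \<partial>lborel) = exp (- u\<^sup>2 / 2)"
  "(\<integral>z. std_normal_density z * sin (u * z) \<partial>lborel) = 0"
proof -
  have i: "integrable lborel std_normal_density" using integrable_std_normal_moment[of 0] by simp
  have "distr (density lborel std_normal_density) borel (\<lambda>z. z) = density lborel std_normal_density"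
    by (rule distr_id2) simp
  then have "char std_normal_distribution u = Complex (\<integral>z. std_normal_density z * cos (u * z) \<partial>lborel) (\<integral>z. std_normal_density z * sin (u * z) \<partial>lborel)"
    using char_density_distr[of "\<lambda>z. z" lborel std_normal_density u] i by simp
  then show "(\<integral>z. std_normal_density z * cos (u * z) \<partial>lborel) = exp (- u\<^sup>2 / 2)"
    "(\<integral>z. std_normal_density z * sin (u * z) \<partial>lborel) = 0"
    by (simp_all add: char_std_normal_distribution complex_eq_iff)
qed

lemma integrable_mult_of_squares:
  fixes f g :: "'a \<Rightarrow> real"
  assumes [measurable]: "f \<in> borel_measurable M" "g \<in> borel_measurable M"
    and "integrable M (\<lambda>x. (f x)\<^sup>2)" "integrable M (\<lambda>x. (g x)\<^sup>2)"
  shows "integrable M (\<lambda>x. f x * g x)"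
proof (rule Bochner_Integration.integrable_bound)
  show "integrable M (\<lambda>x. (f x)\<^sup>2 + (g x)\<^sup>2)" using assms by simp
  show "AE x in M. norm (f x * g x) \<le> norm ((f x)\<^sup>2 + (g x)\<^sup>2)"
  proof (rule AE_I2)
    fix x
    have "0 \<le> (\<bar>f x\<bar> - \<bar>g x\<bar>)\<^sup>2" by simp
    then have "2 * (\<bar>f x\<bar> * \<bar>g x\<bar>) \<le> (f x)\<^sup>2 + (g x)\<^sup>2" by (simp add: power2_diff)
    moreover have "0 \<le> \<bar>f x\<bar> * \<bar>g x\<bar>" by simp
    ultimately have "\<bar>f x\<bar> * \<bar>g x\<bar> \<le> (f x)\<^sup>2 + (g x)\<^sup>2" by linarith
    then show "norm (f x * g x) \<le> norm ((f x)\<^sup>2 + (g x)\<^sup>2)" by (simp add: abs_mult)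
  qed
qed simp

context prob_space begin

text \<open>The free angle keeps both parts of the characteristic function in one identity. A
  degenerate variable fits the formula with second moment \<open>0\<close>.\<close>

lemma gaussian_rv_cos:
  assumes X: "gaussian_rv M X" and E: "expectation X = 0"
  shows "expectation (\<lambda>\<omega>. cos (\<theta> + X \<omega>)) = cos \<theta> * exp (- expectation (\<lambda>\<omega>. (X \<omega>)\<^sup>2) / 2)"
proof -
  have [measurable]: "X \<in> borel_measurable M" using X by (simp add: gaussian_rv_def)
  from X obtain \<mu> \<sigma> where "(\<sigma> = 0 \<and> (AE \<omega> in M. X \<omega> = \<mu>)) \<or>
      (\<sigma> > 0 \<and> distributed M lborel X (\<lambda>x. ennreal (normal_density \<mu> \<sigma> x)))"
    unfolding gaussian_rv_def by blast
  then show ?thesis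
  proof (elim disjE conjE)
    assume ae: "AE \<omega> in M. X \<omega> = \<mu>"
    have "expectation X = expectation (\<lambda>_. \<mu>)" using ae by (intro integral_cong_AE) auto
    then have "\<mu> = 0" using E by (simp add: prob_space)
    then have ae: "AE \<omega> in M. X \<omega> = 0" using ae by simp
    have "expectation (\<lambda>\<omega>. cos (\<theta> + X \<omega>)) = expectation (\<lambda>_. cos \<theta>)"
      by (intro integral_cong_AE) (use ae in \<open>auto elim!: eventually_mono\<close>)
    moreover have "expectation (\<lambda>\<omega>. (X \<omega>)\<^sup>2) = expectation (\<lambda>_. 0)"
      by (intro integral_cong_AE) (use ae in \<open>auto elim!: eventually_mono\<close>)
    ultimately show ?thesis by (simp add: prob_space)
  next
    assume \<sigma>: "0 < \<sigma>" and D: "distributed M lborel X (\<lambda>x. ennreal (normal_density \<mu> \<sigma> x))"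
    have "\<mu> = 0" using normal_distributed_expectation[OF \<sigma> D] E by simp
    then have DZ: "distributed M lborel (\<lambda>\<omega>. X \<omega> / \<sigma>) std_normal_density"
      using D normal_standard_normal_convert[OF \<sigma>, of X \<mu>] by simp
    have var: "expectation (\<lambda>\<omega>. (X \<omega>)\<^sup>2) = \<sigma>\<^sup>2"
      using normal_distributed_variance[OF \<sigma> D] E by simp
    have i: "integrable lborel std_normal_density" using integrable_std_normal_moment[of 0] by simp
    have ic: "integrable lborel (\<lambda>z. std_normal_density z * cos (\<sigma> * z))"
      "integrable lborel (\<lambda>z. std_normal_density z * sin (\<sigma> * z))"
      by (rule Bochner_Integration.integrable_bound[OF i]; auto simp: abs_mult mult_left_le)+
    have "expectation (\<lambda>\<omega>. cos (\<theta> + \<sigma> * (X \<omega> / \<sigma>))) = (\<integral>z. std_normal_density z * cos (\<theta> + \<sigma> * z) \<partial>lborel)"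
      by (rule distributed_integral[OF DZ, symmetric]) auto
    also have "\<dots> = (\<integral>z. cos \<theta> * (std_normal_density z * cos (\<sigma> * z)) - sin \<theta> * (std_normal_density z * sin (\<sigma> * z)) \<partial>lborel)"
      by (intro Bochner_Integration.integral_cong refl) (simp add: cos_add algebra_simps)
    also have "\<dots> = cos \<theta> * exp (- \<sigma>\<^sup>2 / 2)"
      using ic by (subst Bochner_Integration.integral_diff) (auto simp: std_normal_fourier)
    finally show ?thesis using \<sigma> var by simp
  qed
qed

lemma expectation_abs_le_sqrt:
  assumes [measurable]: "X \<in> borel_measurable M" and i: "integrable M (\<lambda>\<omega>. (X \<omega>)\<^sup>2)"
  shows "expectation (\<lambda>\<omega>. \<bar>X \<omega>\<bar>) \<le> sqrt (expectation (\<lambda>\<omega>. (X \<omega>)\<^sup>2))"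
proof -
  have X: "integrable M X" using square_integrable_imp_integrable[OF assms] .
  have "0 \<le> variance (\<lambda>\<omega>. \<bar>X \<omega>\<bar>)" by (rule variance_positive)
  also have "\<dots> = expectation (\<lambda>\<omega>. (X \<omega>)\<^sup>2) - (expectation (\<lambda>\<omega>. \<bar>X \<omega>\<bar>))\<^sup>2"
    using X i by (subst variance_eq) auto
  finally show ?thesis by (intro real_le_rsqrt) simp
qed

end

locale regular_fbm = fbm_wiener_integral M H B \<iota> W
  for M :: "'a measure" and H :: real and B :: "real \<Rightarrow> 'a \<Rightarrow> real"
    and \<iota> :: "(real \<Rightarrow> real) \<Rightarrow> 'h::{real_inner, complete_space}"
    and W :: "'h \<Rightarrow> 'a \<Rightarrow> real" +
  assumes H_gt_half: "1 / 2 < H"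

sublocale regular_fbm \<subseteq> regular_hurst_completion H \<iota>
  using H_gt_half Hurst by unfold_locales

context regular_fbm begin

lemma W_measurable [measurable]: "W h \<in> borel_measurable M"
  and W_sq_integrable: "integrable M (\<lambda>\<omega>. (W h \<omega>)\<^sup>2)"
  using W_square_integrable[of h] by (auto simp: square_integrable_def)

lemma W_integrable: "integrable M (W h)"
  using square_integrable_imp_integrable[OF W_measurable W_sq_integrable] .

lemma W_mult_integrable: "integrable M (\<lambda>\<omega>. W h \<omega> * W k \<omega>)"
  by (rule integrable_mult_of_squares) (auto intro: W_sq_integrable)

lemma W_inner: "expectation (\<lambda>\<omega>. W h \<omega> * W k \<omega>) = inner h k"
proof -
  have "(norm (h + k))\<^sup>2 = expectation (\<lambda>\<omega>. (W (1 *\<^sub>R h + 1 *\<^sub>R k) \<omega>)\<^sup>2)" by (simp add: W_isometry)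
  also have "\<dots> = expectation (\<lambda>\<omega>. (W h \<omega> + W k \<omega>)\<^sup>2)"
    using W_linear[of 1 h 1 k] by (intro integral_cong_AE) (auto elim!: eventually_mono)
  also have "\<dots> = expectation (\<lambda>\<omega>. (W h \<omega>)\<^sup>2 + (W k \<omega>)\<^sup>2 + 2 * (W h \<omega> * W k \<omega>))"
    by (simp add: power2_sum mult.assoc)
  also have "\<dots> = (norm h)\<^sup>2 + (norm k)\<^sup>2 + 2 * expectation (\<lambda>\<omega>. W h \<omega> * W k \<omega>)"
    by (simp add: W_sq_integrable W_mult_integrable W_isometry)
  finally show ?thesis by (simp add: power2_norm_eq_inner inner_add inner_commute)
qed

lemma W_ind_vec: "0 \<le> s \<Longrightarrow> AE \<omega> in M. W (ind_vec s) \<omega> = B s \<omega>"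
  by (rule W_indicator[OF _ represents_ind_vec])

lemma B_measurable: "0 \<le> s \<Longrightarrow> B s \<in> borel_measurable M"
  using gaussian[of "{s}" "\<lambda>_. 1"] by (simp add: gaussian_rv_def)

lemma B_integrable: "0 \<le> s \<Longrightarrow> integrable M (B s)"
  using W_ind_vec[of s] W_integrable[of "ind_vec s"] B_measurable[of s]
  by (subst integrable_cong_AE[of _ _ "W (ind_vec s)"]) auto

text \<open>\<open>W\<close> is an isometry that maps \<open>ind_vec s\<close> to
  \<open>B s\<close>, so the value is read off from the covariance of \<open>B\<close> and no double
  integral of \<open>theta\<close> is evaluated.\<close>

lemma inner_ind_vec:
  assumes "0 \<le> s" "0 \<le> t"
  shows "inner (ind_vec s) (ind_vec t) = (t powr (2 * H) + s powr (2 * H) - \<bar>t - s\<bar> powr (2 * H)) / 2"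
proof -
  have "expectation (\<lambda>\<omega>. W (ind_vec s) \<omega> * W (ind_vec t) \<omega>) = expectation (\<lambda>\<omega>. B s \<omega> * B t \<omega>)"
    using W_ind_vec[OF assms(1)] W_ind_vec[OF assms(2)] B_measurable[OF assms(1)] B_measurable[OF assms(2)]
    by (intro integral_cong_AE) auto
  then show ?thesis using covariance[OF assms] by (simp add: W_inner)
qed

lemma norm_ind_vec_diff:
  assumes "0 \<le> a" "0 \<le> b"
  shows "norm (ind_vec b - ind_vec a) = \<bar>b - a\<bar> powr H"
proof (rule power2_eq_imp_eq)
  have "(norm (ind_vec b - ind_vec a))\<^sup>2 = \<bar>b - a\<bar> powr (2 * H)"
    using assms by (simp add: power2_norm_eq_inner inner_diff_left inner_diff_right inner_ind_vec abs_minus_commute field_simps)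
  also have "\<dots> = (\<bar>b - a\<bar> powr H)\<^sup>2" by (simp add: power2_eq_square powr_add[symmetric])
  finally show "(norm (ind_vec b - ind_vec a))\<^sup>2 = (\<bar>b - a\<bar> powr H)\<^sup>2" .
qed auto

lemma norm_ind_vec: "0 \<le> s \<Longrightarrow> norm (ind_vec s) = s powr H"
  using norm_ind_vec_diff[of 0 s] by (simp add: ind_vec_0)

lemma W_sum:
  assumes "finite J"
  shows "AE \<omega> in M. W (\<Sum>j\<in>J. c j *\<^sub>R g j) \<omega> = (\<Sum>j\<in>J. c j * W (g j) \<omega>)"
  using assms
proof (induction J rule: finite_induct)
  case empty
  show ?case using W_linear[of 0 0 0 0] by simp
next
  case (insert j J)
  have "AE \<omega> in M. W (c j *\<^sub>R g j + 1 *\<^sub>R (\<Sum>j\<in>J. c j *\<^sub>R g j)) \<omega> = c j * W (g j) \<omega> + 1 * W (\<Sum>j\<in>J. c j *\<^sub>R g j) \<omega>"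
    by (rule W_linear)
  then show ?case using insert.IH
    by eventually_elim (use insert in simp)
qed

lemma W_cos_span:
  assumes "h \<in> span (ind_vec ` {0..})"
  shows "expectation (\<lambda>\<omega>. cos (\<theta> + W h \<omega>)) = cos \<theta> * exp (- (norm h)\<^sup>2 / 2)"
proof -
  obtain T r where T: "finite T" "T \<subseteq> ind_vec ` {0..}" "h = (\<Sum>a\<in>T. r a *\<^sub>R a)"
    using assms unfolding span_explicit by auto
  \<comment> \<open>One time is selected for each vector of the combination, so that the sum can be
    reindexed over times.\<close>
  obtain J where J: "J \<subseteq> {0..}" "inj_on ind_vec J" "T = ind_vec ` J"
    using T(2) unfolding subset_image_inj by blast
  have fJ: "finite J" using J T(1) finite_image_iff by blast
  have h: "h = (\<Sum>s\<in>J. r (ind_vec s) *\<^sub>R ind_vec s)"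
    unfolding T(3) J(3) using J(2) by (simp add: sum.reindex)
  define X where "X \<omega> = (\<Sum>s\<in>J. r (ind_vec s) * B s \<omega>)" for \<omega>
  have g: "gaussian_rv M X" unfolding X_def by (rule gaussian[OF fJ J(1)])
  have [measurable]: "X \<in> borel_measurable M" using g by (simp add: gaussian_rv_def)
  have "AE \<omega> in M. \<forall>s\<in>J. W (ind_vec s) \<omega> = B s \<omega>"
    using fJ J(1) W_ind_vec by (intro AE_finite_allI) auto
  moreover have "AE \<omega> in M. W h \<omega> = (\<Sum>s\<in>J. r (ind_vec s) * W (ind_vec s) \<omega>)"
    unfolding h by (rule W_sum[OF fJ])
  ultimately have ae: "AE \<omega> in M. W h \<omega> = X \<omega>"
    by eventually_elim (simp add: X_def)
  have "expectation X = (\<Sum>s\<in>J. r (ind_vec s) * expectation (B s))"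
    unfolding X_def using J(1) B_integrable by (subst Bochner_Integration.integral_sum) auto
  also have "\<dots> = 0" using J(1) centered by (intro sum.neutral) auto
  finally have E: "expectation X = 0" .
  have "(norm h)\<^sup>2 = expectation (\<lambda>\<omega>. (X \<omega>)\<^sup>2)"
    unfolding W_isometry[symmetric] using ae by (intro integral_cong_AE) (auto elim!: eventually_mono)
  moreover have "expectation (\<lambda>\<omega>. cos (\<theta> + W h \<omega>)) = expectation (\<lambda>\<omega>. cos (\<theta> + X \<omega>))"
    using ae by (intro integral_cong_AE) (auto elim!: eventually_mono)
  ultimately show ?thesis using gaussian_rv_cos[OF g E] by simp
qed

text \<open>Gaussianity of every \<open>W h\<close>, in the form of its characteristic function. The
  cosine is 1-Lipschitz, so approximation in the completion carries over from the span through the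
  isometry.\<close>

lemma W_cos: "expectation (\<lambda>\<omega>. cos (\<theta> + W h \<omega>)) = cos \<theta> * exp (- (norm h)\<^sup>2 / 2)"
proof -
  obtain v where v: "\<And>k. v k \<in> span (ind_vec ` {0..})" "v \<longlonglongrightarrow> h" using dense_span_ind_vec by blast
  have ic: "integrable M (\<lambda>\<omega>. cos (\<theta> + W k \<omega>))" for k
    by (rule integrable_const_bound[of _ 1]) auto
  have bound: "\<bar>expectation (\<lambda>\<omega>. cos (\<theta> + W (v k) \<omega>)) - expectation (\<lambda>\<omega>. cos (\<theta> + W h \<omega>))\<bar> \<le> norm (v k - h)" for k
  proof -
    have ae: "AE \<omega> in M. W (v k - h) \<omega> = W (v k) \<omega> - W h \<omega>"
      using W_linear[of 1 "v k" "-1" h] by simp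
    have "\<bar>expectation (\<lambda>\<omega>. cos (\<theta> + W (v k) \<omega>)) - expectation (\<lambda>\<omega>. cos (\<theta> + W h \<omega>))\<bar>
        = \<bar>expectation (\<lambda>\<omega>. cos (\<theta> + W (v k) \<omega>) - cos (\<theta> + W h \<omega>))\<bar>" using ic by simp
    also have "\<dots> \<le> expectation (\<lambda>\<omega>. \<bar>cos (\<theta> + W (v k) \<omega>) - cos (\<theta> + W h \<omega>)\<bar>)"
      by (rule integral_abs_bound)
    also have "\<dots> \<le> expectation (\<lambda>\<omega>. \<bar>W (v k - h) \<omega>\<bar>)"
    proof (rule integral_mono_AE)
      show "AE \<omega> in M. \<bar>cos (\<theta> + W (v k) \<omega>) - cos (\<theta> + W h \<omega>)\<bar> \<le> \<bar>W (v k - h) \<omega>\<bar>"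
        using ae
      proof eventually_elim
        case (elim \<omega>)
        have "\<bar>cos x - cos y\<bar> \<le> \<bar>x - y\<bar>" for x y :: real
        proof -
          have "\<bar>cos x - cos y\<bar> = 2 * (\<bar>sin ((x + y) / 2)\<bar> * \<bar>sin ((y - x) / 2)\<bar>)"
            by (simp add: cos_diff_cos abs_mult)
          also have "\<dots> \<le> 2 * (1 * \<bar>(y - x) / 2\<bar>)"
            by (intro mult_left_mono mult_mono abs_sin_x_le_abs_x abs_sin_le_one) auto
          finally show ?thesis by simp
        qed
        from this[of "\<theta> + W (v k) \<omega>" "\<theta> + W h \<omega>"] show ?case using elim by simp
      qed
    qed (intro integrable_abs Bochner_Integration.integrable_diff ic W_integrable)+
    also have "\<dots> \<le> norm (v k - h)"
      using expectation_abs_le_sqrt[OF W_measurable W_sq_integrable, of "v k - h"] by (simp add: W_isometry)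
    finally show ?thesis .
  qed
  have "(\<lambda>k. norm (v k - h)) \<longlonglongrightarrow> 0"
    by (intro tendsto_norm_zero LIM_zero v(2))
  then have "(\<lambda>k. expectation (\<lambda>\<omega>. cos (\<theta> + W (v k) \<omega>)) - expectation (\<lambda>\<omega>. cos (\<theta> + W h \<omega>))) \<longlonglongrightarrow> 0"
  proof (rule Lim_null_comparison[rotated])
    show "eventually (\<lambda>k. norm (expectation (\<lambda>\<omega>. cos (\<theta> + W (v k) \<omega>)) - expectation (\<lambda>\<omega>. cos (\<theta> + W h \<omega>)))
        \<le> norm (v k - h)) sequentially"
      unfolding real_norm_def by (rule always_eventually, rule allI, rule bound)
  qed
  then have "(\<lambda>k. expectation (\<lambda>\<omega>. cos (\<theta> + W (v k) \<omega>))) \<longlonglongrightarrow> expectation (\<lambda>\<omega>. cos (\<theta> + W h \<omega>))"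
    by (rule LIM_zero_cancel)
  moreover have "(\<lambda>k. cos \<theta> * exp (- (norm (v k))\<^sup>2 / 2)) \<longlonglongrightarrow> cos \<theta> * exp (- (norm h)\<^sup>2 / 2)"
    by (intro tendsto_intros v(2)) simp
  ultimately show ?thesis unfolding W_cos_span[OF v(1)] by (rule LIMSEQ_unique)
qed

end

section \<open>Gaussian integration by parts\<close>

context regular_fbm begin

lemma B_distributed:
  assumes s: "0 < s"
  shows "distributed M lborel (\<lambda>\<omega>. B s \<omega> / s powr H) std_normal_density"
proof -
  have [measurable]: "B s \<in> borel_measurable M" using s by (intro B_measurable) simp
  have g: "gaussian_rv M (B s)" using gaussian[of "{s}" "\<lambda>_. 1"] s by simp
  have sq: "expectation (\<lambda>\<omega>. (B s \<omega>)\<^sup>2) = (s powr H)\<^sup>2"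
    using covariance[of s s] s by (simp add: power2_eq_square powr_add[symmetric])
  have pos: "0 < (s powr H)\<^sup>2" using s by simp
  obtain \<mu> \<sigma> where "(\<sigma> = 0 \<and> (AE \<omega> in M. B s \<omega> = \<mu>)) \<or>
      (\<sigma> > 0 \<and> distributed M lborel (B s) (\<lambda>x. ennreal (normal_density \<mu> \<sigma> x)))"
    using g unfolding gaussian_rv_def by blast
  then show ?thesis
  proof (elim disjE conjE)
    assume ae: "AE \<omega> in M. B s \<omega> = \<mu>"
    have "expectation (B s) = expectation (\<lambda>_. \<mu>)" using ae by (intro integral_cong_AE) auto
    then have "\<mu> = 0" using centered[of s] s by (simp add: prob_space)
    then have "expectation (\<lambda>\<omega>. (B s \<omega>)\<^sup>2) = expectation (\<lambda>_. 0)"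
      using ae by (intro integral_cong_AE) (auto elim!: eventually_mono)
    then show ?thesis using sq pos by simp
  next
    assume \<sigma>: "0 < \<sigma>" and D: "distributed M lborel (B s) (\<lambda>x. ennreal (normal_density \<mu> \<sigma> x))"
    have "\<mu> = 0" using normal_distributed_expectation[OF \<sigma> D] centered[of s] s by simp
    moreover have "\<sigma>\<^sup>2 = (s powr H)\<^sup>2"
      using normal_distributed_variance[OF \<sigma> D] centered[of s] s sq by simp
    then have "\<sigma> = s powr H" using \<sigma> by (simp add: power2_eq_iff_nonneg)
    ultimately show ?thesis using D normal_standard_normal_convert[OF \<sigma>, of "B s" \<mu>] by simp
  qed
qed

text \<open>The argument of the cosine is almost surely an angle plus a single variable
  \<open>W h\<close>, and orthogonality splits the squared norm of \<open>h\<close>. Thus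
  uncorrelated Gaussian blocks have a factorising characteristic function.\<close>

lemma cos_orthogonal:
  fixes m :: nat
  assumes s: "0 < s" and orth: "\<And>i. i < m \<Longrightarrow> inner (p i) (ind_vec s) = 0"
  shows "expectation (\<lambda>\<omega>. cos (\<theta> + (\<Sum>i<m. u i * W (p i) \<omega>) + v * (B s \<omega> / s powr H)))
    = cos \<theta> * exp (- (norm (\<Sum>i<m. u i *\<^sub>R p i))\<^sup>2 / 2) * exp (- v\<^sup>2 / 2)"
proof -
  let ?P = "\<Sum>i<m. u i *\<^sub>R p i" and ?\<sigma> = "s powr H"
  have [measurable]: "B s \<in> borel_measurable M" using s by (intro B_measurable) simp
  have \<sigma>: "0 < ?\<sigma>" using s by simp
  have ae: "AE \<omega> in M. W (1 *\<^sub>R ?P + (v / ?\<sigma>) *\<^sub>R ind_vec s) \<omega> = (\<Sum>i<m. u i * W (p i) \<omega>) + v * (B s \<omega> / ?\<sigma>)"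
    using W_linear[of 1 ?P "v / ?\<sigma>" "ind_vec s"] W_sum[OF finite_lessThan[of m], of u p] W_ind_vec[OF less_imp_le[OF s]]
    by eventually_elim simp
  have "inner ?P (ind_vec s) = 0" by (simp add: inner_sum_left orth)
  then have "inner (1 *\<^sub>R ?P + (v / ?\<sigma>) *\<^sub>R ind_vec s) (1 *\<^sub>R ?P + (v / ?\<sigma>) *\<^sub>R ind_vec s)
      = inner ?P ?P + (v / ?\<sigma>)\<^sup>2 * inner (ind_vec s) (ind_vec s)"
    by (simp add: inner_add_left inner_add_right inner_commute[of "ind_vec s" ?P] power2_eq_square)
  also have "inner (ind_vec s) (ind_vec s) = ?\<sigma>\<^sup>2"
    using norm_ind_vec[of s] s by (simp flip: power2_norm_eq_inner)
  finally have n: "(norm (1 *\<^sub>R ?P + (v / ?\<sigma>) *\<^sub>R ind_vec s))\<^sup>2 = (norm ?P)\<^sup>2 + v\<^sup>2"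
    using \<sigma> by (simp add: power2_norm_eq_inner power_divide)
  have "expectation (\<lambda>\<omega>. cos (\<theta> + (\<Sum>i<m. u i * W (p i) \<omega>) + v * (B s \<omega> / ?\<sigma>)))
      = expectation (\<lambda>\<omega>. cos (\<theta> + W (1 *\<^sub>R ?P + (v / ?\<sigma>) *\<^sub>R ind_vec s) \<omega>))"
    using ae by (intro integral_cong_AE) (auto elim!: eventually_mono simp: add.assoc)
  also have "\<dots> = cos \<theta> * exp (- ((norm ?P)\<^sup>2 + v\<^sup>2) / 2)" unfolding W_cos n ..
  finally show ?thesis by (simp add: exp_add[symmetric] add_divide_distrib diff_divide_distrib)
qed

text \<open>From characteristic functions to independence in two passes. Inverting in the variables
  \<open>W (p i)\<close>, with the centred cosine of \<open>Z\<close> as weight, yields the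
  expectation of that cosine times \<open>Q\<close>; inverting in \<open>Z\<close>, with weight
  \<open>Q - expectation Q\<close>, then gives the factorisation on rectangles.\<close>

lemma orthogonal_rect:
  fixes m :: nat
  assumes s: "0 < s" and orth: "\<And>i. i < m \<Longrightarrow> inner (p i) (ind_vec s) = 0"
    and A: "\<And>i. i < m \<Longrightarrow> A i \<in> sets borel" and C[measurable]: "C \<in> sets borel"
  defines "Z \<equiv> \<lambda>\<omega>. B s \<omega> / s powr H"
  shows "expectation (\<lambda>\<omega>. (\<Prod>i<m. indicator (A i) (W (p i) \<omega>)) * indicator C (Z \<omega>))
        = expectation (\<lambda>\<omega>. \<Prod>i<m. indicator (A i) (W (p i) \<omega>)) * prob (Z -` C \<inter> space M)"
proof -
  have [measurable]: "B s \<in> borel_measurable M" using s by (intro B_measurable) simp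
  have Zm[measurable]: "Z \<in> borel_measurable M" unfolding Z_def by measurable
  define Q where "Q \<omega> = (\<Prod>i<m. indicator (A i) (W (p i) \<omega>) :: real)" for \<omega>
  have Qm[measurable]: "Q \<in> borel_measurable M" unfolding Q_def
  proof (rule borel_measurable_prod)
    fix i assume "i \<in> {..<m}"
    then have [measurable]: "A i \<in> sets borel" using A by simp
    show "(\<lambda>\<omega>. indicator (A i) (W (p i) \<omega>) :: real) \<in> borel_measurable M" by measurable
  qed
  have Q1: "\<bar>Q \<omega>\<bar> \<le> 1" for \<omega> unfolding Q_def abs_prod by (intro prod_le_1) (auto simp: indicator_def)
  have bi: "integrable M f" if "f \<in> borel_measurable M" "\<And>\<omega>. \<bar>f \<omega>\<bar> \<le> K" for f :: "'a \<Rightarrow> real" and K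
    using that by (intro integrable_const_bound[of _ K]) auto
  define \<kappa> where "\<kappa> \<theta> v = cos \<theta> * exp (- v\<^sup>2 / 2)" for \<theta> v :: real
  have step1: "expectation (\<lambda>\<omega>. cos (\<theta>' + v * Z \<omega>) * Q \<omega>) = \<kappa> \<theta>' v * expectation Q" for \<theta>' v
  proof -
    have "expectation (\<lambda>\<omega>. (cos (\<theta>' + v * Z \<omega>) - \<kappa> \<theta>' v) * (\<Prod>i<m. indicator (A i) (W (p i) \<omega>))) = 0"
    proof (rule multidim_fourier_uniqueness)
      show "integrable M (\<lambda>\<omega>. cos (\<theta>' + v * Z \<omega>) - \<kappa> \<theta>' v)"
        by (intro Bochner_Integration.integrable_diff bi[of _ 1] integrable_const) auto
      fix u :: "nat \<Rightarrow> real" and \<theta>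
      let ?S = "\<lambda>\<omega>. \<Sum>i<m. u i * W (p i) \<omega>"
      let ?c = "\<lambda>\<theta> v \<omega>. cos (\<theta> + ?S \<omega> + v * (B s \<omega> / s powr H))"
      have ic: "integrable M (?c \<theta> v)" for \<theta> v by (rule bi[of _ 1]) auto
      have co: "expectation (?c \<theta> v) = cos \<theta> * exp (- (norm (\<Sum>i<m. u i *\<^sub>R p i))\<^sup>2 / 2) * exp (- v\<^sup>2 / 2)" for \<theta> v
        by (rule cos_orthogonal[OF s orth])
      have "(cos (\<theta>' + v * Z \<omega>) - \<kappa> \<theta>' v) * cos (\<theta> + ?S \<omega>)
        = ?c (\<theta> + \<theta>') v \<omega> / 2 + ?c (\<theta> - \<theta>') (- v) \<omega> / 2 - \<kappa> \<theta>' v * ?c \<theta> 0 \<omega>" for \<omega>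
      proof -
        have e: "(\<theta> + \<theta>') + ?S \<omega> + v * Z \<omega> = (\<theta> + ?S \<omega>) + (\<theta>' + v * Z \<omega>)"
          "(\<theta> - \<theta>') + ?S \<omega> + (- v) * Z \<omega> = (\<theta> + ?S \<omega>) - (\<theta>' + v * Z \<omega>)" by simp_all
        have Zd: "B s \<omega> / s powr H = Z \<omega>" by (simp add: Z_def)
        show ?thesis unfolding Zd e
          using cos_times_cos[of "\<theta> + ?S \<omega>" "\<theta>' + v * Z \<omega>"] by (simp add: left_diff_distrib add_divide_distrib mult.commute)
      qed
      then have "expectation (\<lambda>\<omega>. (cos (\<theta>' + v * Z \<omega>) - \<kappa> \<theta>' v) * cos (\<theta> + ?S \<omega>))
        = expectation (\<lambda>\<omega>. ?c (\<theta> + \<theta>') v \<omega> / 2 + ?c (\<theta> - \<theta>') (- v) \<omega> / 2 - \<kappa> \<theta>' v * ?c \<theta> 0 \<omega>)" by simp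
      also have "\<dots> = expectation (?c (\<theta> + \<theta>') v) / 2 + expectation (?c (\<theta> - \<theta>') (- v)) / 2 - \<kappa> \<theta>' v * expectation (?c \<theta> 0)"
        using ic[of "\<theta> + \<theta>'" v] ic[of "\<theta> - \<theta>'" "- v"] ic[of \<theta> 0]
        by (subst Bochner_Integration.integral_diff; (subst Bochner_Integration.integral_add)?) auto
      also have "\<dots> = 0"
        unfolding co \<kappa>_def by (simp add: cos_add cos_diff field_simps)
      finally show "expectation (\<lambda>\<omega>. (cos (\<theta>' + v * Z \<omega>) - \<kappa> \<theta>' v) * cos (\<theta> + ?S \<omega>)) = 0" .
    qed (use A in auto)
    then have "expectation (\<lambda>\<omega>. cos (\<theta>' + v * Z \<omega>) * Q \<omega> - \<kappa> \<theta>' v * Q \<omega>) = 0"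
      unfolding Q_def by (simp add: left_diff_distrib)
    moreover have "integrable M (\<lambda>\<omega>. cos (\<theta>' + v * Z \<omega>) * Q \<omega>)"
      by (rule bi[of _ 1]) (use Q1 in \<open>auto simp: abs_mult intro!: mult_le_one\<close>)
    moreover have "integrable M Q" by (rule bi[OF Qm Q1])
    ultimately show ?thesis by simp
  qed
  have cZ: "expectation (\<lambda>\<omega>. cos (\<theta> + u * Z \<omega>)) = \<kappa> \<theta> u" for \<theta> u
    using cos_orthogonal[OF s, of 0 p \<theta> undefined u] by (simp add: \<kappa>_def Z_def)
  have D: "expectation (\<lambda>\<omega>. (Q \<omega> - expectation Q) * cos (\<theta> + u * Z \<omega>)) = 0" for u \<theta>
  proof -
    have "expectation (\<lambda>\<omega>. (Q \<omega> - expectation Q) * cos (\<theta> + u * Z \<omega>))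
      = expectation (\<lambda>\<omega>. cos (\<theta> + u * Z \<omega>) * Q \<omega> - expectation Q * cos (\<theta> + u * Z \<omega>))"
      by (intro Bochner_Integration.integral_cong refl) (simp add: algebra_simps)
    also have "\<dots> = expectation (\<lambda>\<omega>. cos (\<theta> + u * Z \<omega>) * Q \<omega>) - expectation (\<lambda>\<omega>. expectation Q * cos (\<theta> + u * Z \<omega>))"
      by (rule Bochner_Integration.integral_diff; (intro integrable_mult_right)?; rule bi[of _ 1])
        (use Q1 in \<open>auto simp: abs_mult intro!: mult_le_one\<close>)
    finally show ?thesis by (simp add: step1 cZ)
  qed
  have iQ: "integrable M (\<lambda>\<omega>. Q \<omega> - expectation Q)"
    by (intro Bochner_Integration.integrable_diff bi[OF Qm Q1] integrable_const)
  have "expectation (\<lambda>\<omega>. (Q \<omega> - expectation Q) * indicator C (Z \<omega>)) = 0"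
  proof (rule weighted_fourier_uniqueness[OF Zm iQ _ _ C])
    show "expectation (\<lambda>\<omega>. (Q \<omega> - expectation Q) * cos (u * Z \<omega>)) = 0" for u using D[of 0 u] by simp
    show "expectation (\<lambda>\<omega>. (Q \<omega> - expectation Q) * sin (u * Z \<omega>)) = 0" for u
      using D[of "- (pi / 2)" u] by (simp add: cos_diff minus_diff_commute cos_add)
  qed
  moreover have "integrable M (\<lambda>\<omega>. Q \<omega> * indicator C (Z \<omega>))" "integrable M (\<lambda>\<omega>. indicator C (Z \<omega>) :: real)"
    by (rule bi[of _ 1]; use Q1 in \<open>auto simp: abs_mult indicator_def\<close>)+
  ultimately have "expectation (\<lambda>\<omega>. Q \<omega> * indicator C (Z \<omega>)) = expectation Q * expectation (\<lambda>\<omega>. indicator C (Z \<omega>))"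
    by (simp add: left_diff_distrib)
  also have "expectation (\<lambda>\<omega>. indicator C (Z \<omega>) :: real) = expectation (indicator (Z -` C \<inter> space M))"
    by (intro Bochner_Integration.integral_cong refl) (auto simp: indicator_def)
  also have "\<dots> = prob (Z -` C \<inter> space M)" by simp
  finally show ?thesis unfolding Q_def .
qed

text \<open>Each \<open>W (g i)\<close> splits into a multiple of the standard normal variable
  \<open>Z\<close> and a part independent of it. With the independent parts frozen, the test
  function depends on one Gaussian variable, and integration by parts in that variable lowers the
  Hermite order.\<close>

lemma hermite_duality_pos:
  assumes \<phi>: "\<phi> \<in> Cb_infinity m" and s: "0 < s"
  shows "real (Suc n) * expectation (\<lambda>\<omega>. cylindrical m \<phi> g \<omega> * poly (herm (Suc n)) (B s \<omega> / s powr H))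
    = (\<Sum>i<m. inner (g i) (ind_vec s) / s powr H *
        expectation (\<lambda>\<omega>. cylindrical m (partial i \<phi>) g \<omega> * poly (herm n) (B s \<omega> / s powr H)))"
proof -
  let ?\<sigma> = "s powr H"
  have \<sigma>: "0 < ?\<sigma>" using s by simp
  have [measurable]: "B s \<in> borel_measurable M" using s by (intro B_measurable) simp
  define Z where "Z \<omega> = B s \<omega> / ?\<sigma>" for \<omega>
  have Zm[measurable]: "Z \<in> borel_measurable M" unfolding Z_def by measurable
  have DZ: "distributed M lborel Z std_normal_density" unfolding Z_def by (rule B_distributed[OF s])
  define c where "c i = inner (g i) (ind_vec s) / ?\<sigma>" for i
  \<comment> \<open>The component of \<open>g i\<close> orthogonal to \<open>ind_vec s\<close>; the
    coefficient \<open>c i\<close> carries one factor \<open>s powr H\<close> because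
    \<open>Z\<close> is already normalised.\<close>
  define p where "p i = 1 *\<^sub>R g i + (- c i / ?\<sigma>) *\<^sub>R ind_vec s" for i
  define Y where "Y i = W (p i)" for i
  have Ym[measurable]: "Y i \<in> borel_measurable M" for i unfolding Y_def by measurable
  have "inner (ind_vec s) (ind_vec s) = ?\<sigma>\<^sup>2"
    using norm_ind_vec[of s] s by (simp flip: power2_norm_eq_inner)
  then have orth: "inner (p i) (ind_vec s) = 0" for i
    using \<sigma> by (simp add: p_def c_def inner_diff_left power2_eq_square)
  have rect: "expectation (\<lambda>\<omega>. (\<Prod>i<m. indicator (A i) (Y i \<omega>)) * indicator C (Z \<omega>))
        = expectation (\<lambda>\<omega>. \<Prod>i<m. indicator (A i) (Y i \<omega>)) * prob (Z -` C \<inter> space M)"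
    if "\<And>i. i < m \<Longrightarrow> A i \<in> sets borel" "C \<in> sets borel" for A C
    unfolding Y_def Z_def using orthogonal_rect[OF s orth that] .
  have "AE \<omega> in M. W (p i) \<omega> = 1 * W (g i) \<omega> + (- c i / ?\<sigma>) * W (ind_vec s) \<omega>" for i
    unfolding p_def by (rule W_linear)
  then have "AE \<omega> in M. \<forall>i\<in>{..<m}. W (p i) \<omega> = 1 * W (g i) \<omega> + (- c i / ?\<sigma>) * W (ind_vec s) \<omega>"
    by (intro AE_finite_allI) auto
  then have ae: "AE \<omega> in M. \<forall>i<m. W (g i) \<omega> = Y i \<omega> + c i * Z \<omega>"
    using W_ind_vec[OF less_imp_le[OF s]]
    by eventually_elim (auto simp: Y_def Z_def)
  have pm[measurable]: "poly q \<in> borel_measurable borel" for q :: "real poly"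
    by (intro borel_measurable_continuous_onI continuous_intros)
  have arg: "(\<lambda>z i. fst z i + c i * snd z) \<in> borel_measurable (borel \<Otimes>\<^sub>M borel)" (is "?arg \<in> _")
  proof (rule measurable_coordinatewise_then_product)
    fix i
    have "(\<lambda>z::(nat \<Rightarrow> real) \<times> real. fst z i) \<in> borel_measurable (borel \<Otimes>\<^sub>M borel)"
      by (rule measurable_compose[OF measurable_fst measurable_product_then_coordinatewise]) simp
    then show "(\<lambda>z. fst z i + c i * snd z) \<in> borel_measurable (borel \<Otimes>\<^sub>M borel)" by measurable
  qed
  define G where "G \<psi> q x z = \<psi> (\<lambda>i. x i + c i * z) * poly q z" for \<psi> and q :: "real poly" and x z
  have Gm: "(\<lambda>(x, z). G \<psi> q x z) \<in> borel_measurable (borel \<Otimes>\<^sub>M borel)" if "\<psi> \<in> Cb_infinity m" for \<psi> q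
  proof -
    have [measurable]: "(\<lambda>z. \<psi> (\<lambda>i. fst z i + c i * snd z)) \<in> borel_measurable (borel \<Otimes>\<^sub>M borel)"
      by (rule measurable_compose[OF arg borel_measurable_continuous_onI[OF Cb_infinityD(1)[OF that]]])
    have [measurable]: "(\<lambda>z::(nat \<Rightarrow> real) \<times> real. poly q (snd z)) \<in> borel_measurable (borel \<Otimes>\<^sub>M borel)"
      by (rule measurable_compose[OF measurable_snd pm])
    show ?thesis unfolding G_def case_prod_beta' by measurable
  qed
  have Gdep: "G \<psi> q x z = G \<psi> q y z" if "\<psi> \<in> Cb_infinity m" "\<And>i. i < m \<Longrightarrow> x i = y i" for \<psi> q x y z
    unfolding G_def using that(2) by (subst Cb_infinity_cong[OF that(1), of _ "\<lambda>i. y i + c i * z"]) auto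
  have pZ: "integrable M (\<lambda>\<omega>. poly q (Z \<omega>))" for q
    using distributed_integrable[OF DZ, of "poly q"] integrable_poly_std_normal by auto
  have YZ: "(\<lambda>\<omega>. \<lambda>i. Y i \<omega>) \<in> borel_measurable M" by (rule measurable_coordinatewise_then_product) simp
  have Gint: "integrable M (\<lambda>\<omega>. G \<psi> q (\<lambda>i. Y i \<omega>) (Z \<omega>))" if \<psi>: "\<psi> \<in> Cb_infinity m" for \<psi> q
  proof -
    obtain K where K: "\<And>x. \<bar>\<psi> x\<bar> \<le> K" using Cb_infinity_bound[OF \<psi>] by blast
    have m: "(\<lambda>\<omega>. G \<psi> q (\<lambda>i. Y i \<omega>) (Z \<omega>)) \<in> borel_measurable M"
      using measurable_compose[OF measurable_Pair[OF YZ Zm] Gm[OF \<psi>]] by simp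
    show ?thesis
    proof (rule Bochner_Integration.integrable_bound[OF integrable_mult_right[OF pZ[of q], of K] m], rule AE_I2)
      fix \<omega>
      have "\<bar>\<psi> (\<lambda>i. Y i \<omega> + c i * Z \<omega>)\<bar> * \<bar>poly q (Z \<omega>)\<bar> \<le> \<bar>K\<bar> * \<bar>poly q (Z \<omega>)\<bar>"
        by (intro mult_right_mono order_trans[OF K abs_ge_self]) simp
      then show "norm (G \<psi> q (\<lambda>i. Y i \<omega>) (Z \<omega>)) \<le> norm (K * poly q (Z \<omega>))"
        by (simp add: G_def abs_mult)
    qed
  qed
  have cyl: "expectation (\<lambda>\<omega>. cylindrical m \<psi> g \<omega> * poly q (Z \<omega>)) = expectation (\<lambda>\<omega>. G \<psi> q (\<lambda>i. Y i \<omega>) (Z \<omega>))"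
    if \<psi>: "\<psi> \<in> Cb_infinity m" for \<psi> q
  proof (rule integral_cong_AE)
    have [measurable]: "(\<lambda>\<omega>. cylindrical m \<psi> g \<omega>) \<in> borel_measurable M"
      unfolding cylindrical_def
    proof (rule measurable_compose[OF _ borel_measurable_continuous_onI[OF Cb_infinityD(1)[OF \<psi>]]],
        rule measurable_coordinatewise_then_product)
      show "(\<lambda>\<omega>. if i < m then W (g i) \<omega> else 0) \<in> borel_measurable M" for i by (cases "i < m") auto
    qed
    show "(\<lambda>\<omega>. cylindrical m \<psi> g \<omega> * poly q (Z \<omega>)) \<in> borel_measurable M" by measurable
    show "(\<lambda>\<omega>. G \<psi> q (\<lambda>i. Y i \<omega>) (Z \<omega>)) \<in> borel_measurable M"
      by (rule borel_measurable_integrable[OF Gint[OF \<psi>]])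
    show "AE \<omega> in M. cylindrical m \<psi> g \<omega> * poly q (Z \<omega>) = G \<psi> q (\<lambda>i. Y i \<omega>) (Z \<omega>)"
      using ae
    proof eventually_elim
      case (elim \<omega>)
      have "\<psi> (\<lambda>i. if i < m then W (g i) \<omega> else 0) = \<psi> (\<lambda>i. Y i \<omega> + c i * Z \<omega>)"
        by (rule Cb_infinity_cong[OF \<psi>]) (use elim in simp)
      then show ?case by (simp add: cylindrical_def G_def)
    qed
  qed
  have indep: "expectation (\<lambda>\<omega>. F (\<lambda>i. Y i \<omega>) (Z \<omega>)) = expectation (\<lambda>\<omega>. expectation (\<lambda>\<omega>'. F (\<lambda>i. Y i \<omega>) (Z \<omega>')))"
    if "(\<lambda>(x, z). F x z) \<in> borel_measurable (borel \<Otimes>\<^sub>M borel)"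
      "\<And>x y z. (\<And>i. i < m \<Longrightarrow> x i = y i) \<Longrightarrow> F x z = F y z"
      "integrable M (\<lambda>\<omega>. F (\<lambda>i. Y i \<omega>) (Z \<omega>))" for F :: "(nat \<Rightarrow> real) \<Rightarrow> real \<Rightarrow> real"
  proof (rule expectation_independent[where F = F and Y = Y and Z = Z and m = m])
    show "F x z = F y z" if "\<And>i. i < m \<Longrightarrow> x i = y i" for x y z by (rule \<open>\<And>x y z. (\<And>i. i < m \<Longrightarrow> x i = y i) \<Longrightarrow> F x z = F y z\<close>[OF that])
    show "expectation (\<lambda>\<omega>. (\<Prod>i<m. indicator (A i) (Y i \<omega>)) * indicator C (Z \<omega>))
        = expectation (\<lambda>\<omega>. \<Prod>i<m. indicator (A i) (Y i \<omega>)) * prob (Z -` C \<inter> space M)"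
      if "\<And>i. i < m \<Longrightarrow> A i \<in> sets borel" "C \<in> sets borel" for A C by (rule rect[OF that])
  qed (rule Ym Zm that)+
  let ?F' = "\<lambda>x z. \<Sum>i<m. c i * G (partial i \<phi>) (herm n) x z"
  have inner: "real (Suc n) * expectation (\<lambda>\<omega>'. G \<phi> (herm (Suc n)) x (Z \<omega>')) = expectation (\<lambda>\<omega>'. ?F' x (Z \<omega>'))" for x
  proof -
    define \<psi> \<psi>' where "\<psi> z = \<phi> (\<lambda>i. x i + c i * z)"
      and "\<psi>' z = (\<Sum>i<m. c i * partial i \<phi> (\<lambda>i. x i + c i * z))" for z
    obtain K where K: "\<And>x. \<bar>\<phi> x\<bar> \<le> K" using Cb_infinity_bound[OF \<phi>] by blast
    have "\<forall>i. \<exists>K. i < m \<longrightarrow> (\<forall>x. \<bar>partial i \<phi> x\<bar> \<le> K)"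
      using Cb_infinity_bound[OF Cb_infinity_partial[OF \<phi>]] by metis
    then obtain K' where K': "\<And>i x. i < m \<Longrightarrow> \<bar>partial i \<phi> x\<bar> \<le> K' i" by metis
    have b': "\<bar>\<psi>' z\<bar> \<le> (\<Sum>i<m. \<bar>c i\<bar> * K' i)" for z
      unfolding \<psi>'_def by (rule order_trans[OF sum_abs], rule sum_mono) (auto simp: abs_mult intro!: mult_left_mono K')
    have D: "(\<psi> has_real_derivative \<psi>' z) (at z)" for z
      unfolding \<psi>_def \<psi>'_def by (rule Cb_infinity_chain[OF \<phi>])
    have cont: "continuous_on UNIV (\<lambda>z. \<xi> (\<lambda>i. x i + c i * z))" if "\<xi> \<in> Cb_infinity m" for \<xi>
      by (rule continuous_on_compose2[OF Cb_infinityD(1)[OF that]])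
        (auto intro!: continuous_on_coordinatewise_then_product continuous_intros)
    have c': "continuous_on UNIV \<psi>'" unfolding \<psi>'_def
      by (intro continuous_intros cont Cb_infinity_partial[OF \<phi>]) auto
    have c0: "continuous_on UNIV \<psi>" unfolding \<psi>_def by (rule cont[OF \<phi>])
    have dist: "expectation (\<lambda>\<omega>. f (Z \<omega>) * poly q (Z \<omega>)) = (\<integral>z. f z * poly q z * std_normal_density z \<partial>lborel)"
      if "continuous_on UNIV f" for f q
    proof -
      have [measurable]: "f \<in> borel_measurable borel" using that by (rule borel_measurable_continuous_onI)
      have "(\<integral>z. std_normal_density z * (f z * poly q z) \<partial>lborel) = expectation (\<lambda>\<omega>. f (Z \<omega>) * poly q (Z \<omega>))"
        by (rule distributed_integral[OF DZ]) auto
      then show ?thesis by (simp add: mult_ac)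
    qed
    have "real (Suc n) * expectation (\<lambda>\<omega>'. \<psi> (Z \<omega>') * poly (herm (Suc n)) (Z \<omega>'))
        = expectation (\<lambda>\<omega>'. \<psi>' (Z \<omega>') * poly (herm n) (Z \<omega>'))"
      unfolding dist[OF c0] dist[OF c']
      by (rule hermite_integration_by_parts[OF _ b' D c', of K]) (use K in \<open>simp add: \<psi>_def\<close>)
    then show ?thesis unfolding G_def \<psi>_def \<psi>'_def by (simp add: sum_distrib_right mult.assoc del: herm.simps)
  qed
  have "real (Suc n) * expectation (\<lambda>\<omega>. G \<phi> (herm (Suc n)) (\<lambda>i. Y i \<omega>) (Z \<omega>))
      = expectation (\<lambda>\<omega>. real (Suc n) * expectation (\<lambda>\<omega>'. G \<phi> (herm (Suc n)) (\<lambda>i. Y i \<omega>) (Z \<omega>')))"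
    using indep[OF Gm[OF \<phi>] Gdep[OF \<phi>] Gint[OF \<phi>]] by simp
  also have "\<dots> = expectation (\<lambda>\<omega>. expectation (\<lambda>\<omega>'. ?F' (\<lambda>i. Y i \<omega>) (Z \<omega>')))" unfolding inner ..
  also have "\<dots> = expectation (\<lambda>\<omega>. ?F' (\<lambda>i. Y i \<omega>) (Z \<omega>))"
  proof (rule indep[symmetric])
    show "(\<lambda>(x, z). ?F' x z) \<in> borel_measurable (borel \<Otimes>\<^sub>M borel)"
      unfolding case_prod_beta'
      using Gm[OF Cb_infinity_partial[OF \<phi>]] by (intro borel_measurable_sum borel_measurable_times) (auto simp: case_prod_beta')
    show "?F' x z = ?F' y z" if "\<And>i. i < m \<Longrightarrow> x i = y i" for x y z
      using Gdep[OF Cb_infinity_partial[OF \<phi>] that] by (intro sum.cong refl) auto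
    show "integrable M (\<lambda>\<omega>. ?F' (\<lambda>i. Y i \<omega>) (Z \<omega>))"
      using Gint[OF Cb_infinity_partial[OF \<phi>]] by (intro Bochner_Integration.integrable_sum integrable_mult_right) auto
  qed
  also have "\<dots> = (\<Sum>i<m. c i * expectation (\<lambda>\<omega>. G (partial i \<phi>) (herm n) (\<lambda>i. Y i \<omega>) (Z \<omega>)))"
    using Gint[OF Cb_infinity_partial[OF \<phi>]] by (subst Bochner_Integration.integral_sum) auto
  also have "\<dots> = (\<Sum>i<m. c i * expectation (\<lambda>\<omega>. cylindrical m (partial i \<phi>) g \<omega> * poly (herm n) (Z \<omega>)))"
    using cyl[OF Cb_infinity_partial[OF \<phi>]] by (intro sum.cong refl) auto
  finally show ?thesis unfolding Z_def[symmetric] cyl[OF \<phi>] c_def .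
qed

end

section \<open>The iterated integrals\<close>

text \<open>Bounded second moments imply uniform integrability: below a level \<open>R\<close>
  dominated convergence applies, and the rest is at most the second moment divided by
  \<open>R\<close>. It replaces a dominating random variable, which the Riemann sums do not come
  with.\<close>

lemma (in prob_space) expectation_tendsto_bounded_moments:
  fixes X :: "nat \<Rightarrow> 'a \<Rightarrow> real"
  assumes Xm[measurable]: "\<And>k. X k \<in> borel_measurable M" and Ym[measurable]: "Y \<in> borel_measurable M"
    and X2: "\<And>k. integrable M (\<lambda>\<omega>. (X k \<omega>)\<^sup>2)" and K: "\<And>k. expectation (\<lambda>\<omega>. (X k \<omega>)\<^sup>2) \<le> K"
    and Y2: "integrable M (\<lambda>\<omega>. (Y \<omega>)\<^sup>2)"
    and lim: "\<And>\<omega>. \<omega> \<in> space M \<Longrightarrow> (\<lambda>k. X k \<omega>) \<longlonglongrightarrow> Y \<omega>"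
  shows "(\<lambda>k. expectation (X k)) \<longlonglongrightarrow> expectation Y"
proof -
  have iX: "integrable M (X k)" for k using square_integrable_imp_integrable[OF Xm X2] .
  have iY: "integrable M Y" using square_integrable_imp_integrable[OF Ym Y2] .
  define y where "y k \<omega> = \<bar>X k \<omega> - Y \<omega>\<bar>" for k \<omega>
  have [measurable]: "y k \<in> borel_measurable M" for k unfolding y_def by measurable
  have sq: "(y k \<omega>)\<^sup>2 \<le> 2 * (X k \<omega>)\<^sup>2 + 2 * (Y \<omega>)\<^sup>2" for k \<omega>
    using zero_le_power2[of "X k \<omega> + Y \<omega>"] by (simp add: y_def power2_eq_square algebra_simps)
  have i2: "integrable M (\<lambda>\<omega>. 2 * (X k \<omega>)\<^sup>2 + 2 * (Y \<omega>)\<^sup>2)" for k using X2 Y2 by simp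
  have y2: "integrable M (\<lambda>\<omega>. (y k \<omega>)\<^sup>2)" for k
    by (rule Bochner_Integration.integrable_bound[OF i2[of k]]) (use sq in auto)
  define L where "L = 2 * K + 2 * expectation (\<lambda>\<omega>. (Y \<omega>)\<^sup>2)"
  have yL: "expectation (\<lambda>\<omega>. (y k \<omega>)\<^sup>2) \<le> L" for k
  proof -
    have "expectation (\<lambda>\<omega>. (y k \<omega>)\<^sup>2) \<le> expectation (\<lambda>\<omega>. 2 * (X k \<omega>)\<^sup>2 + 2 * (Y \<omega>)\<^sup>2)"
      by (rule integral_mono[OF y2 i2 sq])
    also have "\<dots> = 2 * expectation (\<lambda>\<omega>. (X k \<omega>)\<^sup>2) + 2 * expectation (\<lambda>\<omega>. (Y \<omega>)\<^sup>2)"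
      using X2 Y2 by simp
    finally show ?thesis using K[of k] by (simp add: L_def)
  qed
  have iy: "integrable M (y k)" for k unfolding y_def[abs_def] using iX iY by simp
  have y0: "0 \<le> y k \<omega>" for k \<omega> by (simp add: y_def)
  have L0: "0 \<le> L" by (rule order_trans[OF _ yL[of 0]], rule integral_nonneg_AE) simp
  have "(\<lambda>k. expectation (y k)) \<longlonglongrightarrow> 0"
  proof (rule tendstoI)
    fix e :: real assume e: "0 < e"
    \<comment> \<open>Large enough to push the tail bound \<open>L / R\<close> below
      \<open>e / 2\<close>; the summand \<open>1\<close> keeps \<open>R\<close> positive when
      \<open>L = 0\<close>.\<close>
    define R where "R = 2 * L / e + 1"
    have R: "0 < R" "L / R < e / 2"
    proof -
      show "0 < R" using L0 e by (simp add: R_def add_nonneg_pos)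
      then show "L / R < e / 2" using e by (simp add: R_def field_simps)
    qed
    have "(\<lambda>k. expectation (\<lambda>\<omega>. min (y k \<omega>) R)) \<longlonglongrightarrow> expectation (\<lambda>\<omega>. 0)"
    proof (rule integral_dominated_convergence[where w = "\<lambda>_. R"])
      show "AE \<omega> in M. (\<lambda>k. min (y k \<omega>) R) \<longlonglongrightarrow> 0"
      proof (rule AE_I2)
        fix \<omega> assume "\<omega> \<in> space M"
        then have "(\<lambda>k. \<bar>X k \<omega> - Y \<omega>\<bar>) \<longlonglongrightarrow> 0"
          using lim by (intro tendsto_rabs_zero LIM_zero) auto
        then have "(\<lambda>k. min (y k \<omega>) R) \<longlonglongrightarrow> min 0 R" unfolding y_def by (intro tendsto_min tendsto_const)
        then show "(\<lambda>k. min (y k \<omega>) R) \<longlonglongrightarrow> 0" using R by simp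
      qed
      show "AE \<omega> in M. norm (min (y k \<omega>) R) \<le> R" for k using y0 R by (intro AE_I2) auto
    qed auto
    then have "eventually (\<lambda>k. expectation (\<lambda>\<omega>. min (y k \<omega>) R) < e / 2) sequentially"
      using e by (intro order_tendstoD(2)) auto
    then show "eventually (\<lambda>k. dist (expectation (y k)) 0 < e) sequentially"
    proof eventually_elim
      case (elim k)
      have mi: "integrable M (\<lambda>\<omega>. min (y k \<omega>) R)"
        by (rule integrable_const_bound[of _ R]) (use y0 R in auto)
      have "expectation (y k) \<le> expectation (\<lambda>\<omega>. min (y k \<omega>) R + (y k \<omega>)\<^sup>2 / R)"
      proof (rule integral_mono[OF iy])
        show "integrable M (\<lambda>\<omega>. min (y k \<omega>) R + (y k \<omega>)\<^sup>2 / R)" using mi y2 by simp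
        show "y k \<omega> \<le> min (y k \<omega>) R + (y k \<omega>)\<^sup>2 / R" for \<omega>
        proof (cases "y k \<omega> \<le> R")
          case False
          then have "R * y k \<omega> \<le> (y k \<omega>)\<^sup>2" using y0[of k \<omega>] by (simp add: power2_eq_square mult_right_mono)
          then have "y k \<omega> \<le> (y k \<omega>)\<^sup>2 / R" using R by (simp add: pos_le_divide_eq mult.commute)
          then show ?thesis using R False by (simp add: min_def)
        qed (use R in simp)
      qed
      also have "\<dots> = expectation (\<lambda>\<omega>. min (y k \<omega>) R) + expectation (\<lambda>\<omega>. (y k \<omega>)\<^sup>2) / R"
        using mi y2 by simp
      also have "\<dots> < e / 2 + e / 2"
        using elim R by (intro add_strict_mono le_less_trans[OF divide_right_mono[OF yL[of k]] R(2)]) auto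
      finally show ?case using integral_nonneg_AE[of "y k" M] y0 by simp
    qed
  qed
  moreover have "norm (expectation (X k) - expectation Y) \<le> expectation (y k)" for k
    unfolding Bochner_Integration.integral_diff[OF iX iY, symmetric] y_def
    using integral_abs_bound[of M "\<lambda>\<omega>. X k \<omega> - Y \<omega>"] by simp
  ultimately have "(\<lambda>k. expectation (X k) - expectation Y) \<longlonglongrightarrow> 0"
    by (rule Lim_null_comparison[rotated, OF _ always_eventually, rule_format])
  then show ?thesis by (rule LIM_zero_cancel)
qed

section \<open>The candidate process: paths, measurability, moments, duality\<close>

context regular_fbm begin

text \<open>The set of discontinuous paths need not be measurable; a measurable null set that
  contains it is chosen instead.\<close>

definition bad_paths :: "'a set" where
  "bad_paths = (SOME N. N \<in> null_sets M \<and> {\<omega> \<in> space M. \<not> continuous_on {0..} (\<lambda>t. B t \<omega>)} \<subseteq> N)"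

lemma bad_paths:
  "bad_paths \<in> null_sets M" "\<omega> \<in> space M \<Longrightarrow> \<omega> \<notin> bad_paths \<Longrightarrow> continuous_on {0..} (\<lambda>t. B t \<omega>)"
proof -
  have "\<exists>N. N \<in> null_sets M \<and> {\<omega> \<in> space M. \<not> continuous_on {0..} (\<lambda>t. B t \<omega>)} \<subseteq> N"
    using continuous_paths unfolding eventually_ae_filter by blast
  from someI_ex[OF this] show "bad_paths \<in> null_sets M"
    "\<omega> \<in> space M \<Longrightarrow> \<omega> \<notin> bad_paths \<Longrightarrow> continuous_on {0..} (\<lambda>t. B t \<omega>)"
    unfolding bad_paths_def[symmetric] by auto
qed

text \<open>A version all of whose paths are continuous. Reading it at \<open>max 0 s\<close>
  extends it to all real times, which the discretisation in
  \<open>continuous_B_joint_measurable\<close> relies on.\<close>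

definition continuous_B :: "real \<Rightarrow> 'a \<Rightarrow> real" where
  "continuous_B s \<omega> = (if \<omega> \<in> bad_paths then 0 else B (max 0 s) \<omega>)"

lemma continuous_B_paths: "\<omega> \<in> space M \<Longrightarrow> continuous_on A (\<lambda>s. continuous_B s \<omega>)"
  unfolding continuous_B_def
  by (cases "\<omega> \<in> bad_paths")
    (auto intro!: continuous_intros continuous_on_compose2[OF bad_paths(2)])

lemma continuous_B_measurable [measurable]: "continuous_B s \<in> borel_measurable M"
proof -
  have [measurable]: "bad_paths \<in> sets M" using bad_paths(1) by auto
  have [measurable]: "B (max 0 s) \<in> borel_measurable M" by (rule B_measurable) simp
  show ?thesis unfolding continuous_B_def[abs_def] by measurable
qed

lemma continuous_B_AE: "0 \<le> s \<Longrightarrow> AE \<omega> in M. continuous_B s \<omega> = B s \<omega>"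
  using AE_not_in[OF bad_paths(1)] by eventually_elim (simp add: continuous_B_def max_def)

text \<open>Rounding the time down to a multiple of \<open>1 / (k + 1)\<close> leaves countably many
  values and hence joint measurability; continuity of paths recovers the process in the
  limit.\<close>

lemma continuous_B_joint_measurable: "(\<lambda>z. continuous_B (fst z) (snd z)) \<in> borel_measurable (lborel \<Otimes>\<^sub>M M)"
proof (rule borel_measurable_LIMSEQ_real)
  let ?r = "\<lambda>k (z::real \<times> 'a). real_of_int \<lfloor>real (Suc k) * fst z\<rfloor> / real (Suc k)"
  show "(\<lambda>z. continuous_B (?r k z) (snd z)) \<in> borel_measurable (lborel \<Otimes>\<^sub>M M)" for k
    by (rule measurable_compose_countable[where f = "\<lambda>i z. continuous_B (real_of_int i / real (Suc k)) (snd z)"]) measurable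
  fix z :: "real \<times> 'a" assume "z \<in> space (lborel \<Otimes>\<^sub>M M)"
  then have z: "snd z \<in> space M" by (auto simp: space_pair_measure)
  have "(\<lambda>k. ?r k z) \<longlonglongrightarrow> fst z"
  proof (rule tendsto_sandwich)
    show "eventually (\<lambda>k. fst z - 1 / real (Suc k) \<le> ?r k z) sequentially"
    proof (intro always_eventually allI)
      fix k
      have "real (Suc k) * fst z - 1 \<le> real_of_int \<lfloor>real (Suc k) * fst z\<rfloor>" by linarith
      then have "(real (Suc k) * fst z - 1) / real (Suc k) \<le> ?r k z" by (rule divide_right_mono) simp
      then show "fst z - 1 / real (Suc k) \<le> ?r k z" by (simp add: diff_divide_distrib del: of_nat_Suc)
    qed
    show "eventually (\<lambda>k. ?r k z \<le> fst z) sequentially"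
    proof (intro always_eventually allI)
      fix k
      have "?r k z \<le> (real (Suc k) * fst z) / real (Suc k)" by (rule divide_right_mono) simp_all
      then show "?r k z \<le> fst z" by (simp del: of_nat_Suc)
    qed
    show "(\<lambda>k. fst z - 1 / real (Suc k)) \<longlonglongrightarrow> fst z" by real_asymp
  qed simp
  then show "(\<lambda>k. continuous_B (?r k z) (snd z)) \<longlonglongrightarrow> continuous_B (fst z) (snd z)"
    using continuous_on_tendsto_compose[OF continuous_B_paths[OF z, of UNIV]] by auto
qed

text \<open>The candidate for the iterated integrals. \<open>herm_var\<close> in place of a rescaled
  Hermite polynomial avoids division by \<open>s powr H\<close> and makes paths continuous at time
  \<open>0\<close> as well.\<close>

definition chaos :: "nat \<Rightarrow> real \<Rightarrow> 'a \<Rightarrow> real" where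
  "chaos n s \<omega> = herm_var n (continuous_B s \<omega>) (s powr (2 * H))"

lemma chaos_measurable [measurable]: "chaos n s \<in> borel_measurable M"
  unfolding chaos_def[abs_def] by measurable

lemma chaos_joint_measurable: "(\<lambda>z. chaos n (fst z) (snd z)) \<in> borel_measurable (lborel \<Otimes>\<^sub>M M)"
  unfolding chaos_def using continuous_B_joint_measurable by measurable

lemma chaos_continuous: "\<omega> \<in> space M \<Longrightarrow> A \<subseteq> {0..} \<Longrightarrow> continuous_on A (\<lambda>s. chaos n s \<omega>)"
  unfolding chaos_def using Hurst
  by (intro continuous_intros continuous_B_paths continuous_on_powr') auto

lemma chaos_AE:
  assumes s: "0 < s"
  shows "AE \<omega> in M. chaos n s \<omega> = (s powr H) ^ n * poly (herm n) (B s \<omega> / s powr H)"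
  using continuous_B_AE[OF less_imp_le[OF s]]
proof eventually_elim
  case (elim \<omega>)
  have "s powr (2 * H) = (s powr H)\<^sup>2" by (simp add: power2_eq_square powr_add[symmetric])
  then show ?case using herm_var_scale[of n "s powr H" "B s \<omega> / s powr H"] s by (simp add: chaos_def elim)
qed

lemma chaos_0_AE: "AE \<omega> in M. chaos (Suc n) 0 \<omega> = 0"
proof -
  have "AE \<omega> in M. W (0::'h) \<omega> = 0" using W_sum[of "{}::nat set"] by simp
  moreover have "AE \<omega> in M. W (ind_vec 0) \<omega> = B 0 \<omega>" by (rule W_ind_vec) simp
  moreover have "AE \<omega> in M. continuous_B 0 \<omega> = B 0 \<omega>" by (rule continuous_B_AE) simp
  ultimately show ?thesis
  proof eventually_elim
    case (elim \<omega>)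
    then have "continuous_B 0 \<omega> = 0" by (simp add: ind_vec_0)
    then show ?case using herm_var_0[of n] by (simp add: chaos_def del: herm_var.simps)
  qed
qed

lemma chaos_second_moment:
  obtains K where "0 \<le> K" "\<And>s. 0 \<le> s \<Longrightarrow> s \<le> T \<Longrightarrow> integrable M (\<lambda>\<omega>. (chaos n s \<omega>)\<^sup>2)"
    "\<And>s. 0 \<le> s \<Longrightarrow> s \<le> T \<Longrightarrow> expectation (\<lambda>\<omega>. (chaos n s \<omega>)\<^sup>2) \<le> K"
proof -
  define \<kappa> where "\<kappa> = (\<integral>z. std_normal_density z * poly (herm n * herm n) z \<partial>lborel)"
  have \<kappa>0: "0 \<le> \<kappa>" unfolding \<kappa>_def by (intro integral_nonneg_AE AE_I2) (auto simp: normal_density_nonneg)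
  \<comment> \<open>The summand \<open>1\<close> settles order \<open>0\<close> at time
    \<open>0\<close>, where the second moment is \<open>1\<close>, without an evaluation of
    \<open>\<kappa>\<close>.\<close>
  define K where "K = (T powr H) ^ (2 * n) * \<kappa> + 1"
  have K0: "0 \<le> (T powr H) ^ (2 * n) * \<kappa>" using \<kappa>0 by simp
  have main: "integrable M (\<lambda>\<omega>. (chaos n s \<omega>)\<^sup>2) \<and> expectation (\<lambda>\<omega>. (chaos n s \<omega>)\<^sup>2) \<le> K" if s: "0 \<le> s" "s \<le> T" for s
  proof (cases "s = 0")
    case True
    show ?thesis
    proof (cases n)
      case 0
      then show ?thesis using K0 by (simp add: chaos_def K_def prob_space)
    next
      case (Suc n')
      have ae: "AE \<omega> in M. (chaos n s \<omega>)\<^sup>2 = 0" using chaos_0_AE[of n'] unfolding Suc True by eventually_elim simp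
      have "integrable M (\<lambda>\<omega>. (chaos n s \<omega>)\<^sup>2) \<longleftrightarrow> integrable M (\<lambda>\<omega>. 0 :: real)"
        by (rule integrable_cong_AE) (use ae in auto)
      moreover have "expectation (\<lambda>\<omega>. (chaos n s \<omega>)\<^sup>2) = 0" by (rule integral_eq_zero_AE[OF ae])
      ultimately show ?thesis using K0 by (simp add: K_def)
    qed
  next
    case False
    then have s0: "0 < s" using s by simp
    let ?Z = "\<lambda>\<omega>. B s \<omega> / s powr H"
    have [measurable]: "B s \<in> borel_measurable M" using s by (intro B_measurable) simp
    have pm[measurable]: "poly q \<in> borel_measurable borel" for q :: "real poly"
      by (intro borel_measurable_continuous_onI continuous_intros)
    note D = B_distributed[OF s0]
    have i: "integrable M (\<lambda>\<omega>. poly (herm n * herm n) (?Z \<omega>))"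
      using distributed_integrable[OF D, of "poly (herm n * herm n)"] integrable_poly_std_normal[of "herm n * herm n"] by auto
    have E: "expectation (\<lambda>\<omega>. poly (herm n * herm n) (?Z \<omega>)) = \<kappa>"
      unfolding \<kappa>_def by (rule distributed_integral[OF D, symmetric]) auto
    have ae: "AE \<omega> in M. (chaos n s \<omega>)\<^sup>2 = (s powr H) ^ (2 * n) * poly (herm n * herm n) (?Z \<omega>)"
      using chaos_AE[OF s0, of n]
    proof eventually_elim
      case (elim \<omega>)
      have "(s powr H) ^ (2 * n) = (s powr H) ^ n * (s powr H) ^ n" by (simp add: mult_2 power_add)
      then show ?case by (simp add: elim power2_eq_square)
    qed
    have "integrable M (\<lambda>\<omega>. (chaos n s \<omega>)\<^sup>2)"
      by (subst integrable_cong_AE[OF _ _ ae]) (use i in auto)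
    moreover have "expectation (\<lambda>\<omega>. (chaos n s \<omega>)\<^sup>2) = (s powr H) ^ (2 * n) * \<kappa>"
      by (subst integral_cong_AE[OF _ _ ae]) (use E in auto)
    moreover have "(s powr H) ^ (2 * n) * \<kappa> \<le> (T powr H) ^ (2 * n) * \<kappa>"
      using s s0 Hurst \<kappa>0 by (intro mult_right_mono power_mono powr_mono2) auto
    ultimately show ?thesis by (simp add: K_def)
  qed
  show thesis by (rule that[of K]) (use main K0 in \<open>auto simp: K_def\<close>)
qed

lemma chaos_integrable: "0 \<le> s \<Longrightarrow> integrable M (chaos n s)"
  using chaos_second_moment[of s n] square_integrable_imp_integrable[OF chaos_measurable] by (metis order_refl)

lemma cylindrical_measurable:
  assumes "\<phi> \<in> Cb_infinity m" shows "cylindrical m \<phi> g \<in> borel_measurable M"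
  unfolding cylindrical_def[abs_def]
proof (rule measurable_compose[OF _ borel_measurable_continuous_onI[OF Cb_infinityD(1)[OF assms]]],
    rule measurable_coordinatewise_then_product)
  show "(\<lambda>\<omega>. if i < m then W (g i) \<omega> else 0) \<in> borel_measurable M" for i by (cases "i < m") auto
qed

lemma cylindrical_mult_integrable:
  assumes \<phi>: "\<phi> \<in> Cb_infinity m" and X: "integrable M X"
  shows "integrable M (\<lambda>\<omega>. cylindrical m \<phi> g \<omega> * X \<omega>)"
proof -
  obtain K where K: "\<And>x. \<bar>\<phi> x\<bar> \<le> K" using Cb_infinity_bound[OF \<phi>] by blast
  have [measurable]: "cylindrical m \<phi> g \<in> borel_measurable M" by (rule cylindrical_measurable[OF \<phi>])
  have [measurable]: "X \<in> borel_measurable M" using X by auto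
  show ?thesis
  proof (rule Bochner_Integration.integrable_bound[OF integrable_mult_right[OF X, of K]])
    show "AE \<omega> in M. norm (cylindrical m \<phi> g \<omega> * X \<omega>) \<le> norm (K * X \<omega>)"
      unfolding real_norm_def abs_mult cylindrical_def
      by (intro AE_I2 mult_right_mono order_trans[OF K abs_ge_self]) simp
  qed measurable
qed

lemma chaos_duality:
  assumes \<phi>: "\<phi> \<in> Cb_infinity m" and s: "0 \<le> s"
  shows "real (Suc n) * expectation (\<lambda>\<omega>. cylindrical m \<phi> g \<omega> * chaos (Suc n) s \<omega>)
    = (\<Sum>i<m. inner (g i) (ind_vec s) * expectation (\<lambda>\<omega>. cylindrical m (partial i \<phi>) g \<omega> * chaos n s \<omega>))"
proof (cases "s = 0")
  case True
  have "expectation (\<lambda>\<omega>. cylindrical m \<phi> g \<omega> * chaos (Suc n) s \<omega>) = 0"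
    unfolding True by (rule integral_eq_zero_AE) (use chaos_0_AE[of n] in \<open>auto elim!: eventually_mono\<close>)
  then show ?thesis by (simp add: True ind_vec_0)
next
  case False
  then have s0: "0 < s" using s by simp
  let ?\<sigma> = "s powr H"
  have [measurable]: "B s \<in> borel_measurable M" using s by (rule B_measurable)
  have pm[measurable]: "poly q \<in> borel_measurable borel" for q :: "real poly"
    by (intro borel_measurable_continuous_onI continuous_intros)
  have E: "expectation (\<lambda>\<omega>. cylindrical m \<psi> g \<omega> * chaos k s \<omega>)
      = ?\<sigma> ^ k * expectation (\<lambda>\<omega>. cylindrical m \<psi> g \<omega> * poly (herm k) (B s \<omega> / ?\<sigma>))"
    if \<psi>: "\<psi> \<in> Cb_infinity m" for \<psi> k
  proof -
    have [measurable]: "cylindrical m \<psi> g \<in> borel_measurable M" by (rule cylindrical_measurable[OF \<psi>])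
    have "expectation (\<lambda>\<omega>. cylindrical m \<psi> g \<omega> * chaos k s \<omega>)
        = expectation (\<lambda>\<omega>. ?\<sigma> ^ k * (cylindrical m \<psi> g \<omega> * poly (herm k) (B s \<omega> / ?\<sigma>)))"
      by (rule integral_cong_AE) (use chaos_AE[OF s0, of k] in \<open>auto elim!: eventually_mono\<close>)
    then show ?thesis by simp
  qed
  have "real (Suc n) * expectation (\<lambda>\<omega>. cylindrical m \<phi> g \<omega> * chaos (Suc n) s \<omega>)
    = ?\<sigma> ^ Suc n * (real (Suc n) * expectation (\<lambda>\<omega>. cylindrical m \<phi> g \<omega> * poly (herm (Suc n)) (B s \<omega> / ?\<sigma>)))"
    unfolding E[OF \<phi>] by simp
  also have "\<dots> = (\<Sum>i<m. ?\<sigma> ^ Suc n * (inner (g i) (ind_vec s) / ?\<sigma> *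
        expectation (\<lambda>\<omega>. cylindrical m (partial i \<phi>) g \<omega> * poly (herm n) (B s \<omega> / ?\<sigma>))))"
    unfolding hermite_duality_pos[OF \<phi> s0] sum_distrib_left ..
  also have "\<dots> = (\<Sum>i<m. inner (g i) (ind_vec s) * expectation (\<lambda>\<omega>. cylindrical m (partial i \<phi>) g \<omega> * chaos n s \<omega>))"
    using s0 by (intro sum.cong refl) (simp add: E[OF Cb_infinity_partial[OF \<phi>]])
  finally show ?thesis .
qed

text \<open>Each use of \<open>chaos_duality\<close> trades one order for a derivative of
  \<open>\<phi>\<close> and a factor \<open>inner (g i) (ind_vec s)\<close>, until only expectations
  of cylindrical variables remain.\<close>

lemma expectation_cylindrical_chaos:
  assumes "\<phi> \<in> Cb_infinity m" and s: "0 \<le> s"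
  shows "expectation (\<lambda>\<omega>. cylindrical m \<phi> g \<omega> * chaos n s \<omega>)
    = chaos_poly (\<lambda>\<psi>. expectation (cylindrical m \<psi> g)) m n \<phi> (\<lambda>i. inner (g i) (ind_vec s))"
  using assms(1)
proof (induction n arbitrary: \<phi>)
  case 0
  show ?case by (simp add: chaos_def)
next
  case (Suc n)
  have "real (Suc n) * expectation (\<lambda>\<omega>. cylindrical m \<phi> g \<omega> * chaos (Suc n) s \<omega>)
    = real (Suc n) * chaos_poly (\<lambda>\<psi>. expectation (cylindrical m \<psi> g)) m (Suc n) \<phi> (\<lambda>i. inner (g i) (ind_vec s))"
    unfolding chaos_duality[OF Suc.prems s] using Suc.IH[OF Cb_infinity_partial[OF Suc.prems]]
    by (simp del: of_nat_Suc)
  then show ?case by (rule mult_left_cancel[THEN iffD1, rotated]) simp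
qed

section \<open>Riemann sums of the integrand and their duality\<close>

definition riemann_vec :: "nat \<Rightarrow> real \<Rightarrow> nat \<Rightarrow> 'a \<Rightarrow> 'h" where
  "riemann_vec n t k \<omega> = step_vec (grid t k) (\<lambda>j. chaos n (grid t k j) \<omega>) (Suc k)"

definition chaos_integrand :: "nat \<Rightarrow> real \<Rightarrow> 'a \<Rightarrow> 'h" where
  "chaos_integrand n t \<omega> = lim (\<lambda>k. riemann_vec n t k \<omega>)"

lemma riemann_vec_tendsto:
  assumes t: "0 \<le> t" and \<omega>: "\<omega> \<in> space M"
  shows "(\<lambda>k. riemann_vec n t k \<omega>) \<longlonglongrightarrow> chaos_integrand n t \<omega>"
    and "represents (\<lambda>s. indicator {0..t} s * chaos n s \<omega>) (chaos_integrand n t \<omega>)"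
proof -
  have "continuous_on {0..t} (\<lambda>s. chaos n s \<omega>)" by (rule chaos_continuous[OF \<omega>]) auto
  then obtain h where h: "(\<lambda>k. riemann_vec n t k \<omega>) \<longlonglongrightarrow> h"
    "represents (\<lambda>s. indicator {0..t} s * chaos n s \<omega>) h"
    using riemann_sums_converge[OF t] unfolding riemann_vec_def by blast
  moreover have "chaos_integrand n t \<omega> = h" unfolding chaos_integrand_def by (rule limI[OF h(1)])
  ultimately show "(\<lambda>k. riemann_vec n t k \<omega>) \<longlonglongrightarrow> chaos_integrand n t \<omega>"
    "represents (\<lambda>s. indicator {0..t} s * chaos n s \<omega>) (chaos_integrand n t \<omega>)" by auto
qed

text \<open>\<open>'h\<close> need not be second countable, so sums of measurable vectors are handled as continuous
  images of sequences of real random variables.\<close>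

lemma riemann_vec_measurable [measurable]: "riemann_vec n t k \<in> borel_measurable M"
proof -
  have c: "continuous_on UNIV (\<lambda>c. step_vec (grid t k) c (Suc k))"
    unfolding step_vec_def
    by (intro continuous_intros continuous_on_product_then_coordinatewise[OF continuous_on_id, unfolded id_def])
  have "(\<lambda>\<omega>. \<lambda>j. chaos n (grid t k j) \<omega>) \<in> borel_measurable M"
    by (rule measurable_coordinatewise_then_product) measurable
  from measurable_compose[OF this borel_measurable_continuous_onI[OF c]]
  show ?thesis unfolding riemann_vec_def[abs_def] .
qed

lemma chaos_integrand_measurable: "0 \<le> t \<Longrightarrow> chaos_integrand n t \<in> borel_measurable M"
  by (rule borel_measurable_LIMSEQ_metric[OF riemann_vec_measurable riemann_vec_tendsto(1)])

text \<open>In the expanded norm the inner products of increments are nonnegative, so the mixed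
  moments of the coefficients may all be replaced by one bound \<open>K\<close>. With constant
  coefficients the increments telescope to \<open>ind_vec t\<close>, whose norm does not depend on
  the grid.\<close>

lemma riemann_vec_second_moment:
  assumes t: "0 \<le> t"
  obtains K where "\<And>k. integrable M (\<lambda>\<omega>. (norm (riemann_vec n t k \<omega>))\<^sup>2)"
    "\<And>k. expectation (\<lambda>\<omega>. (norm (riemann_vec n t k \<omega>))\<^sup>2) \<le> K"
proof -
  note g = grid[OF t]
  obtain K where K: "0 \<le> K" "\<And>s. 0 \<le> s \<Longrightarrow> s \<le> t \<Longrightarrow> integrable M (\<lambda>\<omega>. (chaos n s \<omega>)\<^sup>2)"
    "\<And>s. 0 \<le> s \<Longrightarrow> s \<le> t \<Longrightarrow> expectation (\<lambda>\<omega>. (chaos n s \<omega>)\<^sup>2) \<le> K"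
    using chaos_second_moment[of t n] by blast
  have main: "integrable M (\<lambda>\<omega>. (norm (riemann_vec n t k \<omega>))\<^sup>2) \<and>
    expectation (\<lambda>\<omega>. (norm (riemann_vec n t k \<omega>))\<^sup>2) \<le> K * (norm (ind_vec t))\<^sup>2" for k
  proof -
    define \<rho> where "\<rho> i j = inner (ind_vec (grid t k (Suc i)) - ind_vec (grid t k i)) (ind_vec (grid t k (Suc j)) - ind_vec (grid t k j))" for i j
    define c where "c j \<omega> = chaos n (grid t k j) \<omega>" for j \<omega>
    have [measurable]: "c j \<in> borel_measurable M" for j unfolding c_def[abs_def] by measurable
    have \<rho>0: "0 \<le> \<rho> i j" for i j
      unfolding \<rho>_def by (rule inner_increments_nonneg) (auto intro: g(3) monoD[OF g(1)])
    have c2: "integrable M (\<lambda>\<omega>. (c j \<omega>)\<^sup>2)" "expectation (\<lambda>\<omega>. (c j \<omega>)\<^sup>2) \<le> K" if "j < Suc k" for j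
      using K(2,3)[of "grid t k j"] g(3)[of k j] g(6)[of j k] that unfolding c_def by auto
    have cc: "integrable M (\<lambda>\<omega>. c i \<omega> * c j \<omega>)" if "i < Suc k" "j < Suc k" for i j
      by (rule integrable_mult_of_squares) (use c2 that in auto)
    have Ecc: "expectation (\<lambda>\<omega>. c i \<omega> * c j \<omega>) \<le> K" if ij: "i < Suc k" "j < Suc k" for i j
    proof -
      have "expectation (\<lambda>\<omega>. c i \<omega> * c j \<omega>) \<le> expectation (\<lambda>\<omega>. ((c i \<omega>)\<^sup>2 + (c j \<omega>)\<^sup>2) / 2)"
      proof (rule integral_mono[OF cc[OF ij]])
        show "integrable M (\<lambda>\<omega>. ((c i \<omega>)\<^sup>2 + (c j \<omega>)\<^sup>2) / 2)" using c2 ij by simp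
        show "c i \<omega> * c j \<omega> \<le> ((c i \<omega>)\<^sup>2 + (c j \<omega>)\<^sup>2) / 2" for \<omega>
          using zero_le_power2[of "c i \<omega> - c j \<omega>"] by (simp add: power2_diff)
      qed
      also have "\<dots> = (expectation (\<lambda>\<omega>. (c i \<omega>)\<^sup>2) + expectation (\<lambda>\<omega>. (c j \<omega>)\<^sup>2)) / 2"
        using c2 ij by simp
      finally show ?thesis using c2(2)[OF ij(1)] c2(2)[OF ij(2)] by simp
    qed
    have e: "(norm (riemann_vec n t k \<omega>))\<^sup>2 = (\<Sum>i<Suc k. \<Sum>j<Suc k. c i \<omega> * c j \<omega> * \<rho> i j)" for \<omega>
      unfolding riemann_vec_def norm_step_vec_sq c_def \<rho>_def ..
    have i: "integrable M (\<lambda>\<omega>. \<Sum>i<Suc k. \<Sum>j<Suc k. c i \<omega> * c j \<omega> * \<rho> i j)"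
      by (intro Bochner_Integration.integrable_sum integrable_mult_left cc) auto
    have "expectation (\<lambda>\<omega>. \<Sum>i<Suc k. \<Sum>j<Suc k. c i \<omega> * c j \<omega> * \<rho> i j)
        = (\<Sum>i<Suc k. \<Sum>j<Suc k. expectation (\<lambda>\<omega>. c i \<omega> * c j \<omega>) * \<rho> i j)"
    proof (subst Bochner_Integration.integral_sum)
      show "integrable M (\<lambda>\<omega>. \<Sum>j<Suc k. c i \<omega> * c j \<omega> * \<rho> i j)" if "i \<in> {..<Suc k}" for i
        using that by (intro Bochner_Integration.integrable_sum integrable_mult_left cc) auto
      show "(\<Sum>i<Suc k. expectation (\<lambda>\<omega>. \<Sum>j<Suc k. c i \<omega> * c j \<omega> * \<rho> i j))
        = (\<Sum>i<Suc k. \<Sum>j<Suc k. expectation (\<lambda>\<omega>. c i \<omega> * c j \<omega>) * \<rho> i j)"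
      proof (rule sum.cong[OF refl])
        fix i assume i: "i \<in> {..<Suc k}"
        have "expectation (\<lambda>\<omega>. \<Sum>j<Suc k. c i \<omega> * c j \<omega> * \<rho> i j) = (\<Sum>j<Suc k. expectation (\<lambda>\<omega>. c i \<omega> * c j \<omega> * \<rho> i j))"
          using i by (intro Bochner_Integration.integral_sum integrable_mult_left cc) auto
        then show "expectation (\<lambda>\<omega>. \<Sum>j<Suc k. c i \<omega> * c j \<omega> * \<rho> i j) = (\<Sum>j<Suc k. expectation (\<lambda>\<omega>. c i \<omega> * c j \<omega>) * \<rho> i j)"
          by simp
      qed
    qed
    also have "\<dots> \<le> (\<Sum>i<Suc k. \<Sum>j<Suc k. K * \<rho> i j)"
      by (intro sum_mono mult_right_mono Ecc \<rho>0) auto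
    also have "\<dots> = K * (\<Sum>i<Suc k. \<Sum>j<Suc k. 1 * 1 * \<rho> i j)" by (simp only: sum_distrib_left mult_1_left)
    also have "(\<Sum>i<Suc k. \<Sum>j<Suc k. 1 * 1 * \<rho> i j) = (norm (step_vec (grid t k) (\<lambda>_. 1) (Suc k)))\<^sup>2"
      unfolding norm_step_vec_sq \<rho>_def ..
    also have "step_vec (grid t k) (\<lambda>_. 1) (Suc k) = ind_vec t"
      using step_vec_const[where s = "grid t k" and N = "Suc k"] by (simp only: g(2,4))
    finally show ?thesis unfolding e using i by blast
  qed
  show thesis by (rule that[of "K * (norm (ind_vec t))\<^sup>2"]) (use main in auto)
qed

text \<open>Fatou's lemma carries the uniform bound over to the pathwise limit.\<close>

lemma chaos_integrand_square_integrable: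
  assumes t: "0 \<le> t"
  shows "square_integrable M (chaos_integrand n t)"
proof -
  have [measurable]: "chaos_integrand n t \<in> borel_measurable M" by (rule chaos_integrand_measurable[OF t])
  obtain K where K: "\<And>k. integrable M (\<lambda>\<omega>. (norm (riemann_vec n t k \<omega>))\<^sup>2)"
    "\<And>k. expectation (\<lambda>\<omega>. (norm (riemann_vec n t k \<omega>))\<^sup>2) \<le> K"
    using riemann_vec_second_moment[OF t] by blast
  have "(\<integral>\<^sup>+\<omega>. ennreal ((norm (chaos_integrand n t \<omega>))\<^sup>2) \<partial>M)
      = (\<integral>\<^sup>+\<omega>. liminf (\<lambda>k. ennreal ((norm (riemann_vec n t k \<omega>))\<^sup>2)) \<partial>M)"
  proof (rule nn_integral_cong)
    fix \<omega> assume "\<omega> \<in> space M"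
    then have "(\<lambda>k. ennreal ((norm (riemann_vec n t k \<omega>))\<^sup>2)) \<longlonglongrightarrow> ennreal ((norm (chaos_integrand n t \<omega>))\<^sup>2)"
      by (intro tendsto_ennrealI tendsto_intros riemann_vec_tendsto(1)[OF t])
    from lim_imp_Liminf[OF _ this]
    show "ennreal ((norm (chaos_integrand n t \<omega>))\<^sup>2) = liminf (\<lambda>k. ennreal ((norm (riemann_vec n t k \<omega>))\<^sup>2))" by simp
  qed
  also have "\<dots> \<le> liminf (\<lambda>k. \<integral>\<^sup>+\<omega>. ennreal ((norm (riemann_vec n t k \<omega>))\<^sup>2) \<partial>M)"
    by (rule nn_integral_liminf) measurable
  also have "\<dots> \<le> ennreal K"
  proof (rule Liminf_le)
    show "eventually (\<lambda>k. (\<integral>\<^sup>+\<omega>. ennreal ((norm (riemann_vec n t k \<omega>))\<^sup>2) \<partial>M) \<le> ennreal K) sequentially"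
      using K by (intro always_eventually allI) (auto simp: nn_integral_eq_integral intro!: ennreal_leI)
  qed simp
  also have "\<dots> < \<infinity>" by simp
  finally show ?thesis unfolding square_integrable_def by (auto intro!: integrableI_nonneg)
qed

lemma inner_malliavin:
  "inner (malliavin_derivative m \<phi> g \<omega>) v = (\<Sum>i<m. cylindrical m (partial i \<phi>) g \<omega> * inner (g i) v)"
  by (simp add: malliavin_derivative_def cylindrical_def inner_sum_left)

lemma inner_malliavin_measurable:
  assumes \<phi>: "\<phi> \<in> Cb_infinity m" and [measurable]: "U \<in> borel_measurable M"
  shows "(\<lambda>\<omega>. inner (malliavin_derivative m \<phi> g \<omega>) (U \<omega>)) \<in> borel_measurable M"
  unfolding inner_malliavin
proof (intro borel_measurable_sum borel_measurable_times)
  fix i assume "i \<in> {..<m}"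
  then show "cylindrical m (partial i \<phi>) g \<in> borel_measurable M"
    by (intro cylindrical_measurable Cb_infinity_partial \<phi>) simp
  have "continuous_on UNIV (\<lambda>v. inner (g i) v)" by (intro continuous_intros)
  from measurable_compose[OF \<open>U \<in> borel_measurable M\<close> borel_measurable_continuous_onI[OF this]]
  show "(\<lambda>\<omega>. inner (g i) (U \<omega>)) \<in> borel_measurable M" .
qed

lemma malliavin_derivative_bounded:
  assumes \<phi>: "\<phi> \<in> Cb_infinity m"
  obtains C where "0 \<le> C" "\<And>\<omega>. norm (malliavin_derivative m \<phi> g \<omega>) \<le> C"
proof -
  have "\<forall>i. \<exists>K\<ge>0. i < m \<longrightarrow> (\<forall>x. \<bar>partial i \<phi> x\<bar> \<le> K)"
    using Cb_infinity_bound[OF Cb_infinity_partial[OF \<phi>]] by (metis less_imp_le order_refl)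
  then obtain K where K: "\<And>i. 0 \<le> K i" "\<And>i x. i < m \<Longrightarrow> \<bar>partial i \<phi> x\<bar> \<le> K i" by metis
  show thesis
  proof (rule that)
    show "0 \<le> (\<Sum>i<m. K i * norm (g i))" using K(1) by (intro sum_nonneg) auto
    show "norm (malliavin_derivative m \<phi> g \<omega>) \<le> (\<Sum>i<m. K i * norm (g i))" for \<omega>
      unfolding malliavin_derivative_def
      by (rule order_trans[OF norm_sum]) (auto intro!: sum_mono mult_right_mono K(2))
  qed
qed

lemma expectation_inner_riemann_vec:
  fixes g :: "nat \<Rightarrow> 'h"
  assumes \<phi>: "\<phi> \<in> Cb_infinity m" and t: "0 \<le> t"
  defines "A \<equiv> chaos_poly (\<lambda>\<psi>. expectation (cylindrical m \<psi> g)) m"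
    and "G \<equiv> \<lambda>s i. inner (g i) (ind_vec s)"
  shows "expectation (\<lambda>\<omega>. inner (malliavin_derivative m \<phi> g \<omega>) (riemann_vec n t k \<omega>))
    = (\<Sum>j<Suc k. \<Sum>i<m. A n (partial i \<phi>) (G (grid t k j)) * (G (grid t k (Suc j)) i - G (grid t k j) i))"
proof -
  note g = grid[OF t]
  let ?s = "grid t k"
  have e: "inner (malliavin_derivative m \<phi> g \<omega>) (riemann_vec n t k \<omega>)
    = (\<Sum>j<Suc k. \<Sum>i<m. (cylindrical m (partial i \<phi>) g \<omega> * chaos n (?s j) \<omega>) * (G (?s (Suc j)) i - G (?s j) i))" for \<omega>
    unfolding inner_malliavin riemann_vec_def step_vec_def inner_sum_right sum_distrib_left G_def
    by (intro sum.cong refl) (simp add: inner_diff_right mult.assoc)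
  have i: "integrable M (\<lambda>\<omega>. (cylindrical m (partial i \<phi>) g \<omega> * chaos n (?s j) \<omega>) * (G (?s (Suc j)) i - G (?s j) i))"
    if "i < m" for i j
    by (intro integrable_mult_left cylindrical_mult_integrable Cb_infinity_partial \<phi> that chaos_integrable g)
  have "expectation (\<lambda>\<omega>. inner (malliavin_derivative m \<phi> g \<omega>) (riemann_vec n t k \<omega>))
    = (\<Sum>j<Suc k. expectation (\<lambda>\<omega>. \<Sum>i<m. (cylindrical m (partial i \<phi>) g \<omega> * chaos n (?s j) \<omega>) * (G (?s (Suc j)) i - G (?s j) i)))"
    unfolding e by (intro Bochner_Integration.integral_sum Bochner_Integration.integrable_sum i) auto
  also have "\<dots> = (\<Sum>j<Suc k. \<Sum>i<m. expectation (\<lambda>\<omega>. (cylindrical m (partial i \<phi>) g \<omega> * chaos n (?s j) \<omega>) * (G (?s (Suc j)) i - G (?s j) i)))"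
    by (intro sum.cong refl Bochner_Integration.integral_sum i) auto
  also have "\<dots> = (\<Sum>j<Suc k. \<Sum>i<m. A n (partial i \<phi>) (G (?s j)) * (G (?s (Suc j)) i - G (?s j) i))"
  proof (intro sum.cong refl)
    fix i j assume "i \<in> {..<m}"
    then have "expectation (\<lambda>\<omega>. cylindrical m (partial i \<phi>) g \<omega> * chaos n (?s j) \<omega>) = A n (partial i \<phi>) (G (?s j))"
      unfolding A_def G_def by (intro expectation_cylindrical_chaos Cb_infinity_partial \<phi> g) simp
    then show "expectation (\<lambda>\<omega>. (cylindrical m (partial i \<phi>) g \<omega> * chaos n (?s j) \<omega>) * (G (?s (Suc j)) i - G (?s j) i))
      = A n (partial i \<phi>) (G (?s j)) * (G (?s (Suc j)) i - G (?s j) i)" by simp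
  qed
  finally show ?thesis .
qed

lemma riemann_sums_tendsto_chaos:
  assumes \<phi>: "\<phi> \<in> Cb_infinity m" and t: "0 \<le> t"
  shows "(\<lambda>k. expectation (\<lambda>\<omega>. inner (malliavin_derivative m \<phi> g \<omega>) (riemann_vec n t k \<omega>)))
    \<longlonglongrightarrow> expectation (\<lambda>\<omega>. cylindrical m \<phi> g \<omega> * chaos (Suc n) t \<omega>)"
proof -
  define A where "A = chaos_poly (\<lambda>\<psi>. expectation (cylindrical m \<psi> g)) m"
  define G where "G s i = inner (g i) (ind_vec s)" for s i
  define S where "S = (\<Sum>i<m. norm (g i))"
  have S0: "0 \<le> S" unfolding S_def by (intro sum_nonneg) auto
  define R where "R = S * t powr H"
  have Gbound: "\<forall>i<m. \<bar>G s i\<bar> \<le> R" if s: "0 \<le> s" "s \<le> t" for s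
  proof (intro allI impI)
    fix i assume i: "i < m"
    have "\<bar>G s i\<bar> \<le> norm (g i) * norm (ind_vec s)" unfolding G_def by (rule Cauchy_Schwarz_ineq2)
    also have "\<dots> \<le> S * t powr H"
    proof (rule mult_mono)
      show "norm (g i) \<le> S" unfolding S_def using i by (intro member_le_sum) auto
      show "norm (ind_vec s) \<le> t powr H" unfolding norm_ind_vec[OF s(1)] using s Hurst by (intro powr_mono2) auto
    qed (use S0 in auto)
    finally show "\<bar>G s i\<bar> \<le> R" by (simp add: R_def)
  qed
  obtain C where C: "0 \<le> C" "\<And>v w. \<forall>i<m. \<bar>v i\<bar> \<le> R \<Longrightarrow> \<forall>i<m. \<bar>w i\<bar> \<le> R \<Longrightarrow>
    \<bar>A (Suc n) \<phi> w - A (Suc n) \<phi> v - (\<Sum>i<m. A n (partial i \<phi>) v * (w i - v i))\<bar> \<le> C * (\<Sum>i<m. \<bar>w i - v i\<bar>)\<^sup>2"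
    using chaos_poly_expansion[OF \<phi>, of R "\<lambda>\<psi>. expectation (cylindrical m \<psi> g)" n] unfolding A_def by blast
  have EA: "expectation (\<lambda>\<omega>. cylindrical m \<phi> g \<omega> * chaos (Suc n) t \<omega>) = A (Suc n) \<phi> (G t)"
    unfolding A_def G_def[abs_def] by (rule expectation_cylindrical_chaos[OF \<phi> t])
  \<comment> \<open>Every term of positive order carries a factor \<open>G 0 i\<close>, which
    vanishes since \<open>ind_vec 0 = 0\<close>; the telescoping sum therefore starts from
    \<open>0\<close>.\<close>
  have A0: "A (Suc n) \<phi> (G 0) = 0" unfolding A_def by (simp add: G_def ind_vec_0)
  have bound: "\<bar>expectation (\<lambda>\<omega>. inner (malliavin_derivative m \<phi> g \<omega>) (riemann_vec n t k \<omega>)) - A (Suc n) \<phi> (G t)\<bar>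
      \<le> C * (S * t powr H)\<^sup>2 * real (Suc k) powr (1 - 2 * H)" for k
  proof -
    note gr = grid[OF t]
    let ?s = "grid t k"
    have "A (Suc n) \<phi> (G t) = (\<Sum>j<Suc k. A (Suc n) \<phi> (G (?s (Suc j))) - A (Suc n) \<phi> (G (?s j)))"
      unfolding sum_lessThan_telescope[of "\<lambda>j. A (Suc n) \<phi> (G (?s j))"] gr(2,4) A0 by simp
    then have "\<bar>expectation (\<lambda>\<omega>. inner (malliavin_derivative m \<phi> g \<omega>) (riemann_vec n t k \<omega>)) - A (Suc n) \<phi> (G t)\<bar>
      = \<bar>\<Sum>j<Suc k. A (Suc n) \<phi> (G (?s (Suc j))) - A (Suc n) \<phi> (G (?s j))
          - (\<Sum>i<m. A n (partial i \<phi>) (G (?s j)) * (G (?s (Suc j)) i - G (?s j) i))\<bar>"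
      unfolding expectation_inner_riemann_vec[OF \<phi> t, where g = g, folded A_def] G_def[symmetric] sum_subtractf
      by (simp only: abs_minus_commute)
    also have "\<dots> \<le> (\<Sum>j<Suc k. C * (S * (t / real (Suc k)) powr H)\<^sup>2)"
    proof (rule order_trans[OF sum_abs], rule sum_mono)
      fix j assume "j \<in> {..<Suc k}"
      then have j: "j \<le> Suc k" "Suc j \<le> Suc k" by auto
      have "\<bar>G (?s (Suc j)) i - G (?s j) i\<bar> \<le> norm (g i) * (t / real (Suc k)) powr H" for i
      proof -
        have "G (?s (Suc j)) i - G (?s j) i = inner (g i) (ind_vec (?s (Suc j)) - ind_vec (?s j))"
          by (simp add: G_def inner_diff_right)
        then have "\<bar>G (?s (Suc j)) i - G (?s j) i\<bar> \<le> norm (g i) * norm (ind_vec (?s (Suc j)) - ind_vec (?s j))"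
          using Cauchy_Schwarz_ineq2 by metis
        also have "norm (ind_vec (?s (Suc j)) - ind_vec (?s j)) = (t / real (Suc k)) powr H"
          unfolding norm_ind_vec_diff[OF gr(3) gr(3)] using t by (simp add: gr(5) del: of_nat_Suc)
        finally show ?thesis .
      qed
      then have "(\<Sum>i<m. \<bar>G (?s (Suc j)) i - G (?s j) i\<bar>) \<le> S * (t / real (Suc k)) powr H"
        unfolding S_def sum_distrib_right by (rule sum_mono)
      then have "(\<Sum>i<m. \<bar>G (?s (Suc j)) i - G (?s j) i\<bar>)\<^sup>2 \<le> (S * (t / real (Suc k)) powr H)\<^sup>2"
        by (intro power_mono sum_nonneg) auto
      then have "C * (\<Sum>i<m. \<bar>G (?s (Suc j)) i - G (?s j) i\<bar>)\<^sup>2 \<le> C * (S * (t / real (Suc k)) powr H)\<^sup>2"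
        using C(1) by (rule mult_left_mono)
      moreover have "\<bar>A (Suc n) \<phi> (G (?s (Suc j))) - A (Suc n) \<phi> (G (?s j))
          - (\<Sum>i<m. A n (partial i \<phi>) (G (?s j)) * (G (?s (Suc j)) i - G (?s j) i))\<bar>
          \<le> C * (\<Sum>i<m. \<bar>G (?s (Suc j)) i - G (?s j) i\<bar>)\<^sup>2"
        by (rule C(2); intro Gbound gr(3) gr(6) j)
      ultimately show "\<bar>A (Suc n) \<phi> (G (?s (Suc j))) - A (Suc n) \<phi> (G (?s j))
          - (\<Sum>i<m. A n (partial i \<phi>) (G (?s j)) * (G (?s (Suc j)) i - G (?s j) i))\<bar>
          \<le> C * (S * (t / real (Suc k)) powr H)\<^sup>2" by linarith
    qed
    \<comment> \<open>There are \<open>k + 1\<close> cells with an error of order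
      \<open>(k + 1)^(- 2 H)\<close> each, so \<open>(k + 1)^(1 - 2 H)\<close> remains.\<close>
    also have "\<dots> = real (Suc k) * (C * (S * (t powr H / real (Suc k) powr H))\<^sup>2)"
      using t by (simp add: powr_divide)
    also have "\<dots> = C * (S * t powr H)\<^sup>2 * (real (Suc k) powr 1 / (real (Suc k) powr H * real (Suc k) powr H))"
      by (simp add: power2_eq_square field_simps del: of_nat_Suc)
    also have "real (Suc k) powr 1 / (real (Suc k) powr H * real (Suc k) powr H) = real (Suc k) powr (1 - 2 * H)"
      by (simp add: powr_diff powr_add[symmetric] del: of_nat_Suc powr_one)
    finally show ?thesis .
  qed
  have "(\<lambda>k. C * (S * t powr H)\<^sup>2 * real (Suc k) powr (1 - 2 * H)) \<longlonglongrightarrow> 0"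
  proof (rule tendsto_mult_right_zero)
    have "1 - 2 * H < 0" using H_gt_half by simp
    then show "(\<lambda>k. real (Suc k) powr (1 - 2 * H)) \<longlonglongrightarrow> 0" by real_asymp
  qed
  then have "(\<lambda>k. expectation (\<lambda>\<omega>. inner (malliavin_derivative m \<phi> g \<omega>) (riemann_vec n t k \<omega>)) - A (Suc n) \<phi> (G t)) \<longlonglongrightarrow> 0"
  proof (rule Lim_null_comparison[rotated])
    show "eventually (\<lambda>k. norm (expectation (\<lambda>\<omega>. inner (malliavin_derivative m \<phi> g \<omega>) (riemann_vec n t k \<omega>)) - A (Suc n) \<phi> (G t))
        \<le> C * (S * t powr H)\<^sup>2 * real (Suc k) powr (1 - 2 * H)) sequentially"
      unfolding real_norm_def by (rule always_eventually, rule allI, rule bound)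
  qed
  then show ?thesis unfolding EA by (rule LIM_zero_cancel)
qed

text \<open>Two limits of one sequence of expectations: convergence along paths with bounded second
  moments gives the right-hand side, the Taylor expansion gives the left-hand side.\<close>

lemma divergence_duality:
  assumes \<phi>: "\<phi> \<in> Cb_infinity m" and t: "0 \<le> t"
  shows "expectation (\<lambda>\<omega>. cylindrical m \<phi> g \<omega> * chaos (Suc n) t \<omega>)
    = expectation (\<lambda>\<omega>. inner (malliavin_derivative m \<phi> g \<omega>) (chaos_integrand n t \<omega>))"
proof -
  obtain C where C: "0 \<le> C" "\<And>\<omega>. norm (malliavin_derivative m \<phi> g \<omega>) \<le> C"
    using malliavin_derivative_bounded[OF \<phi>] by blast
  obtain K where K: "\<And>k. integrable M (\<lambda>\<omega>. (norm (riemann_vec n t k \<omega>))\<^sup>2)"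
    "\<And>k. expectation (\<lambda>\<omega>. (norm (riemann_vec n t k \<omega>))\<^sup>2) \<le> K"
    using riemann_vec_second_moment[OF t] by blast
  have sqle: "(inner (malliavin_derivative m \<phi> g \<omega>) v)\<^sup>2 \<le> C\<^sup>2 * (norm v)\<^sup>2" for \<omega> v
  proof -
    have "\<bar>inner (malliavin_derivative m \<phi> g \<omega>) v\<bar> \<le> C * norm v"
      by (rule order_trans[OF Cauchy_Schwarz_ineq2]) (intro mult_right_mono C norm_ge_zero)
    then have "\<bar>inner (malliavin_derivative m \<phi> g \<omega>) v\<bar>\<^sup>2 \<le> (C * norm v)\<^sup>2" by (intro power_mono) auto
    then show ?thesis by (simp add: power_mult_distrib)
  qed
  have m1: "(\<lambda>\<omega>. inner (malliavin_derivative m \<phi> g \<omega>) (riemann_vec n t k \<omega>)) \<in> borel_measurable M" for k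
    by (rule inner_malliavin_measurable[OF \<phi> riemann_vec_measurable])
  have m2: "(\<lambda>\<omega>. inner (malliavin_derivative m \<phi> g \<omega>) (chaos_integrand n t \<omega>)) \<in> borel_measurable M"
    by (rule inner_malliavin_measurable[OF \<phi> chaos_integrand_measurable[OF t]])
  have sqi: "integrable M (\<lambda>\<omega>. (inner (malliavin_derivative m \<phi> g \<omega>) (V \<omega>))\<^sup>2)"
    if "integrable M (\<lambda>\<omega>. (norm (V \<omega>))\<^sup>2)" "(\<lambda>\<omega>. inner (malliavin_derivative m \<phi> g \<omega>) (V \<omega>)) \<in> borel_measurable M" for V
    by (rule Bochner_Integration.integrable_bound[OF integrable_mult_right[OF that(1), of "C\<^sup>2"]])
      (use that(2) sqle in \<open>auto simp: abs_mult\<close>)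
  have "(\<lambda>k. expectation (\<lambda>\<omega>. inner (malliavin_derivative m \<phi> g \<omega>) (riemann_vec n t k \<omega>)))
    \<longlonglongrightarrow> expectation (\<lambda>\<omega>. inner (malliavin_derivative m \<phi> g \<omega>) (chaos_integrand n t \<omega>))"
  proof (rule expectation_tendsto_bounded_moments[OF m1 m2])
    show "integrable M (\<lambda>\<omega>. (inner (malliavin_derivative m \<phi> g \<omega>) (riemann_vec n t k \<omega>))\<^sup>2)" for k
      by (rule sqi[OF K(1) m1])
    show "integrable M (\<lambda>\<omega>. (inner (malliavin_derivative m \<phi> g \<omega>) (chaos_integrand n t \<omega>))\<^sup>2)"
      by (rule sqi[OF _ m2]) (use chaos_integrand_square_integrable[OF t] in \<open>simp add: square_integrable_def\<close>)
    show "expectation (\<lambda>\<omega>. (inner (malliavin_derivative m \<phi> g \<omega>) (riemann_vec n t k \<omega>))\<^sup>2) \<le> C\<^sup>2 * K" for k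
    proof -
      have "expectation (\<lambda>\<omega>. (inner (malliavin_derivative m \<phi> g \<omega>) (riemann_vec n t k \<omega>))\<^sup>2)
          \<le> expectation (\<lambda>\<omega>. C\<^sup>2 * (norm (riemann_vec n t k \<omega>))\<^sup>2)"
        by (intro integral_mono sqi[OF K(1) m1] integrable_mult_right K(1) sqle)
      also have "\<dots> \<le> C\<^sup>2 * K" using K(2)[of k] by (simp add: mult_left_mono)
      finally show ?thesis .
    qed
    show "(\<lambda>k. inner (malliavin_derivative m \<phi> g \<omega>) (riemann_vec n t k \<omega>))
        \<longlonglongrightarrow> inner (malliavin_derivative m \<phi> g \<omega>) (chaos_integrand n t \<omega>)" if "\<omega> \<in> space M" for \<omega>
      by (intro tendsto_intros riemann_vec_tendsto(1)[OF t that])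
  qed
  then show ?thesis using riemann_sums_tendsto_chaos[OF \<phi> t] by (rule LIMSEQ_unique[rotated])
qed

section \<open>The candidate satisfies the recursion\<close>

lemma space_sigma_B: "space sigma_B = space M"
  unfolding sigma_B_def by (rule space_measure_of) auto

lemma B_sigma_B: assumes "0 \<le> t" shows "B t \<in> borel_measurable sigma_B"
proof (rule measurableI)
  fix A :: "real set" assume "A \<in> sets borel"
  then have "B t -` A \<inter> space M \<in> sets sigma_B"
    unfolding sigma_B_def using assms by (intro in_measure_of) auto
  then show "B t -` A \<inter> space sigma_B \<in> sets sigma_B" by (simp only: space_sigma_B)
qed simp

lemma chaos_is_divergence:
  assumes t: "0 \<le> t"
  shows "is_divergence (chaos_integrand n t) (chaos (Suc n) t)"
  unfolding is_divergence_def
proof (intro conjI allI ballI)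
  show "square_integrable M (chaos_integrand n t)" by (rule chaos_integrand_square_integrable[OF t])
  show "square_integrable M (chaos (Suc n) t)"
    using chaos_second_moment[of t "Suc n"] t unfolding square_integrable_def by (auto simp del: herm_var.simps)
  \<comment> \<open>The version uses \<open>B\<close> itself, because the exceptional set in
    \<open>continuous_B\<close> need not belong to \<open>sigma_B\<close>.\<close>
  have "(\<lambda>\<omega>. herm_var (Suc n) (B t \<omega>) (t powr (2 * H))) \<in> borel_measurable sigma_B"
    using B_sigma_B[OF t] by measurable
  moreover have "AE \<omega> in M. chaos (Suc n) t \<omega> = herm_var (Suc n) (B t \<omega>) (t powr (2 * H))"
    using continuous_B_AE[OF t] by eventually_elim (simp add: chaos_def del: herm_var.simps)
  ultimately show "\<exists>Y\<in>borel_measurable sigma_B. AE \<omega> in M. chaos (Suc n) t \<omega> = Y \<omega>"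
    by (rule bexI[of _ "\<lambda>\<omega>. herm_var (Suc n) (B t \<omega>) (t powr (2 * H))", rotated])
qed (rule divergence_duality[OF _ t])

lemma chaos_iterated: "iterated_fWIS chaos"
  unfolding iterated_fWIS_def is_fWIS_integral_def
proof (intro conjI allI impI)
  fix n and t :: real assume t: "0 \<le> t"
  show "(\<lambda>(s, \<omega>). indicator {0..t} s * chaos n s \<omega>) \<in> borel_measurable (lborel \<Otimes>\<^sub>M M)"
    unfolding case_prod_beta' using chaos_joint_measurable[of n] by measurable
  show "\<exists>U. (AE \<omega> in M. represents (\<lambda>s. indicator {0..t} s * chaos n s \<omega>) (U \<omega>)) \<and> is_divergence U (chaos (Suc n) t)"
    by (intro exI[of _ "chaos_integrand n t"] conjI chaos_is_divergence[OF t] AE_I2 riemann_vec_tendsto(2)[OF t])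
qed (simp add: chaos_def)

end

section \<open>Uniqueness of the iterated integrals\<close>

context regular_fbm begin

definition cylinder_sets :: "'a set set" where
  "cylinder_sets = {{\<omega> \<in> space M. \<forall>s\<in>J. B s \<omega> \<in> A s} | J A. finite J \<and> J \<subseteq> {0..} \<and> (\<forall>s. A s \<in> sets borel)}"

lemma cylinder_sets_Pow: "cylinder_sets \<subseteq> Pow (space M)"
  by (auto simp: cylinder_sets_def)

lemma Int_stable_cylinder_sets: "Int_stable cylinder_sets"
proof (rule Int_stableI)
  fix a b assume "a \<in> cylinder_sets" "b \<in> cylinder_sets"
  then obtain J A J' A' where a: "a = {\<omega> \<in> space M. \<forall>s\<in>J. B s \<omega> \<in> A s}" "finite J" "J \<subseteq> {0..}" "\<forall>s. A s \<in> sets borel"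
    and b: "b = {\<omega> \<in> space M. \<forall>s\<in>J'. B s \<omega> \<in> A' s}" "finite J'" "J' \<subseteq> {0..}" "\<forall>s. A' s \<in> sets borel"
    unfolding cylinder_sets_def by auto
  define A'' where "A'' s = (if s \<in> J then A s else UNIV) \<inter> (if s \<in> J' then A' s else UNIV)" for s
  have "a \<inter> b = {\<omega> \<in> space M. \<forall>s\<in>J \<union> J'. B s \<omega> \<in> A'' s}"
    unfolding a(1) b(1) A''_def by auto
  moreover have "\<forall>s. A'' s \<in> sets borel" unfolding A''_def using a(4) b(4) by auto
  ultimately show "a \<inter> b \<in> cylinder_sets"
    unfolding cylinder_sets_def using a b by (intro CollectI exI[of _ "J \<union> J'"] exI[of _ A'']) auto
qed

lemma sets_sigma_B_eq:
  "sets sigma_B = sigma_sets (space M) {B t -` A \<inter> space M | t A. 0 \<le> t \<and> A \<in> sets borel}"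
  unfolding sigma_B_def by (rule sets_measure_of) auto

lemma sets_sigma_B_subset: "sets sigma_B \<subseteq> sigma_sets (space M) cylinder_sets"
proof -
  have "B t -` A \<inter> space M \<in> cylinder_sets" if "0 \<le> t" "A \<in> sets borel" for t A
    unfolding cylinder_sets_def using that
    by (intro CollectI exI[of _ "{t}"] exI[of _ "\<lambda>_. A"]) auto
  then have "{B t -` A \<inter> space M | t A. 0 \<le> t \<and> A \<in> sets borel} \<subseteq> sigma_sets (space M) cylinder_sets"
    by auto
  then show ?thesis unfolding sets_sigma_B_eq by (rule sigma_sets_mono)
qed

lemma sets_sigma_B: "sets sigma_B \<subseteq> sets M"
proof -
  have "B t -` A \<inter> space M \<in> sets M" if "0 \<le> t" "A \<in> sets borel" for t A
    using measurable_sets[OF B_measurable[OF that(1)] that(2)] .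
  then show ?thesis unfolding sets_sigma_B_eq by (intro sets.sigma_sets_subset) auto
qed

lemma sigma_B_measurable: "f \<in> borel_measurable sigma_B \<Longrightarrow> f \<in> borel_measurable M"
  using sets_sigma_B space_sigma_B by (auto simp: measurable_def)

text \<open>Cosines of finite combinations of the \<open>B s\<close> are, up to null sets,
  cylindrical variables over the vectors \<open>ind_vec s\<close>. Orthogonality to them is the
  hypothesis of the multidimensional uniqueness lemma, which delivers the indicators.\<close>

lemma expectation_cylinder_zero:
  assumes d: "integrable M d"
    and orth: "\<And>m g \<phi>. \<phi> \<in> Cb_infinity m \<Longrightarrow> expectation (\<lambda>\<omega>. cylindrical m \<phi> g \<omega> * d \<omega>) = 0"
    and C: "C \<in> cylinder_sets"
  shows "expectation (\<lambda>\<omega>. d \<omega> * indicator C \<omega>) = 0"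
proof -
  have [measurable]: "d \<in> borel_measurable M" using d by auto
  obtain J A where C: "C = {\<omega> \<in> space M. \<forall>s\<in>J. B s \<omega> \<in> A s}" and J: "finite J" "J \<subseteq> {0..}" and A: "\<forall>s. A s \<in> sets borel"
    using C unfolding cylinder_sets_def by auto
  obtain e where e: "bij_betw e {0..<card J} J" using ex_bij_betw_nat_finite[OF J(1)] by blast
  let ?d = "card J"
  have e0: "0 \<le> e i" if "i < ?d" for i
    using bij_betwE[OF e] J(2) that by fastforce
  have Bm: "B (e i) \<in> borel_measurable M" if "i < ?d" for i by (rule B_measurable[OF e0[OF that]])
  have "expectation (\<lambda>\<omega>. d \<omega> * (\<Prod>i<?d. indicator (A (e i)) (B (e i) \<omega>))) = 0"
  proof (rule multidim_fourier_uniqueness[OF Bm d])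
    fix u :: "nat \<Rightarrow> real" and \<theta>
    let ?\<phi> = "\<lambda>x. cos (\<theta> + (\<Sum>i<?d. u i * x i))"
    have [measurable]: "(\<lambda>\<omega>. \<Sum>i<?d. u i * B (e i) \<omega>) \<in> borel_measurable M"
      by (intro borel_measurable_sum borel_measurable_times Bm) auto
    have [measurable]: "cylindrical ?d ?\<phi> (\<lambda>i. ind_vec (e i)) \<in> borel_measurable M"
      by (rule cylindrical_measurable[OF cos_Cb_infinity])
    have "AE \<omega> in M. \<forall>i\<in>{..<?d}. W (ind_vec (e i)) \<omega> = B (e i) \<omega>"
      using W_ind_vec e0 by (intro AE_finite_allI) auto
    then have "AE \<omega> in M. d \<omega> * cos (\<theta> + (\<Sum>i<?d. u i * B (e i) \<omega>)) = cylindrical ?d ?\<phi> (\<lambda>i. ind_vec (e i)) \<omega> * d \<omega>"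
      by eventually_elim (simp add: cylindrical_def)
    then have "expectation (\<lambda>\<omega>. d \<omega> * cos (\<theta> + (\<Sum>i<?d. u i * B (e i) \<omega>)))
        = expectation (\<lambda>\<omega>. cylindrical ?d ?\<phi> (\<lambda>i. ind_vec (e i)) \<omega> * d \<omega>)"
      by (intro integral_cong_AE) measurable
    then show "expectation (\<lambda>\<omega>. d \<omega> * cos (\<theta> + (\<Sum>i<?d. u i * B (e i) \<omega>))) = 0"
      using orth[OF cos_Cb_infinity] by simp
  qed (use A in auto)
  moreover have "(\<Prod>i<?d. indicator (A (e i)) (B (e i) \<omega>)) = (indicator C \<omega> :: real)" if "\<omega> \<in> space M" for \<omega>
  proof -
    have "(\<Prod>i<?d. indicator (A (e i)) (B (e i) \<omega>)) = (\<Prod>s\<in>J. indicator (A s) (B s \<omega>) :: real)"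
      using prod.reindex_bij_betw[OF e, of "\<lambda>s. indicator (A s) (B s \<omega>) :: real"] by (simp add: lessThan_atLeast0)
    also have "\<dots> = indicator C \<omega>"
    proof (cases "\<forall>s\<in>J. B s \<omega> \<in> A s")
      case True
      then have "(\<Prod>s\<in>J. indicator (A s) (B s \<omega>) :: real) = 1" by (intro prod.neutral) auto
      then show ?thesis using True that by (simp add: C)
    next
      case False
      then have "(\<Prod>s\<in>J. indicator (A s) (B s \<omega>) :: real) = 0" using J(1) by (intro prod_zero) (auto simp: indicator_def)
      then show ?thesis using False by (simp add: C)
    qed
    finally show ?thesis .
  qed
  then have "expectation (\<lambda>\<omega>. d \<omega> * (\<Prod>i<?d. indicator (A (e i)) (B (e i) \<omega>))) = expectation (\<lambda>\<omega>. d \<omega> * indicator C \<omega>)"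
    by (intro Bochner_Integration.integral_cong refl) simp
  ultimately show ?thesis by simp
qed

text \<open>Cylinder sets are stable under intersection and generate \<open>sigma_B\<close>, and the
  sets on which the integral of \<open>d\<close> vanishes form a Dynkin system.\<close>

lemma expectation_sigma_B_zero:
  assumes d: "integrable M d"
    and orth: "\<And>m g \<phi>. \<phi> \<in> Cb_infinity m \<Longrightarrow> expectation (\<lambda>\<omega>. cylindrical m \<phi> g \<omega> * d \<omega>) = 0"
    and S: "S \<in> sets sigma_B"
  shows "expectation (\<lambda>\<omega>. d \<omega> * indicator S \<omega>) = 0"
proof -
  have [measurable]: "d \<in> borel_measurable M" using d by auto
  have cyl: "cylinder_sets \<subseteq> sets M"
  proof
    fix C assume "C \<in> cylinder_sets"
    then obtain J A where C: "C = {\<omega> \<in> space M. \<forall>s\<in>J. B s \<omega> \<in> A s}" "finite J" "J \<subseteq> {0..}" "\<forall>s. A s \<in> sets borel"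
      unfolding cylinder_sets_def by auto
    show "C \<in> sets M" unfolding C(1)
    proof (rule sets.sets_Collect_finite_All[OF _ C(2)])
      fix s assume "s \<in> J"
      then have "B s -` A s \<inter> space M \<in> sets M"
        using measurable_sets[OF B_measurable[of s], of "A s"] C(3,4) by auto
      moreover have "B s -` A s \<inter> space M = {\<omega> \<in> space M. B s \<omega> \<in> A s}" by auto
      ultimately show "{\<omega> \<in> space M. B s \<omega> \<in> A s} \<in> sets M" by simp
    qed
  qed
  have sm: "a \<in> sets M" if "a \<in> sigma_sets (space M) cylinder_sets" for a
    using sets.sigma_sets_subset[OF cyl] that by auto
  have i: "integrable M (\<lambda>\<omega>. d \<omega> * indicator a \<omega>)" if "a \<in> sets M" for a
    using integrable_mult_indicator[OF that d] by (simp add: mult.commute)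
  \<comment> \<open>The cylinder over no times at all is the whole space; this gives
    \<open>d\<close> mean zero, which complements require.\<close>
  have sp: "space M \<in> cylinder_sets"
    unfolding cylinder_sets_def by (intro CollectI exI[of _ "{}"] exI[of _ "\<lambda>_. UNIV"]) auto
  have Ed: "expectation d = 0"
  proof -
    have "expectation d = expectation (\<lambda>\<omega>. d \<omega> * indicator (space M) \<omega>)"
      by (intro Bochner_Integration.integral_cong refl) simp
    then show ?thesis using expectation_cylinder_zero[OF d orth sp] by simp
  qed
  have "S \<in> sigma_sets (space M) cylinder_sets" using S sets_sigma_B_subset by blast
  then show ?thesis
  proof (induction rule: sigma_sets_induct_disjoint[OF Int_stable_cylinder_sets cylinder_sets_Pow, consumes 1, case_names basic empty compl union])
    case (basic a)
    show ?case by (rule expectation_cylinder_zero[OF d orth basic])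
  next
    case empty
    show ?case by simp
  next
    case (compl a)
    then have a: "a \<in> sets M" using sm by blast
    have "expectation (\<lambda>\<omega>. d \<omega> * indicator (space M - a) \<omega>) = expectation (\<lambda>\<omega>. d \<omega> - d \<omega> * indicator a \<omega>)"
      by (intro Bochner_Integration.integral_cong refl) (simp add: indicator_def)
    then show ?case using d i[OF a] compl Ed by simp
  next
    case (union a)
    have am: "a k \<in> sets M" for k using union sm by blast
    have "(\<lambda>n. expectation (\<lambda>\<omega>. d \<omega> * (\<Sum>k<n. indicator (a k) \<omega>))) \<longlonglongrightarrow> expectation (\<lambda>\<omega>. d \<omega> * indicator (\<Union>k. a k) \<omega>)"
    proof (rule integral_dominated_convergence[where w = "\<lambda>\<omega>. \<bar>d \<omega>\<bar>"])
      have s: "(\<lambda>n. \<Sum>k<n. indicator (a k) \<omega> :: real) \<longlonglongrightarrow> indicator (\<Union>k. a k) \<omega>" for \<omega>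
        using indicator_sums[of a \<omega>] union(1) unfolding sums_def disjoint_family_on_def by simp
      then show "AE \<omega> in M. (\<lambda>n. d \<omega> * (\<Sum>k<n. indicator (a k) \<omega>)) \<longlonglongrightarrow> d \<omega> * indicator (\<Union>k. a k) \<omega>"
        by (intro AE_I2 tendsto_mult tendsto_const)
      have le1: "(\<Sum>k<n. indicator (a k) \<omega> :: real) \<le> 1" for n \<omega>
      proof -
        have "(\<Sum>k<n. indicator (a k) \<omega> :: real) \<le> indicator (\<Union>k. a k) \<omega>"
          by (rule incseq_le[OF _ s]) (auto intro!: incseq_SucI)
        also have "\<dots> \<le> 1" by (simp add: indicator_def)
        finally show ?thesis .
      qed
      have ge0: "0 \<le> (\<Sum>k<n. indicator (a k) \<omega> :: real)" for n \<omega> by (intro sum_nonneg) simp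
      show "AE \<omega> in M. norm (d \<omega> * (\<Sum>k<n. indicator (a k) \<omega>)) \<le> \<bar>d \<omega>\<bar>" for n
        using le1 ge0 by (intro AE_I2) (simp add: abs_mult mult_left_le)
    qed (use am d in \<open>auto intro!: borel_measurable_times borel_measurable_sum\<close>)
    moreover have "expectation (\<lambda>\<omega>. d \<omega> * (\<Sum>k<n. indicator (a k) \<omega>)) = 0" for n
      unfolding sum_distrib_left using i[OF am] union by (subst Bochner_Integration.integral_sum) auto
    ultimately show ?case by (simp add: LIMSEQ_const_iff)
  qed
qed

text \<open>The tested expectations of both divergences agree, so their difference is orthogonal to
  all cylindrical variables and hence to all sets of \<open>sigma_B\<close>. Testing on the sets
  where it is positive and where it is negative makes it vanish.\<close>

lemma divergence_unique:
  assumes "is_divergence U X" "is_divergence U' X'" and UU: "AE \<omega> in M. U \<omega> = U' \<omega>"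
  shows "AE \<omega> in M. X \<omega> = X' \<omega>"
proof -
  have sqX: "square_integrable M X" "square_integrable M X'" and Um: "U \<in> borel_measurable M" "U' \<in> borel_measurable M"
    using assms(1,2) by (auto simp: is_divergence_def square_integrable_def)
  have Xm[measurable]: "X \<in> borel_measurable M" "X' \<in> borel_measurable M"
    using sqX by (auto simp: square_integrable_def)
  have "integrable M (\<lambda>\<omega>. (X \<omega>)\<^sup>2)" "integrable M (\<lambda>\<omega>. (X' \<omega>)\<^sup>2)"
    using sqX by (auto simp: square_integrable_def)
  then have iX: "integrable M X" "integrable M X'"
    using square_integrable_imp_integrable[OF Xm(1)] square_integrable_imp_integrable[OF Xm(2)] by blast+
  obtain Y Y' where Y: "Y \<in> borel_measurable sigma_B" "AE \<omega> in M. X \<omega> = Y \<omega>"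
    and Y': "Y' \<in> borel_measurable sigma_B" "AE \<omega> in M. X' \<omega> = Y' \<omega>"
    using assms(1,2) unfolding is_divergence_def by blast
  have [measurable]: "Y \<in> borel_measurable M" "Y' \<in> borel_measurable M"
    using Y(1) Y'(1) by (auto intro: sigma_B_measurable)
  \<comment> \<open>Built from the \<open>sigma_B\<close>-measurable versions, so that the sets
    where it has a given sign belong to \<open>sigma_B\<close>.\<close>
  define d where "d \<omega> = Y \<omega> - Y' \<omega>" for \<omega>
  have dB: "d \<in> borel_measurable sigma_B" unfolding d_def[abs_def] using Y(1) Y'(1) by measurable
  have dm[measurable]: "d \<in> borel_measurable M" by (rule sigma_B_measurable[OF dB])
  have ae: "AE \<omega> in M. X \<omega> - X' \<omega> = d \<omega>" using Y(2) Y'(2) by eventually_elim (simp add: d_def)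
  have id: "integrable M d"
    by (rule integrable_cong_AE_imp[OF Bochner_Integration.integrable_diff[OF iX] dm])
      (use ae in eventually_elim, simp)
  have orth: "expectation (\<lambda>\<omega>. cylindrical m \<phi> g \<omega> * d \<omega>) = 0" if \<phi>: "\<phi> \<in> Cb_infinity m" for m g \<phi>
  proof -
    have [measurable]: "cylindrical m \<phi> g \<in> borel_measurable M" by (rule cylindrical_measurable[OF \<phi>])
    have "expectation (\<lambda>\<omega>. cylindrical m \<phi> g \<omega> * d \<omega>)
        = expectation (\<lambda>\<omega>. cylindrical m \<phi> g \<omega> * X \<omega> - cylindrical m \<phi> g \<omega> * X' \<omega>)"
      by (rule integral_cong_AE) (use ae in \<open>auto elim!: eventually_mono simp: right_diff_distrib[symmetric]\<close>)
    also have "\<dots> = expectation (\<lambda>\<omega>. cylindrical m \<phi> g \<omega> * X \<omega>) - expectation (\<lambda>\<omega>. cylindrical m \<phi> g \<omega> * X' \<omega>)"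
      by (intro Bochner_Integration.integral_diff cylindrical_mult_integrable \<phi> iX)
    also have "\<dots> = expectation (\<lambda>\<omega>. inner (malliavin_derivative m \<phi> g \<omega>) (U \<omega>)) - expectation (\<lambda>\<omega>. inner (malliavin_derivative m \<phi> g \<omega>) (U' \<omega>))"
      using assms(1,2) \<phi> unfolding is_divergence_def by simp
    also have "expectation (\<lambda>\<omega>. inner (malliavin_derivative m \<phi> g \<omega>) (U \<omega>))
        = expectation (\<lambda>\<omega>. inner (malliavin_derivative m \<phi> g \<omega>) (U' \<omega>))"
    proof (rule integral_cong_AE[OF inner_malliavin_measurable[OF \<phi> Um(1)] inner_malliavin_measurable[OF \<phi> Um(2)]])
      show "AE \<omega> in M. inner (malliavin_derivative m \<phi> g \<omega>) (U \<omega>) = inner (malliavin_derivative m \<phi> g \<omega>) (U' \<omega>)"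
        using UU by eventually_elim simp
    qed
    finally show ?thesis by simp
  qed
  have zero: "AE \<omega> in M. d \<omega> * indicator S \<omega> = 0"
    if S: "S \<in> sets sigma_B" and sgn: "\<And>\<omega>. 0 \<le> c * (d \<omega> * indicator S \<omega>)" and c: "c \<noteq> 0" for S and c :: real
  proof -
    have SM: "S \<in> sets M" using S sets_sigma_B by blast
    have i: "integrable M (\<lambda>\<omega>. c * (d \<omega> * indicator S \<omega>))"
      using integrable_mult_indicator[OF SM id] by (auto simp: mult.commute intro: integrable_mult_right)
    have "expectation (\<lambda>\<omega>. c * (d \<omega> * indicator S \<omega>)) = 0"
      using expectation_sigma_B_zero[OF id orth S] by simp
    then have "AE \<omega> in M. c * (d \<omega> * indicator S \<omega>) = 0"
      using integral_nonneg_eq_0_iff_AE[OF i] sgn by simp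
    then show ?thesis by eventually_elim (use c in simp)
  qed
  have pos: "{\<omega> \<in> space sigma_B. 0 < d \<omega>} \<in> sets sigma_B" and neg: "{\<omega> \<in> space sigma_B. d \<omega> < 0} \<in> sets sigma_B"
    using dB by measurable
  have "AE \<omega> in M. d \<omega> * indicator {\<omega> \<in> space sigma_B. 0 < d \<omega>} \<omega> = 0"
    by (rule zero[OF pos, of 1]) (auto simp: indicator_def)
  moreover have "AE \<omega> in M. d \<omega> * indicator {\<omega> \<in> space sigma_B. d \<omega> < 0} \<omega> = 0"
    by (rule zero[OF neg, of "-1"]) (auto simp: indicator_def)
  ultimately show ?thesis using ae AE_space
  proof eventually_elim
    case (elim \<omega>)
    have "d \<omega> = 0"
      using elim(1,2,4) by (cases "d \<omega>" "0::real" rule: linorder_cases) (auto simp: space_sigma_B)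
    then show ?case using elim(3) by simp
  qed
qed

lemma iterated_fWIS_unique:
  assumes I: "iterated_fWIS I" and t: "0 \<le> t"
  shows "AE \<omega> in M. I n t \<omega> = chaos n t \<omega>"
  using t
proof (induction n arbitrary: t)
  case 0
  then show ?case using I unfolding iterated_fWIS_def by (intro AE_I2) (simp add: chaos_def)
next
  case (Suc n)
  have "is_fWIS_integral (I n) t (I (Suc n) t)" using I Suc.prems unfolding iterated_fWIS_def by blast
  then obtain U where m: "(\<lambda>(s, \<omega>). indicator {0..t} s * I n s \<omega>) \<in> borel_measurable (lborel \<Otimes>\<^sub>M M)"
    and U: "AE \<omega> in M. represents (\<lambda>s. indicator {0..t} s * I n s \<omega>) (U \<omega>)" "is_divergence U (I (Suc n) t)"
    unfolding is_fWIS_integral_def by blast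
  interpret P: pair_sigma_finite lborel M ..
  have m': "(\<lambda>z. indicator {0..t} (fst z) * I n (fst z) (snd z)) \<in> borel_measurable (lborel \<Otimes>\<^sub>M M)"
    using m by (simp add: case_prod_beta')
  have mc: "(\<lambda>z. indicator {0..t} (fst z) * chaos n (fst z) (snd z)) \<in> borel_measurable (lborel \<Otimes>\<^sub>M M)"
    using chaos_joint_measurable[of n] by measurable
  \<comment> \<open>The induction hypothesis has an exceptional null set for every time. Fubini
    exchanges the quantifiers, for which the joint measurability demanded by
    \<open>is_fWIS_integral\<close> is essential; the representing vectors then coincide by
    \<open>represents_unique_AE\<close>.\<close>
  have "(AE s in lborel. AE \<omega> in M. indicator {0..t} s * I n s \<omega> = indicator {0..t} s * chaos n s \<omega>) \<longleftrightarrow>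
      (AE \<omega> in M. AE s in lborel. indicator {0..t} s * I n s \<omega> = indicator {0..t} s * chaos n s \<omega>)"
    by (rule P.AE_commute) (rule borel_measurable_eq[OF m' mc])
  moreover have "AE s in lborel. AE \<omega> in M. indicator {0..t} s * I n s \<omega> = indicator {0..t} s * chaos n s \<omega>"
  proof (rule AE_I2)
    fix s :: real
    show "AE \<omega> in M. indicator {0..t} s * I n s \<omega> = indicator {0..t} s * chaos n s \<omega>"
    proof (cases "s \<in> {0..t}")
      case True
      then have "0 \<le> s" by simp
      from Suc.IH[OF this] show ?thesis by eventually_elim simp
    qed simp
  qed
  ultimately have ae: "AE \<omega> in M. AE s in lborel. indicator {0..t} s * I n s \<omega> = indicator {0..t} s * chaos n s \<omega>"
    by blast
  have "AE \<omega> in M. U \<omega> = chaos_integrand n t \<omega>"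
    using U(1) ae AE_space
  proof eventually_elim
    case (elim \<omega>)
    show ?case
      by (rule represents_unique_AE[OF elim(1) riemann_vec_tendsto(2)[OF Suc.prems elim(3)]])
        (use elim(2) in \<open>auto elim!: eventually_mono\<close>)
  qed
  then show ?case by (rule divergence_unique[OF U(2) chaos_is_divergence[OF Suc.prems]])
qed

end

section \<open>The almost sure growth rate\<close>

lemma std_normal_density_le_1: "std_normal_density x \<le> 1"
proof -
  have "1 \<le> sqrt (2 * pi)" using pi_ge_two by (intro real_le_rsqrt) simp
  then have "1 / sqrt (2 * pi) \<le> 1" by simp
  moreover have "exp (- x\<^sup>2 / 2) \<le> 1" by simp
  ultimately have "1 / sqrt (2 * pi) * exp (- x\<^sup>2 / 2) \<le> 1 * 1" by (intro mult_mono) auto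
  then show ?thesis by (simp add: normal_density_def)
qed

lemma (in prob_space) std_normal_small_ball:
  assumes D: "distributed M lborel Z std_normal_density" and r: "0 \<le> r"
  shows "prob {\<omega> \<in> space M. \<bar>Z \<omega> - a\<bar> < r} \<le> 2 * r"
proof -
  let ?A = "{a - r<..<a + r}"
  have i: "integrable lborel (\<lambda>x. indicator ?A x :: real)"
    by (rule integrable_real_indicator) (auto simp: emeasure_lborel_Ioo r)
  have "{\<omega> \<in> space M. \<bar>Z \<omega> - a\<bar> < r} = Z -` ?A \<inter> space M" by (auto simp: abs_less_iff)
  then have "prob {\<omega> \<in> space M. \<bar>Z \<omega> - a\<bar> < r} = expectation (indicator (Z -` ?A \<inter> space M))"
    by simp
  also have "\<dots> = expectation (\<lambda>\<omega>. indicator ?A (Z \<omega>))"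
    by (intro Bochner_Integration.integral_cong refl) (auto simp: indicator_def)
  also have "\<dots> = (\<integral>x. std_normal_density x * indicator ?A x \<partial>lborel)"
    by (rule distributed_integral[OF D, symmetric]) auto
  also have "\<dots> \<le> (\<integral>x. indicator ?A x \<partial>lborel)"
  proof (rule integral_mono[OF _ i])
    show "integrable lborel (\<lambda>x. std_normal_density x * indicator ?A x)"
      by (rule Bochner_Integration.integrable_bound[OF i])
        (auto simp: indicator_def std_normal_density_le_1 normal_density_nonneg)
  qed (auto simp: indicator_def std_normal_density_le_1)
  also have "\<dots> = 2 * r" using r by simp
  finally show ?thesis .
qed

lemma (in prob_space) std_normal_separated_from_roots:
  assumes D: "distributed M lborel Z std_normal_density"
  shows "AE \<omega> in M. eventually (\<lambda>n. \<forall>z. poly (map_poly complex_of_real (herm n)) z = 0 \<longrightarrow>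
      1 / real n ^ 3 \<le> \<bar>Z \<omega> - Re z\<bar>) sequentially"
proof -
  have [measurable]: "Z \<in> borel_measurable M" using D by (auto simp: distributed_def)
  define R where "R n = {z. poly (map_poly complex_of_real (herm n)) z = 0}" for n
  have nz: "map_poly complex_of_real (herm n) \<noteq> 0" for n using herm_nonzero by (simp add: map_poly_eq_0_iff)
  have fR: "finite (R n)" for n unfolding R_def by (rule poly_roots_finite[OF nz])
  have cR: "card (R n) \<le> n" for n
    unfolding R_def using card_poly_roots_bound[OF nz[of n]] degree_herm_le[of n]
    by (simp add: degree_map_poly)
  define E where "E n = (\<Union>z\<in>R n. {\<omega> \<in> space M. \<bar>Z \<omega> - Re z\<bar> < 1 / real n ^ 3})" for n
  have Em: "E n \<in> sets M" for n unfolding E_def by (intro sets.finite_UN fR) measurable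
  have PE: "prob (E n) \<le> 2 / real n ^ 2" for n
  proof (cases "n = 0")
    \<comment> \<open>At \<open>n = 0\<close> the bound \<open>2 / real n ^ 2\<close> is
      \<open>0\<close>; it holds because \<open>herm 0\<close> has no roots.\<close>
    case True
    then have "R n = {}" using cR[of n] fR[of n] by simp
    then show ?thesis by (simp add: E_def True)
  next
    case False
    have "prob (E n) \<le> (\<Sum>z\<in>R n. prob {\<omega> \<in> space M. \<bar>Z \<omega> - Re z\<bar> < 1 / real n ^ 3})"
      unfolding E_def by (intro finite_measure_subadditive_finite fR) auto
    also have "\<dots> \<le> (\<Sum>z\<in>R n. 2 * (1 / real n ^ 3))"
      by (intro sum_mono std_normal_small_ball[OF D]) simp
    also have "\<dots> = real (card (R n)) * (2 / real n ^ 3)" by simp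
    also have "\<dots> \<le> real n * (2 / real n ^ 3)" using cR[of n] by (intro mult_right_mono) auto
    also have "\<dots> = 2 / real n ^ 2" using False by (simp add: power3_eq_cube power2_eq_square)
    finally show ?thesis .
  qed
  have "summable (\<lambda>n. 2 * inverse (real n ^ 2))"
    by (intro summable_mult inverse_power_summable) simp
  then have "summable (\<lambda>n. prob (E n))"
    by (rule summable_comparison_test'[where N = 0]) (use PE in \<open>auto simp: divide_inverse\<close>)
  then have "AE \<omega> in M. eventually (\<lambda>n. \<omega> \<in> space M - E n) sequentially"
    by (intro borel_cantelli_AE1 Em) (auto simp: emeasure_eq_measure)
  then show ?thesis
  proof eventually_elim
    case (elim \<omega>)
    then show ?case by eventually_elim (auto simp: E_def R_def not_less)
  qed
qed

text \<open>The first conjunct keeps the second from being vacuous: iterated integrals exist, with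
  \<open>chaos\<close> as witness. The growth rate is claimed for every family of versions, each of
  which agrees with \<open>chaos\<close> almost surely at time \<open>t\<close>.\<close>

theorem corollary3p4:
  fixes M :: "'a measure" and H t :: real and B :: "real \<Rightarrow> 'a \<Rightarrow> real"
    and \<iota> :: "(real \<Rightarrow> real) \<Rightarrow> 'h::{real_inner, complete_space}"
    and W :: "'h \<Rightarrow> 'a \<Rightarrow> real"
  assumes "1 / 2 < H" and "H < 1"
    and "fbm_wiener_integral M H B \<iota> W"
    and "0 < t" and "t \<noteq> 1"
  shows "(\<exists>I. fbm_wiener_integral.iterated_fWIS M H B \<iota> W I) \<and>
         (\<forall>I. fbm_wiener_integral.iterated_fWIS M H B \<iota> W I \<longrightarrow>
           (AE \<omega> in M.
              ereal H = limsup (\<lambda>n. ereal (1 / (2 * ln t) *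
                ln (2 * \<bar>Gamma (real n / 2 + 1) * I n t \<omega>\<bar> powr (2 / real n))))))"
proof -
  interpret regular_fbm M H B \<iota> W
    by (intro regular_fbm.intro regular_fbm_axioms.intro assms)
  have "AE \<omega> in M. ereal H = limsup (\<lambda>n. ereal (1 / (2 * ln t) *
                ln (2 * \<bar>Gamma (real n / 2 + 1) * I n t \<omega>\<bar> powr (2 / real n))))"
    if I: "iterated_fWIS I" for I
  proof -
    \<comment> \<open>Time is fixed and there are countably many orders, so a single null set serves
      all of them.\<close>
    have "AE \<omega> in M. \<forall>n. I n t \<omega> = chaos n t \<omega>"
      unfolding AE_all_countable using iterated_fWIS_unique[OF I] assms(4) by auto
    moreover have "AE \<omega> in M. \<forall>n. chaos n t \<omega> = (t powr H) ^ n * poly (herm n) (B t \<omega> / t powr H)"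
      unfolding AE_all_countable using chaos_AE[OF assms(4)] by auto
    ultimately show ?thesis using std_normal_separated_from_roots[OF B_distributed[OF assms(4)]]
    proof eventually_elim
      case (elim \<omega>)
      have "0 < t powr H" using assms(4) by simp
      from herm_log_asymptotics[OF elim(3) this]
      have "(\<lambda>n. ln (2 * \<bar>Gamma (real n / 2 + 1) * I n t \<omega>\<bar> powr (2 / real n))) \<longlonglongrightarrow> 2 * ln (t powr H)"
        using elim(1,2) by simp
      then have "(\<lambda>n. 1 / (2 * ln t) * ln (2 * \<bar>Gamma (real n / 2 + 1) * I n t \<omega>\<bar> powr (2 / real n)))
          \<longlonglongrightarrow> 1 / (2 * ln t) * (2 * ln (t powr H))"
        by (intro tendsto_mult tendsto_const)
      \<comment> \<open>\<open>ln (t powr H)\<close> is \<open>H * ln t\<close>, and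
        \<open>t \<noteq> 1\<close> makes \<open>ln t\<close> nonzero, so it cancels.\<close>
      moreover have "1 / (2 * ln t) * (2 * ln (t powr H)) = H"
        using assms(4,5) by (simp add: ln_powr)
      ultimately have "(\<lambda>n. ereal (1 / (2 * ln t) *
                ln (2 * \<bar>Gamma (real n / 2 + 1) * I n t \<omega>\<bar> powr (2 / real n)))) \<longlonglongrightarrow> ereal H"
        by simp
      then show ?case by (intro lim_imp_Limsup[symmetric]) auto
    qed
  qed
  then show ?thesis using chaos_iterated by blast
qed

end
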